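(* Let $(\mathcal{M},\otimes,\mathbf{1},\sigma)$ be a braided monoidal category which has equalizers and coequalizers that are preserved by $\otimes$, and let $A$ be an object in $\mathsf{Hopf}_{\mathrm{coc}}(\mathcal{M})$. Then there is a bijective correspondence between: 1) subobjects $i:K\to A$ of $A$ in $\mathsf{Hopf}_{\mathrm{coc}}(\mathcal{M})$ such that $i$ is the equalizer in $\mathcal{M}$ of the pair $q_{A,A}(u_A\otimes\mathrm{Id}_A),\ q_{A,A}(\mathrm{Id}_A\otimes u_A):A\to A\otimes_K A$; 2) quotients $\pi:A\to Q$ of $A$ in $\mathsf{Comon}_{\mathrm{coc}}({}_A\mathcal{M})$ such that $\pi$ is the coequalizer in $\mathcal{M}$ of the pair $(\varepsilon_A\otimes\mathrm{Id}_A)e_{A,A},\ (\mathrm{Id}_A\otimes\varepsilon_A)e_{A,A}:A\square_Q A\to A$. The mutually inverse bijections are given by $\phi_A$ and $\psi_A$, where $\phi_A(i)$ is the coequalizer in $\mathcal{M}$ of $m_A(\mathrm{Id}_A\otimes i),\ \mathrm{Id}_A\otimes\varepsilon_K:A\otimes K\to A$, and $\psi_A(\pi)$ is the equalizer in $\mathcal{M}$ of $(\pi\otimes\mathrm{Id}_A)\Delta_A,\ \pi u_A\otimes\mathrm{Id}_A:A\to Q\otimes A$.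
   Context: Associativity and unit constraints are suppressed. "Preserved by $\otimes$" means preserved by $M\otimes(-)$ and $(-)\otimes M$ for every object $M$ of $\mathcal{M}$. $\mathsf{Hopf}_{\mathrm{coc}}(\mathcal{M})$ is the category of Hopf monoids $(A,m_A,u_A,\Delta_A,\varepsilon_A,S_A)$ in $\mathcal{M}$ with $\sigma_{A,A}\Delta_A=\Delta_A$ and Hopf monoid morphisms. $\mathsf{Comon}_{\mathrm{coc}}({}_A\mathcal{M})$: objects are cocommutative comonoids $Q$ in $\mathcal{M}$ with a left $A$-action $\mu_Q:A\otimes Q\to Q$ such that $\Delta_Q$ and $\varepsilon_Q$ are left $A$-linear, where $Q\otimes Q$ has action $(\mu_Q\otimes\mu_Q)(\mathrm{Id}_A\otimes\sigma_{A,Q}\otimes\mathrm{Id}_Q)(\Delta_A\otimes\mathrm{Id}_{Q\otimes Q})$ and $\mathbf{1}$ has action $\varepsilon_A$; morphisms are left $A$-linear comonoid morphisms. $A$ is an object of it with action $m_A$. A subobject of $A$ in $\mathsf{Hopf}_{\mathrm{coc}}(\mathcal{M})$ is an isomorphism class of monomorphisms $i:K\to A$ in $\mathsf{Hopf}_{\mathrm{coc}}(\mathcal{M})$; a quotient of $A$ in $\mathsf{Comon}_{\mathrm{coc}}({}_A\mathcal{M})$ is an isomorphism class of epimorphisms $\pi:A\to Q$ in $\mathsf{Comon}_{\mathrm{coc}}({}_A\mathcal{M})$. $q_{A,A}:A\otimes A\to A\otimes_K A$ is the coequalizer in $\mathcal{M}$ of $m_A(\mathrm{Id}_A\otimes i)\otimes\mathrm{Id}_A$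 and $\mathrm{Id}_A\otimes m_A(i\otimes\mathrm{Id}_A)$, $A\otimes K\otimes A\to A\otimes A$. $e_{A,A}:A\square_Q A\to A\otimes A$ is the equalizer in $\mathcal{M}$ of $(\mathrm{Id}_A\otimes\pi)\Delta_A\otimes\mathrm{Id}_A$ and $\mathrm{Id}_A\otimes(\pi\otimes\mathrm{Id}_A)\Delta_A$, $A\otimes A\to A\otimes Q\otimes A$. The codomain $Q$ of $\phi_A(i)$ is regarded as an object of $\mathsf{Comon}_{\mathrm{coc}}({}_A\mathcal{M})$ with the unique structure making $\phi_A(i)$ a morphism there, and the domain (denoted $A^{\mathrm{co}Q}$) of $\psi_A(\pi)$ is regarded as an object of $\mathsf{Hopf}_{\mathrm{coc}}(\mathcal{M})$ with the unique structure making $\psi_A(\pi)$ a Hopf monoid morphism. *)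

theory Defs
  imports Main
begin

section \<open>Categories\<close>

record ('o, 'a) category =
  Obj :: "'o set"
  Arr :: "'a set"
  Dom :: "'a \<Rightarrow> 'o"
  Cod :: "'a \<Rightarrow> 'o"
  Ident :: "'o \<Rightarrow> 'a"  ("\<I>\<index>")
  Comp :: "'a \<Rightarrow> 'a \<Rightarrow> 'a"  (infixr "\<cdot>\<index>" 55)

definition hom :: "('o, 'a, 'z) category_scheme \<Rightarrow> 'o \<Rightarrow> 'o \<Rightarrow> 'a set" where
  "hom C a b = {f \<in> Arr C. Dom C f = a \<and> Cod C f = b}"

locale category =
  fixes C :: "('o, 'a, 'z) category_scheme" (structure)
  assumes Dom_Obj: "f \<in> Arr C \<Longrightarrow> Dom C f \<in> Obj C"
    and Cod_Obj: "f \<in> Arr C \<Longrightarrow> Cod C f \<in> Obj C"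
    and Ident_hom: "a \<in> Obj C \<Longrightarrow> \<I> a \<in> hom C a a"
    and Comp_hom: "\<lbrakk>f \<in> hom C a b; g \<in> hom C b c\<rbrakk> \<Longrightarrow> g \<cdot> f \<in> hom C a c"
    and Comp_Ident: "f \<in> hom C a b \<Longrightarrow> f \<cdot> \<I> a = f"
    and Ident_Comp: "f \<in> hom C a b \<Longrightarrow> \<I> b \<cdot> f = f"
    and Comp_assoc: "\<lbrakk>f \<in> hom C a b; g \<in> hom C b c; h \<in> hom C c d\<rbrakk> \<Longrightarrow>
      (h \<cdot> g) \<cdot> f = h \<cdot> (g \<cdot> f)"

context
  fixes C :: "('o, 'a, 'z) category_scheme" (structure)
begin

definition inverse_arrows :: "'a \<Rightarrow> 'a \<Rightarrow> bool" where
  "inverse_arrows f g \<longleftrightarrow> f \<in> Arr C \<and> g \<in> hom C (Cod C f) (Dom C f) \<and>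
     g \<cdot> f = \<I> (Dom C f) \<and> f \<cdot> g = \<I> (Cod C f)"

definition is_iso :: "'a \<Rightarrow> bool" where
  "is_iso f \<longleftrightarrow> (\<exists>g. inverse_arrows f g)"

definition inv_arr :: "'a \<Rightarrow> 'a" where
  "inv_arr f = (THE g. inverse_arrows f g)"

definition is_mono :: "'a \<Rightarrow> bool" where
  "is_mono f \<longleftrightarrow> f \<in> Arr C \<and>
     (\<forall>x. \<forall>g \<in> hom C x (Dom C f). \<forall>h \<in> hom C x (Dom C f). f \<cdot> g = f \<cdot> h \<longrightarrow> g = h)"

definition is_epi :: "'a \<Rightarrow> bool" where
  "is_epi f \<longleftrightarrow> f \<in> Arr C \<and>
     (\<forall>x. \<forall>g \<in> hom C (Cod C f) x. \<forall>h \<in> hom C (Cod C f) x. g \<cdot> f = h \<cdot> f \<longrightarrow> g = h)"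

definition parallel :: "'a \<Rightarrow> 'a \<Rightarrow> bool" where
  "parallel f g \<longleftrightarrow> f \<in> Arr C \<and> g \<in> Arr C \<and> Dom C f = Dom C g \<and> Cod C f = Cod C g"

definition is_equalizer :: "'a \<Rightarrow> 'a \<Rightarrow> 'a \<Rightarrow> bool" where
  "is_equalizer f g e \<longleftrightarrow> parallel f g \<and> e \<in> Arr C \<and> Cod C e = Dom C f \<and> f \<cdot> e = g \<cdot> e \<and>
     (\<forall>h \<in> Arr C. Cod C h = Dom C f \<and> f \<cdot> h = g \<cdot> h \<longrightarrow>
        (\<exists>!k. k \<in> hom C (Dom C h) (Dom C e) \<and> e \<cdot> k = h))"

definition is_coequalizer :: "'a \<Rightarrow> 'a \<Rightarrow> 'a \<Rightarrow> bool" where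
  "is_coequalizer f g q \<longleftrightarrow> parallel f g \<and> q \<in> Arr C \<and> Dom C q = Cod C f \<and> q \<cdot> f = q \<cdot> g \<and>
     (\<forall>h \<in> Arr C. Dom C h = Cod C f \<and> h \<cdot> f = h \<cdot> g \<longrightarrow>
        (\<exists>!k. k \<in> hom C (Cod C q) (Cod C h) \<and> k \<cdot> q = h))"

definition has_equalizers :: bool where
  "has_equalizers \<longleftrightarrow> (\<forall>f g. parallel f g \<longrightarrow> (\<exists>e. is_equalizer f g e))"

definition has_coequalizers :: bool where
  "has_coequalizers \<longleftrightarrow> (\<forall>f g. parallel f g \<longrightarrow> (\<exists>q. is_coequalizer f g q))"

definition monos_into :: "'o \<Rightarrow> 'a set" where
  "monos_into a = {i. is_mono i \<and> Cod C i = a}"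

definition subobjects :: "'o \<Rightarrow> 'a set set" where
  "subobjects a = monos_into a //
     {(i, j). i \<in> monos_into a \<and> j \<in> monos_into a \<and>
        (\<exists>t \<in> hom C (Dom C i) (Dom C j). is_iso t \<and> j \<cdot> t = i)}"

definition epis_from :: "'o \<Rightarrow> 'a set" where
  "epis_from a = {p. is_epi p \<and> Dom C p = a}"

definition quotients :: "'o \<Rightarrow> 'a set set" where
  "quotients a = epis_from a //
     {(p, r). p \<in> epis_from a \<and> r \<in> epis_from a \<and>
        (\<exists>t \<in> hom C (Cod C p) (Cod C r). is_iso t \<and> t \<cdot> p = r)}"

end


section \<open>Braided monoidal categories\<close>

text \<open>Monoidal categories are not assumed strict; the associativity constraint \<open>\<a>\<close> and the unit
  constraints \<open>\<l>\<close>, \<open>\<r>\<close> are inserted explicitly wherever the usual notation suppresses them.\<close>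

record ('o, 'a) monoidal_category = "('o, 'a) category" +
  tensor_obj :: "'o \<Rightarrow> 'o \<Rightarrow> 'o"  (infixl "\<odot>\<index>" 70)
  tensor_arr :: "'a \<Rightarrow> 'a \<Rightarrow> 'a"  (infixl "\<otimes>\<index>" 70)
  unit_obj :: "'o"  ("\<one>\<index>")
  assoc :: "'o \<Rightarrow> 'o \<Rightarrow> 'o \<Rightarrow> 'a"  ("\<a>\<index>")
  lunit :: "'o \<Rightarrow> 'a"  ("\<l>\<index>")
  runit :: "'o \<Rightarrow> 'a"  ("\<r>\<index>")

record ('o, 'a) braided_category = "('o, 'a) monoidal_category" +
  braid :: "'o \<Rightarrow> 'o \<Rightarrow> 'a"  ("\<sigma>\<index>")

locale monoidal_category = category C
  for C :: "('o, 'a, 'z) monoidal_category_scheme" (structure) +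
  assumes unit_Obj: "\<one> \<in> Obj C"
    and tensor_Obj: "\<lbrakk>a \<in> Obj C; b \<in> Obj C\<rbrakk> \<Longrightarrow> a \<odot> b \<in> Obj C"
    and tensor_hom: "\<lbrakk>f \<in> hom C a b; g \<in> hom C c d\<rbrakk> \<Longrightarrow> f \<otimes> g \<in> hom C (a \<odot> c) (b \<odot> d)"
    and tensor_Ident: "\<lbrakk>a \<in> Obj C; b \<in> Obj C\<rbrakk> \<Longrightarrow> \<I> a \<otimes> \<I> b = \<I> (a \<odot> b)"
    and tensor_Comp: "\<lbrakk>f \<in> hom C a b; g \<in> hom C b c; f' \<in> hom C a' b'; g' \<in> hom C b' c'\<rbrakk> \<Longrightarrow>
      (g \<cdot> f) \<otimes> (g' \<cdot> f') = (g \<otimes> g') \<cdot> (f \<otimes> f')"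
    and assoc_hom: "\<lbrakk>a \<in> Obj C; b \<in> Obj C; c \<in> Obj C\<rbrakk> \<Longrightarrow>
      \<a> a b c \<in> hom C (a \<odot> b \<odot> c) (a \<odot> (b \<odot> c))"
    and assoc_iso: "\<lbrakk>a \<in> Obj C; b \<in> Obj C; c \<in> Obj C\<rbrakk> \<Longrightarrow> is_iso C (\<a> a b c)"
    and assoc_natural: "\<lbrakk>f \<in> hom C a a'; g \<in> hom C b b'; h \<in> hom C c c'\<rbrakk> \<Longrightarrow>
      \<a> a' b' c' \<cdot> (f \<otimes> g \<otimes> h) = (f \<otimes> (g \<otimes> h)) \<cdot> \<a> a b c"
    and lunit_hom: "a \<in> Obj C \<Longrightarrow> \<l> a \<in> hom C (\<one> \<odot> a) a"
    and lunit_iso: "a \<in> Obj C \<Longrightarrow> is_iso C (\<l> a)"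
    and lunit_natural: "f \<in> hom C a b \<Longrightarrow> \<l> b \<cdot> (\<I> \<one> \<otimes> f) = f \<cdot> \<l> a"
    and runit_hom: "a \<in> Obj C \<Longrightarrow> \<r> a \<in> hom C (a \<odot> \<one>) a"
    and runit_iso: "a \<in> Obj C \<Longrightarrow> is_iso C (\<r> a)"
    and runit_natural: "f \<in> hom C a b \<Longrightarrow> \<r> b \<cdot> (f \<otimes> \<I> \<one>) = f \<cdot> \<r> a"
    and pentagon: "\<lbrakk>a \<in> Obj C; b \<in> Obj C; c \<in> Obj C; d \<in> Obj C\<rbrakk> \<Longrightarrow>
      \<a> a b (c \<odot> d) \<cdot> \<a> (a \<odot> b) c d =
      (\<I> a \<otimes> \<a> b c d) \<cdot> \<a> a (b \<odot> c) d \<cdot> (\<a> a b c \<otimes> \<I> d)"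
    and triangle: "\<lbrakk>a \<in> Obj C; b \<in> Obj C\<rbrakk> \<Longrightarrow> (\<I> a \<otimes> \<l> b) \<cdot> \<a> a \<one> b = \<r> a \<otimes> \<I> b"

locale braided_monoidal_category = monoidal_category C
  for C :: "('o, 'a, 'z) braided_category_scheme" (structure) +
  assumes braid_hom: "\<lbrakk>a \<in> Obj C; b \<in> Obj C\<rbrakk> \<Longrightarrow> \<sigma> a b \<in> hom C (a \<odot> b) (b \<odot> a)"
    and braid_iso: "\<lbrakk>a \<in> Obj C; b \<in> Obj C\<rbrakk> \<Longrightarrow> is_iso C (\<sigma> a b)"
    and braid_natural: "\<lbrakk>f \<in> hom C a a'; g \<in> hom C b b'\<rbrakk> \<Longrightarrow>
      \<sigma> a' b' \<cdot> (f \<otimes> g) = (g \<otimes> f) \<cdot> \<sigma> a b"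
    and hexagon1: "\<lbrakk>a \<in> Obj C; b \<in> Obj C; c \<in> Obj C\<rbrakk> \<Longrightarrow>
      \<a> b c a \<cdot> \<sigma> a (b \<odot> c) \<cdot> \<a> a b c =
      (\<I> b \<otimes> \<sigma> a c) \<cdot> \<a> b a c \<cdot> (\<sigma> a b \<otimes> \<I> c)"
    and hexagon2: "\<lbrakk>a \<in> Obj C; b \<in> Obj C; c \<in> Obj C\<rbrakk> \<Longrightarrow>
      inv_arr C (\<a> c a b) \<cdot> \<sigma> (a \<odot> b) c \<cdot> inv_arr C (\<a> a b c) =
      (\<sigma> a c \<otimes> \<I> b) \<cdot> inv_arr C (\<a> a c b) \<cdot> (\<I> a \<otimes> \<sigma> b c)"

definition equalizers_preserved_by_tensor :: "('o, 'a, 'z) monoidal_category_scheme \<Rightarrow> bool" where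
  "equalizers_preserved_by_tensor C \<longleftrightarrow>
     (\<forall>f g e. \<forall>x \<in> Obj C. is_equalizer C f g e \<longrightarrow>
        is_equalizer C (\<I>\<^bsub>C\<^esub> x \<otimes>\<^bsub>C\<^esub> f) (\<I>\<^bsub>C\<^esub> x \<otimes>\<^bsub>C\<^esub> g) (\<I>\<^bsub>C\<^esub> x \<otimes>\<^bsub>C\<^esub> e) \<and>
        is_equalizer C (f \<otimes>\<^bsub>C\<^esub> \<I>\<^bsub>C\<^esub> x) (g \<otimes>\<^bsub>C\<^esub> \<I>\<^bsub>C\<^esub> x) (e \<otimes>\<^bsub>C\<^esub> \<I>\<^bsub>C\<^esub> x))"

definition coequalizers_preserved_by_tensor :: "('o, 'a, 'z) monoidal_category_scheme \<Rightarrow> bool" where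
  "coequalizers_preserved_by_tensor C \<longleftrightarrow>
     (\<forall>f g q. \<forall>x \<in> Obj C. is_coequalizer C f g q \<longrightarrow>
        is_coequalizer C (\<I>\<^bsub>C\<^esub> x \<otimes>\<^bsub>C\<^esub> f) (\<I>\<^bsub>C\<^esub> x \<otimes>\<^bsub>C\<^esub> g) (\<I>\<^bsub>C\<^esub> x \<otimes>\<^bsub>C\<^esub> q) \<and>
        is_coequalizer C (f \<otimes>\<^bsub>C\<^esub> \<I>\<^bsub>C\<^esub> x) (g \<otimes>\<^bsub>C\<^esub> \<I>\<^bsub>C\<^esub> x) (q \<otimes>\<^bsub>C\<^esub> \<I>\<^bsub>C\<^esub> x))"


section \<open>Comonoids, Hopf monoids and module comonoids\<close>

record ('o, 'a) comonoid =
  carr :: "'o"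
  comul :: "'a"
  counit :: "'a"

record ('o, 'a) hopf_monoid = "('o, 'a) comonoid" +
  mul :: "'a"
  unit_arr :: "'a"
  antipode :: "'a"

record ('o, 'a) module_comonoid = "('o, 'a) comonoid" +
  act :: "'a"

text \<open>Arrows of a category of structured objects: an arrow of the base category together with its
  structured source and target.\<close>

datatype ('s, 'a) sarr = SArr (src: 's) (und: 'a) (tgt: 's)

context
  fixes C :: "('o, 'a, 'z) braided_category_scheme" (structure)
begin

text \<open>The arrow written \<open>Id \<otimes> \<sigma>\<^bsub>b,c\<^esub> \<otimes> Id\<close> when the constraints are suppressed,
  from \<open>(a \<odot> b) \<odot> (c \<odot> d)\<close> to \<open>(a \<odot> c) \<odot> (b \<odot> d)\<close>.\<close>

definition middle_braid :: "'o \<Rightarrow> 'o \<Rightarrow> 'o \<Rightarrow> 'o \<Rightarrow> 'a" where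
  "middle_braid a b c d =
     inv_arr C (\<a> a c (b \<odot> d)) \<cdot>
     (\<I> a \<otimes> (\<a> c b d \<cdot> (\<sigma> b c \<otimes> \<I> d) \<cdot> inv_arr C (\<a> b c d))) \<cdot>
     \<a> a b (c \<odot> d)"

definition is_cocomm_comonoid :: "('o, 'a, 'y) comonoid_scheme \<Rightarrow> bool" where
  "is_cocomm_comonoid X \<longleftrightarrow>
     (let x = carr X; \<Delta> = comul X; \<epsilon> = counit X in
        x \<in> Obj C \<and> \<Delta> \<in> hom C x (x \<odot> x) \<and> \<epsilon> \<in> hom C x \<one> \<and>
        \<a> x x x \<cdot> (\<Delta> \<otimes> \<I> x) \<cdot> \<Delta> = (\<I> x \<otimes> \<Delta>) \<cdot> \<Delta> \<and>
        \<l> x \<cdot> (\<epsilon> \<otimes> \<I> x) \<cdot> \<Delta> = \<I> x \<and>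
        \<r> x \<cdot> (\<I> x \<otimes> \<epsilon>) \<cdot> \<Delta> = \<I> x \<and>
        \<sigma> x x \<cdot> \<Delta> = \<Delta>)"

definition comonoid_morphism ::
  "('o, 'a, 'y) comonoid_scheme \<Rightarrow> ('o, 'a, 'w) comonoid_scheme \<Rightarrow> 'a \<Rightarrow> bool" where
  "comonoid_morphism X Y f \<longleftrightarrow> f \<in> hom C (carr X) (carr Y) \<and>
     comul Y \<cdot> f = (f \<otimes> f) \<cdot> comul X \<and> counit Y \<cdot> f = counit X"

definition is_cocomm_hopf_monoid :: "('o, 'a) hopf_monoid \<Rightarrow> bool" where
  "is_cocomm_hopf_monoid A \<longleftrightarrow> is_cocomm_comonoid A \<and>
     (let a = carr A; m = mul A; u = unit_arr A; \<Delta> = comul A; \<epsilon> = counit A; S = antipode A in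
        m \<in> hom C (a \<odot> a) a \<and> u \<in> hom C \<one> a \<and> S \<in> hom C a a \<and>
        m \<cdot> (m \<otimes> \<I> a) = m \<cdot> (\<I> a \<otimes> m) \<cdot> \<a> a a a \<and>
        m \<cdot> (u \<otimes> \<I> a) = \<l> a \<and>
        m \<cdot> (\<I> a \<otimes> u) = \<r> a \<and>
        \<Delta> \<cdot> m = (m \<otimes> m) \<cdot> middle_braid a a a a \<cdot> (\<Delta> \<otimes> \<Delta>) \<and>
        \<Delta> \<cdot> u = (u \<otimes> u) \<cdot> inv_arr C (\<l> \<one>) \<and>
        \<epsilon> \<cdot> m = \<l> \<one> \<cdot> (\<epsilon> \<otimes> \<epsilon>) \<and>
        \<epsilon> \<cdot> u = \<I> \<one> \<and>
        m \<cdot> (S \<otimes> \<I> a) \<cdot> \<Delta> = u \<cdot> \<epsilon> \<and>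
        m \<cdot> (\<I> a \<otimes> S) \<cdot> \<Delta> = u \<cdot> \<epsilon>)"

text \<open>Hopf monoid morphisms are bimonoid morphisms; they commute with the antipodes automatically.\<close>

definition hopf_morphism :: "('o, 'a) hopf_monoid \<Rightarrow> ('o, 'a) hopf_monoid \<Rightarrow> 'a \<Rightarrow> bool" where
  "hopf_morphism A B f \<longleftrightarrow> comonoid_morphism A B f \<and>
     f \<cdot> mul A = mul B \<cdot> (f \<otimes> f) \<and> f \<cdot> unit_arr A = unit_arr B"

definition Hopf_coc :: "(('o, 'a) hopf_monoid, (('o, 'a) hopf_monoid, 'a) sarr) category" where
  "Hopf_coc =
     \<lparr>Obj = {A. is_cocomm_hopf_monoid A},
      Arr = {SArr A f B | A f B.
        is_cocomm_hopf_monoid A \<and> is_cocomm_hopf_monoid B \<and> hopf_morphism A B f},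
      Dom = src, Cod = tgt,
      Ident = (\<lambda>A. SArr A (\<I> (carr A)) A),
      Comp = (\<lambda>g f. SArr (src f) (und g \<cdot> und f) (tgt g))\<rparr>"

definition left_module :: "('o, 'a) hopf_monoid \<Rightarrow> 'o \<Rightarrow> 'a \<Rightarrow> bool" where
  "left_module A x \<mu> \<longleftrightarrow> x \<in> Obj C \<and> \<mu> \<in> hom C (carr A \<odot> x) x \<and>
     \<mu> \<cdot> (mul A \<otimes> \<I> x) = \<mu> \<cdot> (\<I> (carr A) \<otimes> \<mu>) \<cdot> \<a> (carr A) (carr A) x \<and>
     \<mu> \<cdot> (unit_arr A \<otimes> \<I> x) = \<l> x"

definition left_linear :: "('o, 'a) hopf_monoid \<Rightarrow> 'a \<Rightarrow> 'a \<Rightarrow> 'a \<Rightarrow> bool" where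
  "left_linear A \<mu> \<nu> f \<longleftrightarrow> f \<cdot> \<mu> = \<nu> \<cdot> (\<I> (carr A) \<otimes> f)"

definition tensor_act :: "('o, 'a) hopf_monoid \<Rightarrow> 'o \<Rightarrow> 'a \<Rightarrow> 'a" where
  "tensor_act A x \<mu> =
     (\<mu> \<otimes> \<mu>) \<cdot> middle_braid (carr A) (carr A) x x \<cdot> (comul A \<otimes> \<I> (x \<odot> x))"

definition unit_act :: "('o, 'a) hopf_monoid \<Rightarrow> 'a" where
  "unit_act A = counit A \<cdot> \<r> (carr A)"

definition is_cocomm_module_comonoid ::
  "('o, 'a) hopf_monoid \<Rightarrow> ('o, 'a) module_comonoid \<Rightarrow> bool" where
  "is_cocomm_module_comonoid A Q \<longleftrightarrow> is_cocomm_comonoid Q \<and> left_module A (carr Q) (act Q) \<and>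
     left_linear A (act Q) (tensor_act A (carr Q) (act Q)) (comul Q) \<and>
     left_linear A (act Q) (unit_act A) (counit Q)"

definition Comon_coc :: "('o, 'a) hopf_monoid \<Rightarrow>
    (('o, 'a) module_comonoid, (('o, 'a) module_comonoid, 'a) sarr) category" where
  "Comon_coc A =
     \<lparr>Obj = {Q. is_cocomm_module_comonoid A Q},
      Arr = {SArr P f Q | P f Q.
        is_cocomm_module_comonoid A P \<and> is_cocomm_module_comonoid A Q \<and>
        comonoid_morphism P Q f \<and> left_linear A (act P) (act Q) f},
      Dom = src, Cod = tgt,
      Ident = (\<lambda>Q. SArr Q (\<I> (carr Q)) Q),
      Comp = (\<lambda>g f. SArr (src f) (und g \<cdot> und f) (tgt g))\<rparr>"

definition regular :: "('o, 'a) hopf_monoid \<Rightarrow> ('o, 'a) module_comonoid" where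
  "regular A = \<lparr>carr = carr A, comul = comul A, counit = counit A, act = mul A\<rparr>"


section \<open>The correspondence\<close>

text \<open>Below, \<open>A\<close> is the ambient Hopf monoid, \<open>i\<close> a Hopf monoid morphism \<open>K \<rightarrow> A\<close> and \<open>\<pi>\<close> an
  arrow \<open>A \<rightarrow> Q\<close> of the base category.\<close>

definition is_tensor_over ::
  "('o, 'a) hopf_monoid \<Rightarrow> (('o, 'a) hopf_monoid, 'a) sarr \<Rightarrow> 'a \<Rightarrow> bool" where
  "is_tensor_over A i q \<longleftrightarrow>
     (let a = carr A; k = carr (src i); m = mul A in
        is_coequalizer C
          ((m \<cdot> (\<I> a \<otimes> und i)) \<otimes> \<I> a)
          ((\<I> a \<otimes> (m \<cdot> (und i \<otimes> \<I> a))) \<cdot> \<a> a k a)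
          q)"

definition is_cotensor_over :: "('o, 'a) hopf_monoid \<Rightarrow> 'a \<Rightarrow> 'a \<Rightarrow> bool" where
  "is_cotensor_over A \<pi> e \<longleftrightarrow>
     (let a = carr A; x = Cod C \<pi>; \<Delta> = comul A in
        is_equalizer C
          (((\<I> a \<otimes> \<pi>) \<cdot> \<Delta>) \<otimes> \<I> a)
          (inv_arr C (\<a> a x a) \<cdot> (\<I> a \<otimes> ((\<pi> \<otimes> \<I> a) \<cdot> \<Delta>)))
          e)"

definition sub_condition ::
  "('o, 'a) hopf_monoid \<Rightarrow> (('o, 'a) hopf_monoid, 'a) sarr \<Rightarrow> bool" where
  "sub_condition A i \<longleftrightarrow>
     (let a = carr A; u = unit_arr A in
        \<exists>q. is_tensor_over A i q \<and>
          is_equalizer C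
            (q \<cdot> (u \<otimes> \<I> a) \<cdot> inv_arr C (\<l> a))
            (q \<cdot> (\<I> a \<otimes> u) \<cdot> inv_arr C (\<r> a))
            (und i))"

definition quot_condition :: "('o, 'a) hopf_monoid \<Rightarrow> 'a \<Rightarrow> bool" where
  "quot_condition A \<pi> \<longleftrightarrow>
     (let a = carr A; \<epsilon> = counit A in
        \<exists>e. is_cotensor_over A \<pi> e \<and>
          is_coequalizer C
            (\<l> a \<cdot> (\<epsilon> \<otimes> \<I> a) \<cdot> e)
            (\<r> a \<cdot> (\<I> a \<otimes> \<epsilon>) \<cdot> e)
            \<pi>)"

definition equalizer_subobjects ::
  "('o, 'a) hopf_monoid \<Rightarrow> (('o, 'a) hopf_monoid, 'a) sarr set set" where
  "equalizer_subobjects A = {X \<in> subobjects Hopf_coc A. \<forall>i \<in> X. sub_condition A i}"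

definition coequalizer_quotients ::
  "('o, 'a) hopf_monoid \<Rightarrow> (('o, 'a) module_comonoid, 'a) sarr set set" where
  "coequalizer_quotients A =
     {Y \<in> quotients (Comon_coc A) (regular A). \<forall>p \<in> Y. quot_condition A (und p)}"

definition is_phi :: "('o, 'a) hopf_monoid \<Rightarrow> (('o, 'a) hopf_monoid, 'a) sarr \<Rightarrow> 'a \<Rightarrow> bool" where
  "is_phi A i \<pi> \<longleftrightarrow>
     (let a = carr A; K = src i in
        is_coequalizer C (mul A \<cdot> (\<I> a \<otimes> und i)) (\<r> a \<cdot> (\<I> a \<otimes> counit K)) \<pi>)"

definition is_psi :: "('o, 'a) hopf_monoid \<Rightarrow> 'a \<Rightarrow> 'a \<Rightarrow> bool" where
  "is_psi A \<pi> j \<longleftrightarrow>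
     (let a = carr A in
        is_equalizer C
          ((\<pi> \<otimes> \<I> a) \<cdot> comul A)
          (((\<pi> \<cdot> unit_arr A) \<otimes> \<I> a) \<cdot> inv_arr C (\<l> a))
          j)"

text \<open>Coequalizers and equalizers are determined only up to isomorphism, so the two maps are defined
  on isomorphism classes: the value is the collection of all arrows of the target category,
  with the prescribed (co)domain \<open>A\<close>, whose underlying arrow is such a (co)equalizer.\<close>

definition phi :: "('o, 'a) hopf_monoid \<Rightarrow> (('o, 'a) hopf_monoid, 'a) sarr set \<Rightarrow>
    (('o, 'a) module_comonoid, 'a) sarr set" where
  "phi A X = {p \<in> Arr (Comon_coc A). src p = regular A \<and> (\<exists>i \<in> X. is_phi A i (und p))}"

definition psi :: "('o, 'a) hopf_monoid \<Rightarrow> (('o, 'a) module_comonoid, 'a) sarr set \<Rightarrow>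
    (('o, 'a) hopf_monoid, 'a) sarr set" where
  "psi A Y = {j \<in> Arr Hopf_coc. tgt j = A \<and> (\<exists>p \<in> Y. is_psi A (und p) (und j))}"

end

end

(* Write g1, g2 for the components of the comultiplication and let T(g # h) = g1 # g2 h be the fusion
   arrow of A # A (# is the tensor product), which is invertible because A has an antipode. If pi is
   the coequalizer phi(i), then (pi # 1) T presents A #_K A as Q # A and turns h |-> 1 # h and
   h |-> h # 1 into h |-> pi(1) # h and h |-> pi(h1) # h2, so condition 1) says exactly that
   i = psi(phi(i)). Dually, if j is the equalizer psi(pi), then T (1 # j) presents the cotensor product
   of A and A over Q as A # K, and condition 2) says exactly that pi = phi(psi(pi)).
   The structure on Q comes from the universal property of the coequalizer. The multiplication of A
   restricts to K, and the comultiplication does so because cocommutativity makes both of its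
   components equalize the defining pair of K. For the antipode one uses the diagonal action of A on
   Q # A, for which h |-> pi(h1) # h2 is linear.
   Identities between arrows are verified after a strictification of the monoidal category. *)
theory Submission
  imports Defs
begin

section \<open>Arrows with partial composition\<close>

text \<open>The braiding need not be a symmetry, so a computation with elements g1, g2 only
  abbreviates an identity of arrows in which every crossing counts. The laws of Q and of K are
  tested after \<pi> or j standing next to further factors; the preservation hypotheses keep these
  arrows epic or monic there. The obstacle is the antipode of K. Let F and G be the two arrows whose
  equalizer is K. Since \<pi> is linear on one side only, F(S(x)) is not computed directly. Instead
  x1 . F(S(x2)) and x1 . G(S(x2)) are compared, where the dot is the diagonal action; the antipode
  of A recovers an arrow R from x \<mapsto> x1 . R(x2). Neither condition 1) nor 2) depends on the
  chosen tensor or cotensor product. Each says that one map undoes the other, so both bijections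
  come from a single relation: \<pi> is a \<phi>(i) and i is a \<psi>(\<pi>). Related arrows are
  automatically monic, respectively epic, in the categories of structured objects, and each
  determines the other up to isomorphism.\<close>

context category
begin

text \<open>The type of arrows may be larger than the category, so \<open>Some\<close> of a value
  outside \<open>Arr C\<close> has to be excluded along with \<open>None\<close>.\<close>

definition ok :: "'a option \<Rightarrow> bool" where
  "ok F \<longleftrightarrow> F \<noteq> None \<and> the F \<in> Arr C"

definition odom :: "'a option \<Rightarrow> 'o" where
  "odom F = Dom C (the F)"

definition ocod :: "'a option \<Rightarrow> 'o" where
  "ocod F = Cod C (the F)"

text \<open>\<open>None\<close> stands for every ill-typed composite, so that associativity needs no typing hypotheses.\<close>

definition pcomp :: "'a option \<Rightarrow> 'a option \<Rightarrow> 'a option"  (infixr "**" 55) where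
  "F ** G = (if ok F \<and> ok G \<and> odom F = ocod G then Some (the F \<cdot> the G) else None)"

definition oid :: "'o \<Rightarrow> 'a option" where
  "oid x = (if x \<in> Obj C then Some (\<I> x) else None)"

lemma Comp_closed:
  assumes "f \<in> Arr C" "g \<in> Arr C" "Dom C g = Cod C f"
  shows "g \<cdot> f \<in> Arr C" "Dom C (g \<cdot> f) = Dom C f" "Cod C (g \<cdot> f) = Cod C g"
  using Comp_hom[of f "Dom C f" "Cod C f" g "Cod C g"] assms by (auto simp: hom_def)

lemma Ident_closed:
  assumes "x \<in> Obj C"
  shows "\<I> x \<in> Arr C" "Dom C (\<I> x) = x" "Cod C (\<I> x) = x"
  using Ident_hom[OF assms] by (auto simp: hom_def)

lemma ok_None [simp]: "\<not> ok None"
  by (simp add: ok_def)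

lemma ok_Some [simp]: "ok (Some f) \<longleftrightarrow> f \<in> Arr C"
  by (simp add: ok_def)

lemma odom_Some [simp]: "odom (Some f) = Dom C f"
  by (simp add: odom_def)

lemma ocod_Some [simp]: "ocod (Some f) = Cod C f"
  by (simp add: ocod_def)

lemma ok_pcomp [simp]: "ok (F ** G) \<longleftrightarrow> ok F \<and> ok G \<and> odom F = ocod G"
  by (auto simp: pcomp_def Comp_closed ok_def odom_def ocod_def)

lemma odom_pcomp [simp]: "ok F \<Longrightarrow> ok G \<Longrightarrow> odom F = ocod G \<Longrightarrow> odom (F ** G) = odom G"
  by (auto simp: pcomp_def Comp_closed ok_def odom_def ocod_def)

lemma ocod_pcomp [simp]: "ok F \<Longrightarrow> ok G \<Longrightarrow> odom F = ocod G \<Longrightarrow> ocod (F ** G) = ocod F"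
  by (auto simp: pcomp_def Comp_closed ok_def odom_def ocod_def)

lemma pcomp_not_ok: "\<not> ok (F ** G) \<Longrightarrow> F ** G = None"
  by (auto simp: pcomp_def Comp_closed ok_def odom_def ocod_def split: if_splits)

lemma pcomp_assoc: "(F ** G) ** H = F ** (G ** H)"
proof (cases "ok F \<and> ok G \<and> ok H \<and> odom F = ocod G \<and> odom G = ocod H")
  case True
  then obtain f g h where "F = Some f" "G = Some g" "H = Some h"
    by (auto simp: ok_def)
  with True show ?thesis
    using Comp_assoc[of h "Dom C h" "Cod C h" g "Cod C g" f "Cod C f"]
    by (auto simp: pcomp_def Comp_closed hom_def)
next
  case False
  then have "\<not> ok ((F ** G) ** H)" "\<not> ok (F ** (G ** H))"
    using odom_pcomp[of F G] ocod_pcomp[of G H] by (metis ok_pcomp)+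
  then show ?thesis
    by (metis pcomp_not_ok)
qed

lemma ok_oid [simp]: "ok (oid x) \<longleftrightarrow> x \<in> Obj C"
  by (auto simp: oid_def Ident_closed)

lemma odom_oid [simp]: "x \<in> Obj C \<Longrightarrow> odom (oid x) = x"
  by (auto simp: oid_def Ident_closed)

lemma ocod_oid [simp]: "x \<in> Obj C \<Longrightarrow> ocod (oid x) = x"
  by (auto simp: oid_def Ident_closed)

lemma ok_Obj [simp]: "ok F \<Longrightarrow> odom F \<in> Obj C" "ok F \<Longrightarrow> ocod F \<in> Obj C"
  using Dom_Obj Cod_Obj by (auto simp: ok_def odom_def ocod_def)

lemma pcomp_oid [simp]: "ok F \<Longrightarrow> odom F = x \<Longrightarrow> F ** oid x = F"
  using Comp_Ident[of "the F" "odom F" "ocod F"] Dom_Obj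
  by (auto simp: oid_def pcomp_def hom_def ok_def odom_def ocod_def Ident_closed)

lemma oid_pcomp [simp]: "ok F \<Longrightarrow> ocod F = x \<Longrightarrow> oid x ** F = F"
  using Ident_Comp[of "the F" "odom F" "ocod F"] Cod_Obj
  by (auto simp: oid_def pcomp_def hom_def ok_def odom_def ocod_def Ident_closed)

lemma pcomp_tail: "F = G \<Longrightarrow> F ** H = G ** H"
  by simp

lemma Some_Comp: "f \<in> hom C x y \<Longrightarrow> g \<in> hom C y z \<Longrightarrow> Some (g \<cdot> f) = Some g ** Some f"
  by (auto simp: pcomp_def hom_def)

section \<open>Isomorphisms among partial arrows\<close>

definition oiso :: "'a option \<Rightarrow> bool" where
  "oiso F \<longleftrightarrow> ok F \<and> (\<exists>G. ok G \<and> odom G = ocod F \<and> ocod G = odom F \<and>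
     G ** F = oid (odom F) \<and> F ** G = oid (ocod F))"

definition oinv :: "'a option \<Rightarrow> 'a option" where
  "oinv F = (SOME G. ok G \<and> odom G = ocod F \<and> ocod G = odom F \<and>
     G ** F = oid (odom F) \<and> F ** G = oid (ocod F))"

lemma oiso_ok: "oiso F \<Longrightarrow> ok F"
  by (simp add: oiso_def)

lemma oinv:
  assumes "oiso F"
  shows "ok (oinv F)" "odom (oinv F) = ocod F" "ocod (oinv F) = odom F"
    "oinv F ** F = oid (odom F)" "F ** oinv F = oid (ocod F)"
  using someI_ex[of "\<lambda>G. ok G \<and> odom G = ocod F \<and> ocod G = odom F \<and>
     G ** F = oid (odom F) \<and> F ** G = oid (ocod F)"] assms
  by (auto simp: oiso_def oinv_def)

lemma oisoI:
  assumes "ok F" "ok G" "G ** F = oid (odom F)" "F ** G = oid (ocod F)"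
  shows "oiso F"
  using assms by (metis ok_Obj ok_oid ok_pcomp oiso_def)

lemma oiso_oid [simp]: "x \<in> Obj C \<Longrightarrow> oiso (oid x)"
  by (rule oisoI[of _ "oid x"]) auto

lemma oiso_pcomp:
  assumes "oiso F" "oiso G" "odom F = ocod G"
  shows "oiso (F ** G)"
proof (rule oisoI[of _ "oinv G ** oinv F"])
  have "oinv F ** F ** G = G" "G ** oinv G ** oinv F = oinv F"
    using assms by (simp_all add: pcomp_assoc[symmetric] oinv oiso_ok)
  then show "(oinv G ** oinv F) ** F ** G = oid (odom (F ** G))"
    "(F ** G) ** oinv G ** oinv F = oid (ocod (F ** G))"
    using assms by (simp_all add: pcomp_assoc oinv oiso_ok)
qed (use assms in \<open>simp_all add: oinv oiso_ok\<close>)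

lemma oiso_cancel_right:
  assumes "oiso F" "ok G" "ok H" "odom G = ocod F" "odom H = ocod F" "G ** F = H ** F"
  shows "G = H"
  using assms by (metis oinv(5) pcomp_assoc pcomp_oid)

lemma oiso_cancel_left:
  assumes "oiso F" "ok G" "ok H" "odom F = ocod G" "odom F = ocod H" "F ** G = F ** H"
  shows "G = H"
  using assms by (metis oid_pcomp oinv(4) pcomp_assoc)

text \<open>Uniqueness of inverses makes the definite description \<open>inv_arr\<close> well
  defined and forces it to agree with the chosen \<open>oinv\<close>.\<close>

lemma is_iso_oiso:
  assumes "is_iso C f"
  shows "oiso (Some f)" "Some (inv_arr C f) = oinv (Some f)" "inv_arr C f \<in> hom C (Cod C f) (Dom C f)"
proof -
  obtain g where g: "inverse_arrows C f g"
    using assms by (auto simp: is_iso_def)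
  have uniq: "h = g" if "inverse_arrows C f h" for h
  proof -
    have "h = h \<cdot> (f \<cdot> g)" "(h \<cdot> f) \<cdot> g = g"
      using that g Comp_Ident[of h "Cod C f" "Dom C f"] Ident_Comp[of g "Cod C f" "Dom C f"]
      by (auto simp: inverse_arrows_def)
    then show ?thesis
      using Comp_assoc[of g "Cod C f" "Dom C f" f "Cod C f" h "Dom C f"] that g
      by (auto simp: inverse_arrows_def hom_def)
  qed
  have inv: "inverse_arrows C f (inv_arr C f)"
    unfolding inv_arr_def by (rule theI[where P = "inverse_arrows C f", OF g uniq])
  then show "inv_arr C f \<in> hom C (Cod C f) (Dom C f)"
    by (auto simp: inverse_arrows_def)
  have 1: "f \<in> Arr C" "inv_arr C f \<in> Arr C" "Dom C (inv_arr C f) = Cod C f"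
    "Cod C (inv_arr C f) = Dom C f" "Dom C f \<in> Obj C" "Cod C f \<in> Obj C"
    using inv Dom_Obj Cod_Obj by (auto simp: inverse_arrows_def hom_def)
  have 2: "Some (inv_arr C f) ** Some f = oid (odom (Some f))"
      "Some f ** Some (inv_arr C f) = oid (ocod (Some f))"
    using inv 1 by (auto simp: inverse_arrows_def pcomp_def oid_def)
  show iso: "oiso (Some f)"
    by (rule oisoI[OF _ _ 2]) (use 1 in auto)
  show "Some (inv_arr C f) = oinv (Some f)"
    by (rule oiso_cancel_right[OF iso]) (use iso oinv[OF iso] 1 2 in auto)
qed

end

section \<open>Tensor products and constraints of partial arrows\<close>

context monoidal_category
begin

definition otensor :: "'a option \<Rightarrow> 'a option \<Rightarrow> 'a option"  (infixl "\<boxtimes>" 70) where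
  "F \<boxtimes> G = (if ok F \<and> ok G then Some (the F \<otimes> the G) else None)"

lemma ok_otensor [simp]: "ok (F \<boxtimes> G) \<longleftrightarrow> ok F \<and> ok G"
  using tensor_hom[of "the F" "odom F" "ocod F" "the G" "odom G" "ocod G"]
  by (auto simp: otensor_def ok_def hom_def odom_def ocod_def)

lemma odom_otensor [simp]: "ok F \<Longrightarrow> ok G \<Longrightarrow> odom (F \<boxtimes> G) = odom F \<odot> odom G"
  using tensor_hom[of "the F" "odom F" "ocod F" "the G" "odom G" "ocod G"]
  by (auto simp: otensor_def ok_def hom_def odom_def ocod_def)

lemma ocod_otensor [simp]: "ok F \<Longrightarrow> ok G \<Longrightarrow> ocod (F \<boxtimes> G) = ocod F \<odot> ocod G"
  using tensor_hom[of "the F" "odom F" "ocod F" "the G" "odom G" "ocod G"]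
  by (auto simp: otensor_def ok_def hom_def odom_def ocod_def)

lemma otensor_pcomp:
  assumes "ok F" "ok G" "odom G = ocod F" "ok F'" "ok G'" "odom G' = ocod F'"
  shows "(G ** F) \<boxtimes> (G' ** F') = (G \<boxtimes> G') ** (F \<boxtimes> F')"
proof -
  obtain f g f' g' where "F = Some f" "G = Some g" "F' = Some f'" "G' = Some g'"
    using assms by (auto simp: ok_def)
  with assms show ?thesis
    using tensor_Comp[of f "Dom C f" "Cod C f" g "Cod C g" f' "Dom C f'" "Cod C f'" g' "Cod C g'"]
      tensor_hom[of f "Dom C f" "Cod C f" f' "Dom C f'" "Cod C f'"]
      tensor_hom[of g "Dom C g" "Cod C g" g' "Dom C g'" "Cod C g'"]
    by (auto simp: otensor_def pcomp_def hom_def Comp_closed)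
qed

lemma oid_otensor [simp]: "x \<in> Obj C \<Longrightarrow> y \<in> Obj C \<Longrightarrow> oid x \<boxtimes> oid y = oid (x \<odot> y)"
  by (auto simp: otensor_def oid_def tensor_Ident tensor_Obj Ident_closed)

lemma Some_tensor: "f \<in> hom C x y \<Longrightarrow> g \<in> hom C z w \<Longrightarrow> Some (f \<otimes> g) = Some f \<boxtimes> Some g"
  by (auto simp: otensor_def hom_def)

lemma tensor_Obj' [simp]: "a \<in> Obj C \<Longrightarrow> b \<in> Obj C \<Longrightarrow> a \<odot> b \<in> Obj C"
  by (rule tensor_Obj)

lemma unit_Obj' [simp]: "\<one> \<in> Obj C"
  by (rule unit_Obj)

definition oassoc :: "'o \<Rightarrow> 'o \<Rightarrow> 'o \<Rightarrow> 'a option" where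
  "oassoc x y z = Some (\<a> x y z)"

definition olunit :: "'o \<Rightarrow> 'a option" where
  "olunit x = Some (\<l> x)"

definition orunit :: "'o \<Rightarrow> 'a option" where
  "orunit x = Some (\<r> x)"

lemma oassoc [simp]:
  assumes "x \<in> Obj C" "y \<in> Obj C" "z \<in> Obj C"
  shows "ok (oassoc x y z)" "odom (oassoc x y z) = x \<odot> y \<odot> z"
    "ocod (oassoc x y z) = x \<odot> (y \<odot> z)" "oiso (oassoc x y z)"
  using assoc_hom[OF assms] is_iso_oiso(1)[OF assoc_iso[OF assms]]
  by (auto simp: oassoc_def hom_def)

lemma olunit [simp]:
  assumes "x \<in> Obj C"
  shows "ok (olunit x)" "odom (olunit x) = \<one> \<odot> x" "ocod (olunit x) = x" "oiso (olunit x)"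
  using lunit_hom[OF assms] is_iso_oiso(1)[OF lunit_iso[OF assms]]
  by (auto simp: olunit_def hom_def)

lemma orunit [simp]:
  assumes "x \<in> Obj C"
  shows "ok (orunit x)" "odom (orunit x) = x \<odot> \<one>" "ocod (orunit x) = x" "oiso (orunit x)"
  using runit_hom[OF assms] is_iso_oiso(1)[OF runit_iso[OF assms]]
  by (auto simp: orunit_def hom_def)

lemma oassoc_natural:
  assumes "ok F" "ok G" "ok H"
  shows "oassoc (ocod F) (ocod G) (ocod H) ** (F \<boxtimes> G \<boxtimes> H) =
    (F \<boxtimes> (G \<boxtimes> H)) ** oassoc (odom F) (odom G) (odom H)"
proof -
  have "ocod F \<in> Obj C" "ocod G \<in> Obj C" "ocod H \<in> Obj C"
    "odom F \<in> Obj C" "odom G \<in> Obj C" "odom H \<in> Obj C" using assms by auto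
  moreover obtain f g h where "F = Some f" "G = Some g" "H = Some h"
    using assms by (auto simp: ok_def)
  ultimately show ?thesis
    using assms assoc_natural[of f "Dom C f" "Cod C f" g "Dom C g" "Cod C g" h "Dom C h" "Cod C h"]
      assoc_hom[of "Dom C f" "Dom C g" "Dom C h"] assoc_hom[of "Cod C f" "Cod C g" "Cod C h"]
      tensor_hom[of f "Dom C f" "Cod C f" g "Dom C g" "Cod C g"]
      tensor_hom[of g "Dom C g" "Cod C g" h "Dom C h" "Cod C h"]
      tensor_hom[of "f \<otimes> g" "Dom C f \<odot> Dom C g" "Cod C f \<odot> Cod C g" h "Dom C h" "Cod C h"]
      tensor_hom[of f "Dom C f" "Cod C f" "g \<otimes> h" "Dom C g \<odot> Dom C h" "Cod C g \<odot> Cod C h"]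
    by (auto simp: oassoc_def pcomp_def otensor_def hom_def)
qed

lemma olunit_natural: "ok F \<Longrightarrow> olunit (ocod F) ** (oid \<one> \<boxtimes> F) = F ** olunit (odom F)"
  using lunit_natural[of "the F" "odom F" "ocod F"] lunit_hom[of "odom F"] lunit_hom[of "ocod F"]
    Dom_Obj[of "the F"] Cod_Obj[of "the F"] Ident_closed[of \<one>]
    tensor_hom[of "\<I> \<one>" \<one> \<one> "the F" "odom F" "ocod F"]
  by (auto simp: olunit_def pcomp_def otensor_def oid_def ok_def odom_def ocod_def hom_def)

lemma orunit_natural: "ok F \<Longrightarrow> orunit (ocod F) ** (F \<boxtimes> oid \<one>) = F ** orunit (odom F)"
  using runit_natural[of "the F" "odom F" "ocod F"] runit_hom[of "odom F"] runit_hom[of "ocod F"]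
    Dom_Obj[of "the F"] Cod_Obj[of "the F"] Ident_closed[of \<one>]
    tensor_hom[of "the F" "odom F" "ocod F" "\<I> \<one>" \<one> \<one>]
  by (auto simp: orunit_def pcomp_def otensor_def oid_def ok_def odom_def ocod_def hom_def)

lemma opentagon:
  assumes "a \<in> Obj C" "b \<in> Obj C" "c \<in> Obj C" "d \<in> Obj C"
  shows "oassoc a b (c \<odot> d) ** oassoc (a \<odot> b) c d =
    (oid a \<boxtimes> oassoc b c d) ** oassoc a (b \<odot> c) d ** (oassoc a b c \<boxtimes> oid d)"
proof -
  have o: "\<And>x. x \<in> Obj C \<Longrightarrow> \<I> x \<in> hom C x x" "oid a = Some (\<I> a)" "oid d = Some (\<I> d)"
    using assms by (auto simp: Ident_hom oid_def)
  show ?thesis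
    using pentagon[OF assms] assms o
    apply (simp add: oassoc_def o)
    apply (subst Some_Comp[symmetric] Some_tensor[symmetric],
       (assumption | rule assoc_hom Comp_hom tensor_hom o tensor_Obj)+)+
    apply simp
    done
qed

lemma otriangle:
  assumes "a \<in> Obj C" "b \<in> Obj C"
  shows "(oid a \<boxtimes> olunit b) ** oassoc a \<one> b = orunit a \<boxtimes> oid b"
proof -
  have o: "\<And>x. x \<in> Obj C \<Longrightarrow> \<I> x \<in> hom C x x" "oid a = Some (\<I> a)" "oid b = Some (\<I> b)"
    using assms by (auto simp: Ident_hom oid_def)
  show ?thesis
    using triangle[OF assms] assms o
    apply (simp add: oassoc_def olunit_def orunit_def o)
    apply (subst Some_Comp[symmetric] Some_tensor[symmetric],
       (assumption | rule assoc_hom lunit_hom runit_hom Comp_hom tensor_hom o tensor_Obj unit_Obj)+)+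
    apply simp
    done
qed

end

section \<open>Strictification\<close>

text \<open>As in Cayley's theorem, an object is represented by the functor that tensors with it on the left.
  A bracketed word \<open>t\<close> stands for the object \<open>ob t\<close> and acts on objects and arrows by successive
  tensoring with its letters; \<open>con t z\<close> is the constraint from \<open>ob t \<odot> z\<close> to \<open>act_ob t z\<close>, and \<open>hat s t F z\<close>
  is \<open>F \<boxtimes> z\<close> conjugated by these constraints. Then \<open>hat\<close> is strictly functorial, turns tensor products
  into composites, sends every coherence arrow to an identity, and is faithful by taking \<open>z = \<one>\<close>.\<close>

datatype 'o tree = Unit | Leaf 'o | Node "'o tree" "'o tree"

context category
begin

text \<open>Composites are kept bracketed to the right; as an attribute this turns a law for two
  factors into one that fires in front of any further factor.\<close>

lemma pcomp_eq_tail: "F ** G = H \<Longrightarrow> F ** (G ** K) = H ** K"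
  by (simp add: pcomp_assoc[symmetric])

lemma hom_Some: "f \<in> hom C x y \<longleftrightarrow> ok (Some f) \<and> odom (Some f) = x \<and> ocod (Some f) = y"
  by (auto simp: hom_def)

end

context monoidal_category
begin

definition whisker :: "'o \<Rightarrow> 'a option \<Rightarrow> 'a option"  (infixr "|>" 65) where
  "x |> F = oid x \<boxtimes> F"

lemma ok_whisker [simp]: "ok (x |> F) \<longleftrightarrow> x \<in> Obj C \<and> ok F"
  by (auto simp: whisker_def)

lemma odom_whisker [simp]: "x \<in> Obj C \<Longrightarrow> ok F \<Longrightarrow> odom (x |> F) = x \<odot> odom F"
  by (auto simp: whisker_def)

lemma ocod_whisker [simp]: "x \<in> Obj C \<Longrightarrow> ok F \<Longrightarrow> ocod (x |> F) = x \<odot> ocod F"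
  by (auto simp: whisker_def)

lemma whisker_oid [simp]: "x \<in> Obj C \<Longrightarrow> y \<in> Obj C \<Longrightarrow> x |> oid y = oid (x \<odot> y)"
  by (auto simp: whisker_def)

lemma whisker_pcomp:
  "x \<in> Obj C \<Longrightarrow> ok F \<Longrightarrow> ok G \<Longrightarrow> odom F = ocod G \<Longrightarrow> x |> (F ** G) = (x |> F) ** (x |> G)"
  using otensor_pcomp[of "oid x" "oid x" G F] by (simp add: whisker_def)

primrec ob :: "'o tree \<Rightarrow> 'o" where
  "ob Unit = \<one>"
| "ob (Leaf x) = x"
| "ob (Node s t) = ob s \<odot> ob t"

primrec wft :: "'o tree \<Rightarrow> bool" where
  "wft Unit = True"
| "wft (Leaf x) = (x \<in> Obj C)"
| "wft (Node s t) = (wft s \<and> wft t)"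

primrec act_ob :: "'o tree \<Rightarrow> 'o \<Rightarrow> 'o" where
  "act_ob Unit z = z"
| "act_ob (Leaf x) z = x \<odot> z"
| "act_ob (Node s t) z = act_ob s (act_ob t z)"

primrec act_arr :: "'o tree \<Rightarrow> 'a option \<Rightarrow> 'a option" where
  "act_arr Unit F = F"
| "act_arr (Leaf x) F = x |> F"
| "act_arr (Node s t) F = act_arr s (act_arr t F)"

primrec con :: "'o tree \<Rightarrow> 'o \<Rightarrow> 'a option" where
  "con Unit z = olunit z"
| "con (Leaf x) z = oid (x \<odot> z)"
| "con (Node s t) z =
    con s (act_ob t z) ** (oid (ob s) \<boxtimes> con t z) ** oassoc (ob s) (ob t) z"

lemma ob_Obj [simp]: "wft t \<Longrightarrow> ob t \<in> Obj C"
  by (induction t) auto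

lemma act_ob_Obj [simp]: "wft t \<Longrightarrow> z \<in> Obj C \<Longrightarrow> act_ob t z \<in> Obj C"
  by (induction t arbitrary: z) auto

lemma act_arr_ok [simp]:
  assumes "wft t" "ok F"
  shows "ok (act_arr t F)" "odom (act_arr t F) = act_ob t (odom F)"
    "ocod (act_arr t F) = act_ob t (ocod F)"
proof -
  have "ok (act_arr t F) \<and> odom (act_arr t F) = act_ob t (odom F)
    \<and> ocod (act_arr t F) = act_ob t (ocod F)"
    using assms by (induction t arbitrary: F) auto
  then show "ok (act_arr t F)" "odom (act_arr t F) = act_ob t (odom F)"
    "ocod (act_arr t F) = act_ob t (ocod F)" by auto
qed

lemma act_arr_oid [simp]: "wft t \<Longrightarrow> z \<in> Obj C \<Longrightarrow> act_arr t (oid z) = oid (act_ob t z)"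
  by (induction t arbitrary: z) auto

lemma oiso_otensor:
  assumes "oiso F" "oiso G"
  shows "oiso (F \<boxtimes> G)"
  by (rule oisoI[of _ "oinv F \<boxtimes> oinv G"])
    (use assms in \<open>simp_all add: oinv oiso_ok flip: otensor_pcomp\<close>)

lemma con_ok [simp]:
  assumes "wft t" "z \<in> Obj C"
  shows "ok (con t z)" "odom (con t z) = ob t \<odot> z" "ocod (con t z) = act_ob t z" "oiso (con t z)"
proof -
  have "oiso (con t z) \<and> odom (con t z) = ob t \<odot> z \<and> ocod (con t z) = act_ob t z"
    using assms by (induction t arbitrary: z) (auto simp: oiso_ok intro!: oiso_pcomp oiso_otensor)
  then show "ok (con t z)" "odom (con t z) = ob t \<odot> z" "ocod (con t z) = act_ob t z" "oiso (con t z)"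
    by (auto simp: oiso_ok)
qed

lemma oid_otensor_pcomp:
  "x \<in> Obj C \<Longrightarrow> ok F \<Longrightarrow> ok G \<Longrightarrow> odom F = ocod G \<Longrightarrow>
    oid x \<boxtimes> (F ** G) = (oid x \<boxtimes> F) ** (oid x \<boxtimes> G)"
  using otensor_pcomp[of "oid x" "oid x" G F] by simp

lemma otensor_oid_pcomp:
  "x \<in> Obj C \<Longrightarrow> ok F \<Longrightarrow> ok G \<Longrightarrow> odom F = ocod G \<Longrightarrow>
    (F ** G) \<boxtimes> oid x = (F \<boxtimes> oid x) ** (G \<boxtimes> oid x)"
  using otensor_pcomp[of G F "oid x" "oid x"] by simp

text \<open>Induction on the bracketing. At a \<open>Node\<close> the associator is natural, and the
  constraint of each half passes \<open>H\<close> by its own hypothesis.\<close>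

lemma con_natural:
  assumes "wft t" "ok H"
  shows "con t (ocod H) ** (oid (ob t) \<boxtimes> H) = act_arr t H ** con t (odom H)"
  using assms
proof (induction t arbitrary: H)
  case Unit
  then show ?case by (simp add: olunit_natural)
next
  case (Leaf x)
  then show ?case by (simp add: whisker_def)
next
  case (Node s t)
  let ?s = "ob s" and ?t = "ob t"
  have w: "wft s" "wft t" using Node.prems by auto
  have "con (Node s t) (ocod H) ** (oid (ob (Node s t)) \<boxtimes> H) =
      con s (act_ob t (ocod H)) ** (oid ?s \<boxtimes> con t (ocod H)) **
      oassoc ?s ?t (ocod H) ** (oid ?s \<boxtimes> oid ?t \<boxtimes> H)"
    using w by (simp add: pcomp_assoc)
  also have "oassoc ?s ?t (ocod H) ** (oid ?s \<boxtimes> oid ?t \<boxtimes> H) =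
      (oid ?s \<boxtimes> (oid ?t \<boxtimes> H)) ** oassoc ?s ?t (odom H)"
    using oassoc_natural[of "oid ?s" "oid ?t" H] w Node.prems by simp
  also have "(oid ?s \<boxtimes> con t (ocod H)) ** (oid ?s \<boxtimes> (oid ?t \<boxtimes> H)) ** oassoc ?s ?t (odom H) =
      ((oid ?s \<boxtimes> act_arr t H) ** (oid ?s \<boxtimes> con t (odom H))) ** oassoc ?s ?t (odom H)"
    using w Node.prems Node.IH(2)[of H] by (simp add: pcomp_assoc[symmetric] flip: oid_otensor_pcomp)
  also have "con s (act_ob t (ocod H)) **
      ((oid ?s \<boxtimes> act_arr t H) ** (oid ?s \<boxtimes> con t (odom H))) ** oassoc ?s ?t (odom H) =
      (con s (act_ob t (ocod H)) ** (oid ?s \<boxtimes> act_arr t H)) **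
      (oid ?s \<boxtimes> con t (odom H)) ** oassoc ?s ?t (odom H)"
    by (simp only: pcomp_assoc)
  also have "con s (act_ob t (ocod H)) ** (oid ?s \<boxtimes> act_arr t H) =
      act_arr s (act_arr t H) ** con s (act_ob t (odom H))"
    using w Node.prems Node.IH(1)[of "act_arr t H"] by simp
  finally show ?case by (simp add: pcomp_assoc)
qed

definition hat :: "'o tree \<Rightarrow> 'o tree \<Rightarrow> 'a option \<Rightarrow> 'o \<Rightarrow> 'a option" where
  "hat s t F z = con t z ** (F \<boxtimes> oid z) ** oinv (con s z)"

lemma hat_ok [simp]:
  assumes "wft s" "wft t" "z \<in> Obj C" "ok F" "odom F = ob s" "ocod F = ob t"
  shows "ok (hat s t F z)" "odom (hat s t F z) = act_ob s z" "ocod (hat s t F z) = act_ob t z"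
  using assms by (simp_all add: hat_def oinv)

lemma hat_con:
  assumes "wft s" "wft t" "z \<in> Obj C" "ok F" "odom F = ob s" "ocod F = ob t"
  shows "hat s t F z ** con s z = con t z ** (F \<boxtimes> oid z)"
  using assms by (simp add: hat_def pcomp_assoc oinv)

text \<open>Since \<open>con s z\<close> is invertible, only one arrow completes the square; the
  values of \<open>hat\<close> below are found by exhibiting a completion.\<close>

lemma hatI:
  assumes "wft s" "wft t" "z \<in> Obj C" "ok F" "odom F = ob s" "ocod F = ob t"
    and "ok H" "odom H = act_ob s z" "H ** con s z = con t z ** (F \<boxtimes> oid z)"
  shows "hat s t F z = H"
  by (rule oiso_cancel_right[of "con s z"]) (use assms in \<open>simp_all add: hat_con\<close>)

lemma hat_oid: "wft t \<Longrightarrow> z \<in> Obj C \<Longrightarrow> hat t t (oid (ob t)) z = oid (act_ob t z)"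
  by (rule hatI) auto

lemma hat_pcomp:
  assumes "wft r" "wft s" "wft t" "z \<in> Obj C"
    and "ok F" "odom F = ob r" "ocod F = ob s" "ok G" "odom G = ob s" "ocod G = ob t"
  shows "hat r t (G ** F) z = hat s t G z ** hat r s F z"
  by (rule hatI)
    (use assms in \<open>simp_all add: hat_con otensor_oid_pcomp pcomp_assoc pcomp_eq_tail[OF hat_con]\<close>)

text \<open>The interchange law: \<open>F\<close> acts on the word in front, \<open>H\<close> only
  on the tail behind it.\<close>

lemma hat_natural:
  assumes "wft s" "wft t" "ok F" "odom F = ob s" "ocod F = ob t" "ok H"
  shows "hat s t F (ocod H) ** act_arr s H = act_arr t H ** hat s t F (odom H)"
proof (rule oiso_cancel_right[of "con s (odom H)"])
  have "(hat s t F (ocod H) ** act_arr s H) ** con s (odom H) =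
      hat s t F (ocod H) ** con s (ocod H) ** (oid (ob s) \<boxtimes> H)"
    using assms by (simp add: pcomp_assoc con_natural)
  also have "\<dots> = con t (ocod H) ** (F \<boxtimes> oid (ocod H)) ** (oid (ob s) \<boxtimes> H)"
    using assms by (simp add: pcomp_eq_tail[OF hat_con] pcomp_assoc)
  also have "(F \<boxtimes> oid (ocod H)) ** (oid (ob s) \<boxtimes> H) = (oid (ob t) \<boxtimes> H) ** (F \<boxtimes> oid (odom H))"
    using assms by (simp flip: otensor_pcomp)
  also have "con t (ocod H) ** (oid (ob t) \<boxtimes> H) ** (F \<boxtimes> oid (odom H)) =
     act_arr t H ** con t (odom H) ** (F \<boxtimes> oid (odom H))"
    using assms by (simp add: pcomp_eq_tail[OF con_natural] pcomp_assoc)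
  also have "\<dots> = (act_arr t H ** hat s t F (odom H)) ** con s (odom H)"
    using assms by (simp add: pcomp_assoc hat_con)
  finally show "(hat s t F (ocod H) ** act_arr s H) ** con s (odom H) =
    (act_arr t H ** hat s t F (odom H)) ** con s (odom H)" .
qed (use assms in auto)

text \<open>The second factor acts inside the word \<open>s\<close>; the first then acts with the
  result as its tail. This is how a tensor product turns into a composite.\<close>

lemma hat_otensor:
  assumes "wft s" "wft t" "wft s'" "wft t'" "z \<in> Obj C"
    and "ok F" "odom F = ob s" "ocod F = ob t" "ok G" "odom G = ob s'" "ocod G = ob t'"
  shows "hat (Node s s') (Node t t') (F \<boxtimes> G) z =
    hat s t F (act_ob t' z) ** act_arr s (hat s' t' G z)"
proof (rule hatI)
  let ?G = "hat s' t' G z"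
  have "(hat s t F (act_ob t' z) ** act_arr s ?G) ** con (Node s s') z =
      hat s t F (act_ob t' z) ** act_arr s ?G ** con s (act_ob s' z) **
      (oid (ob s) \<boxtimes> con s' z) ** oassoc (ob s) (ob s') z"
    using assms by (simp add: pcomp_assoc)
  also have "act_arr s ?G ** con s (act_ob s' z) **
      (oid (ob s) \<boxtimes> con s' z) ** oassoc (ob s) (ob s') z =
      con s (act_ob t' z) ** (oid (ob s) \<boxtimes> ?G) ** (oid (ob s) \<boxtimes> con s' z) ** oassoc (ob s) (ob s') z"
    using assms con_natural[of s ?G] by (simp add: pcomp_assoc[symmetric])
  also have "(oid (ob s) \<boxtimes> ?G) ** (oid (ob s) \<boxtimes> con s' z) ** oassoc (ob s) (ob s') z =
      (oid (ob s) \<boxtimes> con t' z) ** (oid (ob s) \<boxtimes> (G \<boxtimes> oid z)) ** oassoc (ob s) (ob s') z"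
    using assms by (simp add: pcomp_assoc[symmetric] hat_con flip: oid_otensor_pcomp)
  also have "hat s t F (act_ob t' z) ** con s (act_ob t' z) ** (oid (ob s) \<boxtimes> con t' z) **
      (oid (ob s) \<boxtimes> (G \<boxtimes> oid z)) ** oassoc (ob s) (ob s') z =
      con t (act_ob t' z) ** (F \<boxtimes> oid (act_ob t' z)) ** (oid (ob s) \<boxtimes> con t' z) **
      (oid (ob s) \<boxtimes> (G \<boxtimes> oid z)) ** oassoc (ob s) (ob s') z"
    using assms by (simp add: pcomp_eq_tail[OF hat_con] pcomp_assoc)
  also have "(F \<boxtimes> oid (act_ob t' z)) ** (oid (ob s) \<boxtimes> con t' z) **
      (oid (ob s) \<boxtimes> (G \<boxtimes> oid z)) ** oassoc (ob s) (ob s') z =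
      (oid (ob t) \<boxtimes> con t' z) ** (F \<boxtimes> (G \<boxtimes> oid z)) ** oassoc (ob s) (ob s') z"
    using assms by (simp add: pcomp_assoc[symmetric] flip: otensor_pcomp)
  also have "(F \<boxtimes> (G \<boxtimes> oid z)) ** oassoc (ob s) (ob s') z =
      oassoc (ob t) (ob t') z ** (F \<boxtimes> G \<boxtimes> oid z)"
    using oassoc_natural[of F G "oid z"] assms by simp
  finally show "(hat s t F (act_ob t' z) ** act_arr s ?G) ** con (Node s s') z =
      con (Node t t') z ** (F \<boxtimes> G \<boxtimes> oid z)"
    by (simp add: pcomp_assoc)
qed (use assms in auto)

text \<open>The pentagon says that the constraints of the two bracketings differ exactly by the
  associator.\<close>

lemma hat_oassoc:
  assumes "wft r" "wft s" "wft t" "z \<in> Obj C"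
  shows "hat (Node (Node r s) t) (Node r (Node s t)) (oassoc (ob r) (ob s) (ob t)) z =
    oid (act_ob r (act_ob s (act_ob t z)))"
proof (rule hatI)
  let ?r = "ob r" and ?s = "ob s" and ?t = "ob t"
  have "con (Node (Node r s) t) z = con r (act_ob s (act_ob t z)) **
      (oid ?r \<boxtimes> con s (act_ob t z)) ** oassoc ?r ?s (act_ob t z) **
      (oid ?r \<boxtimes> oid ?s \<boxtimes> con t z) ** oassoc (?r \<odot> ?s) ?t z"
    using assms by (simp add: pcomp_assoc)
  also have "oassoc ?r ?s (act_ob t z) ** (oid ?r \<boxtimes> oid ?s \<boxtimes> con t z) ** oassoc (?r \<odot> ?s) ?t z =
      (oid ?r \<boxtimes> (oid ?s \<boxtimes> con t z)) ** oassoc ?r ?s (?t \<odot> z) ** oassoc (?r \<odot> ?s) ?t z"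
    using oassoc_natural[of "oid ?r" "oid ?s" "con t z"] assms by (simp add: pcomp_assoc[symmetric])
  also have "oassoc ?r ?s (?t \<odot> z) ** oassoc (?r \<odot> ?s) ?t z =
      (oid ?r \<boxtimes> oassoc ?s ?t z) ** oassoc ?r (?s \<odot> ?t) z ** (oassoc ?r ?s ?t \<boxtimes> oid z)"
    using assms by (simp add: opentagon)
  finally have "con (Node (Node r s) t) z =
      con (Node r (Node s t)) z ** (oassoc ?r ?s ?t \<boxtimes> oid z)"
    using assms by (simp add: pcomp_assoc oid_otensor_pcomp)
  then show "oid (act_ob r (act_ob s (act_ob t z))) ** con (Node (Node r s) t) z =
    con (Node r (Node s t)) z ** (oassoc ?r ?s ?t \<boxtimes> oid z)"
    using assms by (metis act_ob.simps(3) act_ob_Obj con_ok(1,3) oid_pcomp wft.simps(3))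
qed (use assms in auto)

text \<open>The triangle axiom, as the unit letter contributes only a left unit constraint.\<close>

lemma hat_orunit:
  assumes "wft t" "z \<in> Obj C"
  shows "hat (Node t Unit) t (orunit (ob t)) z = oid (act_ob t z)"
  by (rule hatI) (use assms in \<open>simp_all add: otriangle\<close>)

text \<open>The right unit constraint is a natural isomorphism, so tensoring with the unit object is
  faithful; this makes the tail \<open>\<one>\<close> enough to detect an arrow.\<close>

lemma orunit_cancel:
  assumes "ok F" "ok G" "odom F = odom G" "ocod F = ocod G" "F \<boxtimes> oid \<one> = G \<boxtimes> oid \<one>"
  shows "F = G"
  by (rule oiso_cancel_right[of "orunit (odom F)"])
    (use assms orunit_natural[of F] orunit_natural[of G] in auto)

lemma olunit_cancel:
  assumes "ok F" "ok G" "odom F = odom G" "ocod F = ocod G" "oid \<one> \<boxtimes> F = oid \<one> \<boxtimes> G"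
  shows "F = G"
  by (rule oiso_cancel_right[of "olunit (odom F)"])
    (use assms olunit_natural[of F] olunit_natural[of G] in auto)

text \<open>Kelly's consequence of the pentagon and the triangle: it suffices to compare both sides after
  tensoring with the unit object on the left.\<close>

lemma olunit_oassoc:
  assumes "x \<in> Obj C" "y \<in> Obj C"
  shows "olunit (x \<odot> y) ** oassoc \<one> x y = olunit x \<boxtimes> oid y"
proof (rule olunit_cancel)
  let ?u = "oid \<one>"
  have nat: "oassoc \<one> x y ** (?u \<boxtimes> olunit x \<boxtimes> oid y) =
      (?u \<boxtimes> (olunit x \<boxtimes> oid y)) ** oassoc \<one> (\<one> \<odot> x) y"
    using oassoc_natural[of ?u "olunit x" "oid y"] assms by simp
  have nat': "oassoc \<one> x y ** (orunit \<one> \<boxtimes> oid x \<boxtimes> oid y) =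
      (orunit \<one> \<boxtimes> oid (x \<odot> y)) ** oassoc (\<one> \<odot> \<one>) x y"
    using oassoc_natural[of "orunit \<one>" "oid x" "oid y"] assms by simp
  have "(?u \<boxtimes> (olunit (x \<odot> y) ** oassoc \<one> x y)) ** oassoc \<one> (\<one> \<odot> x) y ** (oassoc \<one> \<one> x \<boxtimes> oid y) =
      (?u \<boxtimes> olunit (x \<odot> y)) ** oassoc \<one> \<one> (x \<odot> y) ** oassoc (\<one> \<odot> \<one>) x y"
    using assms by (simp add: oid_otensor_pcomp pcomp_assoc opentagon)
  also have "\<dots> = (orunit \<one> \<boxtimes> oid (x \<odot> y)) ** oassoc (\<one> \<odot> \<one>) x y"
    using assms by (simp add: pcomp_eq_tail[OF otriangle])
  also have "\<dots> = oassoc \<one> x y ** (orunit \<one> \<boxtimes> oid x \<boxtimes> oid y)"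
    by (simp add: nat')
  also have "\<dots> = oassoc \<one> x y ** (?u \<boxtimes> olunit x \<boxtimes> oid y) ** (oassoc \<one> \<one> x \<boxtimes> oid y)"
    using assms by (simp add: otriangle[symmetric] otensor_oid_pcomp)
  also have "\<dots> = (?u \<boxtimes> (olunit x \<boxtimes> oid y)) ** oassoc \<one> (\<one> \<odot> x) y ** (oassoc \<one> \<one> x \<boxtimes> oid y)"
    by (simp add: pcomp_eq_tail[OF nat] pcomp_assoc)
  finally have eq: "(?u \<boxtimes> (olunit (x \<odot> y) ** oassoc \<one> x y)) ** (oassoc \<one> (\<one> \<odot> x) y ** (oassoc \<one> \<one> x \<boxtimes> oid y)) =
      (?u \<boxtimes> (olunit x \<boxtimes> oid y)) ** (oassoc \<one> (\<one> \<odot> x) y ** (oassoc \<one> \<one> x \<boxtimes> oid y))" .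
  show "?u \<boxtimes> (olunit (x \<odot> y) ** oassoc \<one> x y) = ?u \<boxtimes> (olunit x \<boxtimes> oid y)"
    by (rule oiso_cancel_right[OF _ _ _ _ _ eq])
      (use assms in \<open>auto intro!: oiso_pcomp oiso_otensor\<close>)
qed (use assms in auto)

text \<open>The left unit constraint of the word meets an associator; Kelly's identity
  \<open>olunit_oassoc\<close> removes it.\<close>

lemma hat_olunit:
  assumes "wft t" "z \<in> Obj C"
  shows "hat (Node Unit t) t (olunit (ob t)) z = oid (act_ob t z)"
proof (rule hatI)
  have "con (Node Unit t) z = con t z ** olunit (ob t \<odot> z) ** oassoc \<one> (ob t) z"
    using assms pcomp_eq_tail[OF olunit_natural[of "con t z"], of "oassoc \<one> (ob t) z"]
    by (simp add: pcomp_assoc)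
  then show "oid (act_ob t z) ** con (Node Unit t) z = con t z ** (olunit (ob t) \<boxtimes> oid z)"
    using assms by (simp add: olunit_oassoc)
qed (use assms in auto)

lemma hat_oinv:
  assumes "wft s" "wft t" "z \<in> Obj C" "oiso F" "odom F = ob s" "ocod F = ob t"
    and "hat s t F z = oid (act_ob s z)" "act_ob t z = act_ob s z"
  shows "hat t s (oinv F) z = oid (act_ob t z)"
proof -
  have "hat t s (oinv F) z = hat t s (oinv F) z ** hat s t F z"
    using assms by (simp add: oinv oiso_ok)
  also have "\<dots> = hat s s (oinv F ** F) z"
    by (rule hat_pcomp[symmetric]) (use assms in \<open>simp_all add: oinv oiso_ok\<close>)
  finally show ?thesis
    using assms by (simp add: oinv hat_oid)
qed

lemma hat_cancel:
  assumes "wft s" "wft t" "ok F" "ok G" "odom F = ob s" "ocod F = ob t" "odom G = ob s" "ocod G = ob t"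
    and "hat s t F \<one> = hat s t G \<one>"
  shows "F = G"
proof (rule orunit_cancel)
  have "con t \<one> ** (F \<boxtimes> oid \<one>) = con t \<one> ** (G \<boxtimes> oid \<one>)"
    using hat_con[of s t \<one> F] hat_con[of s t \<one> G] assms by simp
  then show "F \<boxtimes> oid \<one> = G \<boxtimes> oid \<one>"
    by (rule oiso_cancel_left[rotated 5]) (use assms in auto)
qed (use assms in auto)

text \<open>\<open>tr f s t F\<close> says that the arrow \<open>f\<close> between the bracketed words \<open>s\<close> and \<open>t\<close> is translated to \<open>F\<close>.\<close>

definition tr :: "'a \<Rightarrow> 'o tree \<Rightarrow> 'o tree \<Rightarrow> ('o \<Rightarrow> 'a option) \<Rightarrow> bool" where
  "tr f s t F \<longleftrightarrow> wft s \<and> wft t \<and> f \<in> hom C (ob s) (ob t) \<and> (\<forall>z \<in> Obj C. F z = hat s t (Some f) z)"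

lemma tr_ok:
  assumes "tr f s t F" "z \<in> Obj C"
  shows "ok (F z)" "odom (F z) = act_ob s z" "ocod (F z) = act_ob t z"
  using assms by (auto simp: tr_def hom_def)

lemma tr_natural:
  assumes "tr f s t F" "ok H"
  shows "F (ocod H) ** act_arr s H = act_arr t H ** F (odom H)"
  using assms hat_natural[of s t "Some f" H] by (auto simp: tr_def hom_def)

lemma tr_Comp: "tr g r t G \<Longrightarrow> tr f s r F \<Longrightarrow> tr (g \<cdot> f) s t (\<lambda>z. G z ** F z)"
  using hat_pcomp[of s r t _ "Some f" "Some g"] Comp_hom[of f "ob s" "ob r" g "ob t"]
  by (auto simp: tr_def Some_Comp hom_Some)

lemma tr_tensor:
  "tr f s t F \<Longrightarrow> tr g s' t' G \<Longrightarrow>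
    tr (f \<otimes> g) (Node s s') (Node t t') (\<lambda>z. F (act_ob t' z) ** act_arr s (G z))"
  using hat_otensor[of s t s' t' _ "Some f" "Some g"] tensor_hom[of f "ob s" "ob t" g "ob s'" "ob t'"]
  by (auto simp: tr_def Some_tensor hom_Some)

lemma tr_Ident: "wft t \<Longrightarrow> tr (\<I> (ob t)) t t (\<lambda>z. oid (act_ob t z))"
  using hat_oid[of t] Ident_hom[of "ob t"] by (auto simp: tr_def oid_def)

lemma tr_assoc:
  "wft r \<Longrightarrow> wft s \<Longrightarrow> wft t \<Longrightarrow> tr (\<a> (ob r) (ob s) (ob t)) (Node (Node r s) t) (Node r (Node s t))
    (\<lambda>z. oid (act_ob r (act_ob s (act_ob t z))))"
  using hat_oassoc[of r s t] assoc_hom[of "ob r" "ob s" "ob t"] by (auto simp: tr_def oassoc_def)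

lemma tr_lunit: "wft t \<Longrightarrow> tr (\<l> (ob t)) (Node Unit t) t (\<lambda>z. oid (act_ob t z))"
  using hat_olunit[of t] lunit_hom[of "ob t"] by (auto simp: tr_def olunit_def)

lemma tr_runit: "wft t \<Longrightarrow> tr (\<r> (ob t)) (Node t Unit) t (\<lambda>z. oid (act_ob t z))"
  using hat_orunit[of t] runit_hom[of "ob t"] by (auto simp: tr_def orunit_def)

lemma tr_inv:
  assumes "tr f s t (\<lambda>z. oid (act_ob s z))" "is_iso C f" "act_ob s = act_ob t"
  shows "tr (inv_arr C f) t s (\<lambda>z. oid (act_ob t z))"
proof -
  have w: "wft s" "wft t" and f: "ok (Some f)" "odom (Some f) = ob s" "ocod (Some f) = ob t"
    and h: "hat s t (Some f) z = oid (act_ob s z)" if "z \<in> Obj C" for z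
    using assms(1) that by (auto simp: tr_def hom_def)
  have "hat t s (Some (inv_arr C f)) z = oid (act_ob t z)" if z: "z \<in> Obj C" for z
    unfolding is_iso_oiso(2)[OF assms(2)]
    by (rule hat_oinv[OF w(1)[OF z] w(2)[OF z] z is_iso_oiso(1)[OF assms(2)] f(2)[OF z] f(3)[OF z] h[OF z]])
      (simp add: assms(3))
  then show ?thesis
    using is_iso_oiso(3)[OF assms(2)] w[OF unit_Obj] f[OF unit_Obj] by (simp add: tr_def)
qed

lemma tr_assoc_inv:
  assumes "wft r" "wft s" "wft t"
  shows "tr (inv_arr C (\<a> (ob r) (ob s) (ob t))) (Node r (Node s t)) (Node (Node r s) t)
    (\<lambda>z. oid (act_ob r (act_ob s (act_ob t z))))"
  using tr_inv[of "\<a> (ob r) (ob s) (ob t)" "Node (Node r s) t" "Node r (Node s t)"]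
    tr_assoc[OF assms] assoc_iso[of "ob r" "ob s" "ob t"] assms by (simp add: fun_eq_iff)

lemma tr_lunit_inv: "wft t \<Longrightarrow> tr (inv_arr C (\<l> (ob t))) t (Node Unit t) (\<lambda>z. oid (act_ob t z))"
  using tr_inv[of "\<l> (ob t)" "Node Unit t" t] tr_lunit[of t] lunit_iso[of "ob t"]
  by (simp add: fun_eq_iff)

lemma tr_runit_inv: "wft t \<Longrightarrow> tr (inv_arr C (\<r> (ob t))) t (Node t Unit) (\<lambda>z. oid (act_ob t z))"
  using tr_inv[of "\<r> (ob t)" "Node t Unit" t] tr_runit[of t] runit_iso[of "ob t"]
  by (simp add: fun_eq_iff)

text \<open>Faithfulness of the translation. It is used forwards to read axioms as laws on words and
  backwards to return from words to arrows.\<close>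

lemma tr_eq_iff:
  assumes "tr f s t F" "tr g s t G"
  shows "f = g \<longleftrightarrow> (\<forall>z \<in> Obj C. F z = G z)"
  using assms hat_cancel[of s t "Some f" "Some g"] by (auto simp: tr_def hom_def)

lemma tr_eqI:
  assumes "tr f s t F" "tr g s t G" "\<And>z. z \<in> Obj C \<Longrightarrow> F z = G z"
  shows "f = g"
  using assms by (simp add: tr_eq_iff[OF assms(1,2)])

lemma tr_hom: "tr f s t F \<Longrightarrow> f \<in> hom C (ob s) (ob t)"
  by (simp add: tr_def)

end

section \<open>Translations of the individual constraints\<close>

context monoidal_category
begin

lemma tr_Ident_Unit: "tr (\<I> \<one>) Unit Unit (\<lambda>z. oid z)"
  using tr_Ident[of Unit] by simp

lemma tr_Ident_Leaf: "x \<in> Obj C \<Longrightarrow> tr (\<I> x) (Leaf x) (Leaf x) (\<lambda>z. oid (x \<odot> z))"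
  using tr_Ident[of "Leaf x"] by simp

lemma tr_Ident_Node: "x \<in> Obj C \<Longrightarrow> y \<in> Obj C \<Longrightarrow>
    tr (\<I> (x \<odot> y)) (Node (Leaf x) (Leaf y)) (Node (Leaf x) (Leaf y)) (\<lambda>z. oid (x \<odot> (y \<odot> z)))"
  using tr_Ident[of "Node (Leaf x) (Leaf y)"] by simp

lemma tr_assoc_Leaf: "x \<in> Obj C \<Longrightarrow> y \<in> Obj C \<Longrightarrow> w \<in> Obj C \<Longrightarrow>
    tr (\<a> x y w) (Node (Node (Leaf x) (Leaf y)) (Leaf w)) (Node (Leaf x) (Node (Leaf y) (Leaf w)))
      (\<lambda>z. oid (x \<odot> (y \<odot> (w \<odot> z))))"
  using tr_assoc[of "Leaf x" "Leaf y" "Leaf w"] by simp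

lemma tr_assoc_Node: "x \<in> Obj C \<Longrightarrow> y \<in> Obj C \<Longrightarrow> v \<in> Obj C \<Longrightarrow> w \<in> Obj C \<Longrightarrow>
    tr (\<a> x y (v \<odot> w)) (Node (Node (Leaf x) (Leaf y)) (Node (Leaf v) (Leaf w)))
      (Node (Leaf x) (Node (Leaf y) (Node (Leaf v) (Leaf w)))) (\<lambda>z. oid (x \<odot> (y \<odot> (v \<odot> (w \<odot> z)))))"
  using tr_assoc[of "Leaf x" "Leaf y" "Node (Leaf v) (Leaf w)"] by simp

lemma tr_assoc_inv_Leaf: "x \<in> Obj C \<Longrightarrow> y \<in> Obj C \<Longrightarrow> w \<in> Obj C \<Longrightarrow>
    tr (inv_arr C (\<a> x y w)) (Node (Leaf x) (Node (Leaf y) (Leaf w)))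
      (Node (Node (Leaf x) (Leaf y)) (Leaf w)) (\<lambda>z. oid (x \<odot> (y \<odot> (w \<odot> z))))"
  using tr_assoc_inv[of "Leaf x" "Leaf y" "Leaf w"] by simp

lemma tr_assoc_inv_Node: "x \<in> Obj C \<Longrightarrow> y \<in> Obj C \<Longrightarrow> v \<in> Obj C \<Longrightarrow> w \<in> Obj C \<Longrightarrow>
    tr (inv_arr C (\<a> x y (v \<odot> w))) (Node (Leaf x) (Node (Leaf y) (Node (Leaf v) (Leaf w))))
      (Node (Node (Leaf x) (Leaf y)) (Node (Leaf v) (Leaf w))) (\<lambda>z. oid (x \<odot> (y \<odot> (v \<odot> (w \<odot> z)))))"
  using tr_assoc_inv[of "Leaf x" "Leaf y" "Node (Leaf v) (Leaf w)"] by simp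

lemma tr_lunit_Unit: "tr (\<l> \<one>) (Node Unit Unit) Unit (\<lambda>z. oid z)"
  using tr_lunit[of Unit] by simp

lemma tr_lunit_Leaf: "x \<in> Obj C \<Longrightarrow> tr (\<l> x) (Node Unit (Leaf x)) (Leaf x) (\<lambda>z. oid (x \<odot> z))"
  using tr_lunit[of "Leaf x"] by simp

lemma tr_runit_Leaf: "x \<in> Obj C \<Longrightarrow> tr (\<r> x) (Node (Leaf x) Unit) (Leaf x) (\<lambda>z. oid (x \<odot> z))"
  using tr_runit[of "Leaf x"] by simp

lemma tr_lunit_inv_Unit: "tr (inv_arr C (\<l> \<one>)) Unit (Node Unit Unit) (\<lambda>z. oid z)"
  using tr_lunit_inv[of Unit] by simp

lemma tr_lunit_inv_Leaf:
    "x \<in> Obj C \<Longrightarrow> tr (inv_arr C (\<l> x)) (Leaf x) (Node Unit (Leaf x)) (\<lambda>z. oid (x \<odot> z))"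
  using tr_lunit_inv[of "Leaf x"] by simp

lemma tr_runit_inv_Leaf:
    "x \<in> Obj C \<Longrightarrow> tr (inv_arr C (\<r> x)) (Leaf x) (Node (Leaf x) Unit) (\<lambda>z. oid (x \<odot> z))"
  using tr_runit_inv[of "Leaf x"] by simp

text \<open>The \<open>Node\<close> variants precede the \<open>Leaf\<close> variants, so that an
  identity on a tensor product is read as a word of two letters before it is tried as a single
  letter.\<close>

lemmas tr_rules = tr_Comp tr_tensor tr_Ident_Unit tr_Ident_Node tr_Ident_Leaf
  tr_assoc_Node tr_assoc_Leaf tr_assoc_inv_Node tr_assoc_inv_Leaf tr_lunit_Unit tr_lunit_Leaf
  tr_runit_Leaf tr_lunit_inv_Unit tr_lunit_inv_Leaf tr_runit_inv_Leaf

lemma tr_iff: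
  "tr f s t F \<Longrightarrow> tr g s t G \<Longrightarrow> ((\<forall>z \<in> Obj C. F z = G z) \<longleftrightarrow> R) \<Longrightarrow> f = g \<longleftrightarrow> R"
  using tr_eq_iff by blast

lemma tr_hat_Some:
  "wft s \<Longrightarrow> wft t \<Longrightarrow> f \<in> hom C (ob s) (ob t) \<Longrightarrow> tr f s t (hat s t (Some f))"
  by (simp add: tr_def)

lemma pcomp_whisker [simp]:
  assumes "ok F" "ok G" "odom F = ocod G" "x \<in> Obj C"
  shows "(x |> F) ** (x |> G) = x |> (F ** G)" "(x |> F) ** (x |> G) ** H = (x |> (F ** G)) ** H"
  using assms by (simp_all add: whisker_pcomp pcomp_assoc)

text \<open>Operations on the tail get merged under one whiskering, which hides \<open>G\<close>
  from a law whose left side is \<open>F ** (x |> G)\<close>; this variant finds it there.\<close>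

lemma pcomp_whisker_inner:
  "F ** (x |> G) = H \<Longrightarrow> x \<in> Obj C \<Longrightarrow> ok G \<Longrightarrow> ok K \<Longrightarrow> odom G = ocod K \<Longrightarrow>
    F ** (x |> (G ** K)) = H ** (x |> K)"
  by (simp add: whisker_pcomp pcomp_assoc[symmetric] del: pcomp_whisker)

lemma pcomp_whisker_inner_tail:
  "F ** (x |> G) = H \<Longrightarrow> x \<in> Obj C \<Longrightarrow> ok G \<Longrightarrow> ok K \<Longrightarrow> odom G = ocod K \<Longrightarrow>
    F ** (x |> (G ** K)) ** T = H ** (x |> K) ** T"
  using pcomp_whisker_inner[of F x G H K] by (metis pcomp_assoc)

end

section \<open>The braiding of words\<close>

context braided_monoidal_category
begin

definition braid_tree :: "'o tree \<Rightarrow> 'o tree \<Rightarrow> 'o \<Rightarrow> 'a option" where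
  "braid_tree s t = hat (Node s t) (Node t s) (Some (\<sigma> (ob s) (ob t)))"

abbreviation braidw :: "'o \<Rightarrow> 'o \<Rightarrow> 'o \<Rightarrow> 'a option" where
  "braidw x y \<equiv> braid_tree (Leaf x) (Leaf y)"

lemma tr_braid: "wft s \<Longrightarrow> wft t \<Longrightarrow> tr (\<sigma> (ob s) (ob t)) (Node s t) (Node t s) (braid_tree s t)"
  by (simp add: braid_tree_def tr_hat_Some braid_hom)

lemma tr_braid_Leaf: "x \<in> Obj C \<Longrightarrow> y \<in> Obj C \<Longrightarrow>
    tr (\<sigma> x y) (Node (Leaf x) (Leaf y)) (Node (Leaf y) (Leaf x)) (braidw x y)"
  using tr_braid[of "Leaf x" "Leaf y"] by simp

lemma braid_tree_ok [simp]:
  assumes "wft s" "wft t" "z \<in> Obj C"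
  shows "ok (braid_tree s t z)" "odom (braid_tree s t z) = act_ob s (act_ob t z)"
    "ocod (braid_tree s t z) = act_ob t (act_ob s z)"
  using tr_ok[OF tr_braid] assms by auto

lemma oiso_hat:
  assumes "wft s" "wft t" "z \<in> Obj C" "oiso F" "odom F = ob s" "ocod F = ob t"
  shows "oiso (hat s t F z)"
proof (rule oisoI)
  have o: "ok F" using assms oiso_ok by auto
  show "hat t s (oinv F) z ** hat s t F z = oid (odom (hat s t F z))"
    "hat s t F z ** hat t s (oinv F) z = oid (ocod (hat s t F z))"
    using assms o hat_pcomp[of s t s z F "oinv F"] hat_pcomp[of t s t z "oinv F" F]
    by (simp_all add: oinv hat_oid)
qed (use assms oiso_ok[OF assms(4)] in \<open>auto simp: oinv\<close>)

lemma oiso_braid: "wft s \<Longrightarrow> wft t \<Longrightarrow> z \<in> Obj C \<Longrightarrow> oiso (braid_tree s t z)"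
  unfolding braid_tree_def
  by (rule oiso_hat) (use braid_hom[of "ob s" "ob t"] braid_iso[of "ob s" "ob t"] in
    \<open>auto simp: hom_def intro: is_iso_oiso(1)\<close>)

lemma braid_natural_left:
  assumes "tr f s t F" "wft r" "z \<in> Obj C"
  shows "braid_tree t r z ** F (act_ob r z) = act_arr r (F z) ** braid_tree s r z"
proof -
  note F = tr_ok[OF assms(1)]
  have w: "wft s" "wft t" using assms(1) by (auto simp: tr_def)
  have "\<sigma> (ob t) (ob r) \<cdot> (f \<otimes> \<I> (ob r)) = (\<I> (ob r) \<otimes> f) \<cdot> \<sigma> (ob s) (ob r)"
    using assms by (intro braid_natural) (auto simp: tr_def Ident_hom)
  then have "\<forall>z \<in> Obj C. braid_tree t r z ** F (act_ob r z) ** act_arr s (oid (act_ob r z)) =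
      (oid (act_ob r (act_ob t z)) ** act_arr r (F z)) ** braid_tree s r z"
    by (rule tr_eq_iff[THEN iffD1, rotated 2])
      (rule tr_rules tr_braid assms tr_Ident w)+
  then show ?thesis
    using assms w by (simp add: F)
qed

lemma braid_natural_right:
  assumes "tr f s t F" "wft r" "z \<in> Obj C"
  shows "braid_tree r t z ** act_arr r (F z) = F (act_ob r z) ** braid_tree r s z"
proof -
  note F = tr_ok[OF assms(1)]
  have w: "wft s" "wft t" using assms(1) by (auto simp: tr_def)
  have "\<sigma> (ob r) (ob t) \<cdot> (\<I> (ob r) \<otimes> f) = (f \<otimes> \<I> (ob r)) \<cdot> \<sigma> (ob r) (ob s)"
    using assms by (intro braid_natural) (auto simp: tr_def Ident_hom)
  then have "\<forall>z \<in> Obj C. braid_tree r t z ** oid (act_ob r (act_ob t z)) ** act_arr r (F z) =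
      (F (act_ob r z) ** act_arr s (oid (act_ob r z))) ** braid_tree r s z"
    by (rule tr_eq_iff[THEN iffD1, rotated 2])
      (rule tr_rules tr_braid assms tr_Ident w)+
  then show ?thesis
    using assms w by (simp add: F)
qed

lemma braid_natural_z:
  assumes "wft s" "wft t" "ok F"
  shows "braid_tree s t (ocod F) ** act_arr s (act_arr t F) = act_arr t (act_arr s F) ** braid_tree s t (odom F)"
  using tr_natural[OF tr_braid[OF assms(1,2)] assms(3)] by simp

text \<open>The first hexagon, with its associators translated to identities. The second hexagon
  does the same for a product on the left.\<close>

lemma braid_Node_right:
  assumes w: "wft r" "wft s" "wft t" and "z \<in> Obj C"
  shows "braid_tree r (Node s t) z = act_arr s (braid_tree r t z) ** braid_tree r s (act_ob t z)"
proof -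
  have "\<a> (ob s) (ob t) (ob r) \<cdot> \<sigma> (ob r) (ob (Node s t)) \<cdot> \<a> (ob r) (ob s) (ob t) =
      (\<I> (ob s) \<otimes> \<sigma> (ob r) (ob t)) \<cdot> \<a> (ob s) (ob r) (ob t) \<cdot> (\<sigma> (ob r) (ob s) \<otimes> \<I> (ob t))"
    using assms hexagon1[of "ob r" "ob s" "ob t"] by simp
  then have "\<forall>z \<in> Obj C. oid (act_ob s (act_ob t (act_ob r z))) ** braid_tree r (Node s t) z **
        oid (act_ob r (act_ob s (act_ob t z))) =
      (oid (act_ob s (act_ob (Node t r) z)) ** act_arr s (braid_tree r t z)) **
      oid (act_ob s (act_ob r (act_ob t z))) **
      braid_tree r s (act_ob t z) ** act_arr (Node r s) (oid (act_ob t z))"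
    apply (rule tr_eq_iff[THEN iffD1, rotated 2])
     apply (rule tr_Comp tr_tensor tr_braid tr_Ident tr_assoc w wft.simps(3)[THEN iffD2] conjI)+
    done
  then show ?thesis
    using assms by simp
qed

lemma braid_Node_left:
  assumes w: "wft r" "wft s" "wft t" and "z \<in> Obj C"
  shows "braid_tree (Node r s) t z = braid_tree r t (act_ob s z) ** act_arr r (braid_tree s t z)"
proof -
  have "inv_arr C (\<a> (ob t) (ob r) (ob s)) \<cdot> \<sigma> (ob (Node r s)) (ob t) \<cdot> inv_arr C (\<a> (ob r) (ob s) (ob t)) =
      (\<sigma> (ob r) (ob t) \<otimes> \<I> (ob s)) \<cdot> inv_arr C (\<a> (ob r) (ob t) (ob s)) \<cdot> (\<I> (ob r) \<otimes> \<sigma> (ob s) (ob t))"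
    using assms hexagon2[of "ob r" "ob s" "ob t"] by simp
  then have "\<forall>z \<in> Obj C. oid (act_ob t (act_ob r (act_ob s z))) ** braid_tree (Node r s) t z **
        oid (act_ob r (act_ob s (act_ob t z))) =
      (braid_tree r t (act_ob s z) ** act_arr (Node r t) (oid (act_ob s z))) **
      oid (act_ob r (act_ob t (act_ob s z))) **
      oid (act_ob r (act_ob (Node t s) z)) ** act_arr r (braid_tree s t z)"
    apply (rule tr_eq_iff[THEN iffD1, rotated 2])
     apply (rule tr_Comp tr_tensor tr_braid tr_Ident tr_assoc_inv w wft.simps(3)[THEN iffD2] conjI)+
    done
  then show ?thesis
    using assms by simp
qed

text \<open>The hexagon exhibits the braiding with the unit object as an idempotent isomorphism.\<close>

lemma braid_Unit_right [simp]:
  assumes "wft s" "z \<in> Obj C"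
  shows "braid_tree s Unit z = oid (act_ob s z)"
proof (rule oiso_cancel_right[of "braid_tree s Unit z"])
  have "tr (\<l> \<one>) (Node Unit Unit) Unit (\<lambda>z. oid z)"
    by (rule tr_lunit_Unit)
  from braid_natural_right[OF this assms]
  show "braid_tree s Unit z ** braid_tree s Unit z = oid (act_ob s z) ** braid_tree s Unit z"
    using assms by (simp add: braid_Node_right)
qed (use assms in \<open>auto simp: oiso_braid\<close>)

lemma braid_Unit_left [simp]:
  assumes "wft s" "z \<in> Obj C"
  shows "braid_tree Unit s z = oid (act_ob s z)"
proof (rule oiso_cancel_right[of "braid_tree Unit s z"])
  have "tr (\<l> \<one>) (Node Unit Unit) Unit (\<lambda>z. oid z)"
    by (rule tr_lunit_Unit)
  from braid_natural_left[OF this assms]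
  show "braid_tree Unit s z ** braid_tree Unit s z = oid (act_ob s z) ** braid_tree Unit s z"
    using assms by (simp add: braid_Node_left)
qed (use assms in \<open>auto simp: oiso_braid\<close>)

text \<open>All associators of the definition become identities, so only the crossing of the two
  inner letters is left.\<close>

lemma tr_middle_braid:
  assumes "x \<in> Obj C" "y \<in> Obj C" "v \<in> Obj C" "w \<in> Obj C"
  shows "tr (middle_braid C x y v w)
    (Node (Node (Leaf x) (Leaf y)) (Node (Leaf v) (Leaf w)))
    (Node (Node (Leaf x) (Leaf v)) (Node (Leaf y) (Leaf w))) (\<lambda>z. x |> braidw y v (w \<odot> z))"
proof -
  have "tr (middle_braid C x y v w)
    (Node (Node (Leaf x) (Leaf y)) (Node (Leaf v) (Leaf w)))
    (Node (Node (Leaf x) (Leaf v)) (Node (Leaf y) (Leaf w)))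
    (\<lambda>z. oid (x \<odot> (v \<odot> (y \<odot> (w \<odot> z)))) **
     (oid (x \<odot> act_ob (Node (Leaf v) (Node (Leaf y) (Leaf w))) z) **
     act_arr (Leaf x) (oid (v \<odot> (y \<odot> (w \<odot> z))) **
       (braidw y v (act_ob (Leaf w) z) ** act_arr (Node (Leaf y) (Leaf v)) (oid (w \<odot> z))) **
       oid (y \<odot> (v \<odot> (w \<odot> z))))) ** oid (x \<odot> (y \<odot> (v \<odot> (w \<odot> z)))))"
    unfolding middle_braid_def by (rule tr_rules tr_braid_Leaf assms)+
  then show ?thesis
    using assms by (auto simp: tr_def)
qed

end

section \<open>Words of structure arrows\<close>

context braided_monoidal_category
begin

abbreviation word_cons :: "'o \<Rightarrow> 'o \<Rightarrow> 'o"  (infixr "*." 70) where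
  "x *. y \<equiv> x \<odot> y"

text \<open>The word operations: the translations of the structure arrows, acting on the head of a word.\<close>

definition Hw :: "'o \<Rightarrow> 'o \<Rightarrow> 'a \<Rightarrow> 'o \<Rightarrow> 'a option" where
  "Hw x y f = hat (Leaf x) (Leaf y) (Some f)"

definition Dw :: "('o, 'a, 'y) comonoid_scheme \<Rightarrow> 'o \<Rightarrow> 'a option" where
  "Dw X = hat (Leaf (carr X)) (Node (Leaf (carr X)) (Leaf (carr X))) (Some (comul X))"

definition Ew :: "('o, 'a, 'y) comonoid_scheme \<Rightarrow> 'o \<Rightarrow> 'a option" where
  "Ew X = hat (Leaf (carr X)) Unit (Some (counit X))"

definition Mw :: "('o, 'a) hopf_monoid \<Rightarrow> 'o \<Rightarrow> 'a option" where
  "Mw A = hat (Node (Leaf (carr A)) (Leaf (carr A))) (Leaf (carr A)) (Some (mul A))"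

definition Uw :: "('o, 'a) hopf_monoid \<Rightarrow> 'o \<Rightarrow> 'a option" where
  "Uw A = hat Unit (Leaf (carr A)) (Some (unit_arr A))"

definition Sw :: "('o, 'a) hopf_monoid \<Rightarrow> 'o \<Rightarrow> 'a option" where
  "Sw A = hat (Leaf (carr A)) (Leaf (carr A)) (Some (antipode A))"

definition Lw :: "('o, 'a) hopf_monoid \<Rightarrow> ('o, 'a) module_comonoid \<Rightarrow> 'o \<Rightarrow> 'a option" where
  "Lw A Q = hat (Node (Leaf (carr A)) (Leaf (carr Q))) (Leaf (carr Q)) (Some (act Q))"

lemma tr_Hw: "x \<in> Obj C \<Longrightarrow> y \<in> Obj C \<Longrightarrow> f \<in> hom C x y \<Longrightarrow> tr f (Leaf x) (Leaf y) (Hw x y f)"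
  by (simp add: Hw_def tr_hat_Some)

lemma tr_Dw: "carr X \<in> Obj C \<Longrightarrow> comul X \<in> hom C (carr X) (carr X *. carr X) \<Longrightarrow>
    tr (comul X) (Leaf (carr X)) (Node (Leaf (carr X)) (Leaf (carr X))) (Dw X)"
  by (simp add: Dw_def tr_hat_Some)

lemma tr_Ew: "carr X \<in> Obj C \<Longrightarrow> counit X \<in> hom C (carr X) \<one> \<Longrightarrow>
    tr (counit X) (Leaf (carr X)) Unit (Ew X)"
  by (simp add: Ew_def tr_hat_Some)

lemma tr_Mw: "carr A \<in> Obj C \<Longrightarrow> mul A \<in> hom C (carr A *. carr A) (carr A) \<Longrightarrow>
    tr (mul A) (Node (Leaf (carr A)) (Leaf (carr A))) (Leaf (carr A)) (Mw A)"
  by (simp add: Mw_def tr_hat_Some)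

lemma tr_Uw: "carr A \<in> Obj C \<Longrightarrow> unit_arr A \<in> hom C \<one> (carr A) \<Longrightarrow>
    tr (unit_arr A) Unit (Leaf (carr A)) (Uw A)"
  by (simp add: Uw_def tr_hat_Some)

lemma tr_Sw: "carr A \<in> Obj C \<Longrightarrow> antipode A \<in> hom C (carr A) (carr A) \<Longrightarrow>
    tr (antipode A) (Leaf (carr A)) (Leaf (carr A)) (Sw A)"
  by (simp add: Sw_def tr_hat_Some)

lemma tr_Lw: "carr A \<in> Obj C \<Longrightarrow> carr Q \<in> Obj C \<Longrightarrow> act Q \<in> hom C (carr A *. carr Q) (carr Q) \<Longrightarrow>
    tr (act Q) (Node (Leaf (carr A)) (Leaf (carr Q))) (Leaf (carr Q)) (Lw A Q)"
  by (simp add: Lw_def tr_hat_Some)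

lemmas op_tr = tr_Dw tr_Ew tr_Mw tr_Uw tr_Sw tr_Lw tr_Hw

lemmas op_tr_ok = tr_ok[OF tr_Hw] tr_ok[OF tr_Dw] tr_ok[OF tr_Ew] tr_ok[OF tr_Mw]
  tr_ok[OF tr_Uw] tr_ok[OF tr_Sw] tr_ok[OF tr_Lw]

text \<open>Axiom by axiom by faithfulness of the translation. The laws of the given structures are
  read off from this equivalence and its analogues, and \<open>Q\<close> and \<open>K\<close> are
  recognised by them.\<close>

lemma cocomm_comonoid_iff:
  "is_cocomm_comonoid C X \<longleftrightarrow> (let x = carr X in
     x \<in> Obj C \<and> comul X \<in> hom C x (x *. x) \<and> counit X \<in> hom C x \<one> \<and>
     (\<forall>z \<in> Obj C. Dw X (x *. z) ** Dw X z = (x |> Dw X z) ** Dw X z) \<and>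
     (\<forall>z \<in> Obj C. Ew X (x *. z) ** Dw X z = oid (x *. z)) \<and>
     (\<forall>z \<in> Obj C. (x |> Ew X z) ** Dw X z = oid (x *. z)) \<and>
     (\<forall>z \<in> Obj C. braidw x x z ** Dw X z = Dw X z))"
  unfolding is_cocomm_comonoid_def Let_def
  by (intro conj_cong refl; rule tr_iff, (rule tr_rules op_tr tr_braid_Leaf | assumption)+,
    simp add: op_tr_ok)

lemma cocomm_hopf_monoid_iff:
  "is_cocomm_hopf_monoid C A \<longleftrightarrow> is_cocomm_comonoid C A \<and> (let a = carr A in
     mul A \<in> hom C (a *. a) a \<and> unit_arr A \<in> hom C \<one> a \<and> antipode A \<in> hom C a a \<and>
     (\<forall>z \<in> Obj C. Mw A z ** Mw A (a *. z) = Mw A z ** (a |> Mw A z)) \<and>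
     (\<forall>z \<in> Obj C. Mw A z ** Uw A (a *. z) = oid (a *. z)) \<and>
     (\<forall>z \<in> Obj C. Mw A z ** (a |> Uw A z) = oid (a *. z)) \<and>
     (\<forall>z \<in> Obj C. Dw A z ** Mw A z = Mw A (a *. z) ** (a |> a |> Mw A z) **
        (a |> braidw a a (a *. z)) ** Dw A (a *. a *. z) ** (a |> Dw A z)) \<and>
     (\<forall>z \<in> Obj C. Dw A z ** Uw A z = Uw A (a *. z) ** Uw A z) \<and>
     (\<forall>z \<in> Obj C. Ew A z ** Mw A z = Ew A z ** (a |> Ew A z)) \<and>
     (\<forall>z \<in> Obj C. Ew A z ** Uw A z = oid z) \<and>
     (\<forall>z \<in> Obj C. Mw A z ** Sw A (a *. z) ** Dw A z = Uw A z ** Ew A z) \<and>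
     (\<forall>z \<in> Obj C. Mw A z ** (a |> Sw A z) ** Dw A z = Uw A z ** Ew A z))"
\<comment> \<open>The remaining axioms can be translated only when the comonoid part is well typed;
  if it fails, both sides are false.\<close>
proof (cases "is_cocomm_comonoid C A")
  case True
  then have X: "carr A \<in> Obj C" "comul A \<in> hom C (carr A) (carr A *. carr A)"
      "counit A \<in> hom C (carr A) \<one>"
    by (auto simp: is_cocomm_comonoid_def Let_def)
  show ?thesis
    unfolding is_cocomm_hopf_monoid_def Let_def
    by (intro conj_cong refl; rule tr_iff,
      (rule tr_rules op_tr tr_braid_Leaf tr_middle_braid X | assumption)+,
      simp add: op_tr_ok X pcomp_assoc del: pcomp_whisker)
qed (simp add: is_cocomm_hopf_monoid_def)

lemma comonoid_morphism_iff:
  assumes "is_cocomm_comonoid C X" "is_cocomm_comonoid C Y"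
  shows "comonoid_morphism C X Y f \<longleftrightarrow> (let x = carr X; y = carr Y in f \<in> hom C x y \<and>
     (\<forall>z \<in> Obj C. Dw Y z ** Hw x y f z = Hw x y f (y *. z) ** (x |> Hw x y f z) ** Dw X z) \<and>
     (\<forall>z \<in> Obj C. Ew Y z ** Hw x y f z = Ew X z))"
proof -
  have X: "carr X \<in> Obj C" "comul X \<in> hom C (carr X) (carr X *. carr X)"
      "counit X \<in> hom C (carr X) \<one>"
    and Y: "carr Y \<in> Obj C" "comul Y \<in> hom C (carr Y) (carr Y *. carr Y)"
      "counit Y \<in> hom C (carr Y) \<one>"
    using assms by (auto simp: is_cocomm_comonoid_def Let_def)
  show ?thesis
    unfolding comonoid_morphism_def Let_def
    by (intro conj_cong refl; rule tr_iff, (rule tr_rules op_tr X Y | assumption)+,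
      simp add: op_tr_ok X Y pcomp_assoc del: pcomp_whisker)
qed

lemma hopf_morphism_iff:
  assumes "is_cocomm_hopf_monoid C A" "is_cocomm_hopf_monoid C B"
  shows "hopf_morphism C A B f \<longleftrightarrow> comonoid_morphism C A B f \<and> (let a = carr A; b = carr B in
     (\<forall>z \<in> Obj C. Hw a b f z ** Mw A z = Mw B z ** Hw a b f (b *. z) ** (a |> Hw a b f z)) \<and>
     (\<forall>z \<in> Obj C. Hw a b f z ** Uw A z = Uw B z))"
proof (cases "comonoid_morphism C A B f")
  case True
  then have f: "f \<in> hom C (carr A) (carr B)"
    by (simp add: comonoid_morphism_def)
  have A: "carr A \<in> Obj C" "mul A \<in> hom C (carr A *. carr A) (carr A)" "unit_arr A \<in> hom C \<one> (carr A)"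
    and B: "carr B \<in> Obj C" "mul B \<in> hom C (carr B *. carr B) (carr B)" "unit_arr B \<in> hom C \<one> (carr B)"
    using assms by (auto simp: is_cocomm_hopf_monoid_def is_cocomm_comonoid_def Let_def)
  show ?thesis
    unfolding hopf_morphism_def Let_def
    by (intro conj_cong refl; rule tr_iff, (rule tr_rules op_tr A B f | assumption)+,
      simp add: op_tr_ok A B f pcomp_assoc del: pcomp_whisker)
qed (simp add: hopf_morphism_def)

lemma module_comonoid_iff:
  assumes "is_cocomm_hopf_monoid C A"
  shows "is_cocomm_module_comonoid C A Q \<longleftrightarrow> is_cocomm_comonoid C Q \<and> (let a = carr A; q = carr Q in
     act Q \<in> hom C (a *. q) q \<and>
     (\<forall>z \<in> Obj C. Lw A Q z ** Mw A (q *. z) = Lw A Q z ** (a |> Lw A Q z)) \<and>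
     (\<forall>z \<in> Obj C. Lw A Q z ** Uw A (q *. z) = oid (q *. z)) \<and>
     (\<forall>z \<in> Obj C. Dw Q z ** Lw A Q z = Lw A Q (q *. z) ** (a |> q |> Lw A Q z) **
        (a |> braidw a q (q *. z)) ** Dw A (q *. q *. z) ** (a |> Dw Q z)) \<and>
     (\<forall>z \<in> Obj C. Ew Q z ** Lw A Q z = Ew A z ** (a |> Ew Q z)))"
  (is "_ \<longleftrightarrow> ?R")
proof (cases "is_cocomm_comonoid C Q")
  case True
  then have Q: "carr Q \<in> Obj C" "comul Q \<in> hom C (carr Q) (carr Q *. carr Q)"
      "counit Q \<in> hom C (carr Q) \<one>"
    by (auto simp: is_cocomm_comonoid_def Let_def)
  have A: "carr A \<in> Obj C" "mul A \<in> hom C (carr A *. carr A) (carr A)" "unit_arr A \<in> hom C \<one> (carr A)"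
     "comul A \<in> hom C (carr A) (carr A *. carr A)" "counit A \<in> hom C (carr A) \<one>"
    using assms by (auto simp: is_cocomm_hopf_monoid_def is_cocomm_comonoid_def Let_def)
  have "is_cocomm_module_comonoid C A Q \<longleftrightarrow> is_cocomm_comonoid C Q \<and>
    (act Q \<in> hom C (carr A *. carr Q) (carr Q) \<and>
     act Q \<cdot> (mul A \<otimes> \<I> (carr Q)) = act Q \<cdot> (\<I> (carr A) \<otimes> act Q) \<cdot> \<a> (carr A) (carr A) (carr Q) \<and>
     act Q \<cdot> (unit_arr A \<otimes> \<I> (carr Q)) = \<l> (carr Q) \<and>
     left_linear C A (act Q) (tensor_act C A (carr Q) (act Q)) (comul Q) \<and>
     left_linear C A (act Q) (unit_act C A) (counit Q))"
    using Q by (auto simp: is_cocomm_module_comonoid_def left_module_def)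
  also have "\<dots> \<longleftrightarrow> ?R"
    unfolding left_linear_def tensor_act_def unit_act_def Let_def
    by (intro conj_cong refl; rule tr_iff,
      (rule tr_rules op_tr tr_braid_Leaf tr_middle_braid A Q | assumption)+,
      simp add: op_tr_ok A Q pcomp_assoc del: pcomp_whisker)
  finally show ?thesis .
qed (simp add: is_cocomm_module_comonoid_def)

lemma left_linear_iff:
  assumes "is_cocomm_hopf_monoid C A" "is_cocomm_module_comonoid C A P" "is_cocomm_module_comonoid C A Q"
    and f: "f \<in> hom C (carr P) (carr Q)"
  shows "left_linear C A (act P) (act Q) f \<longleftrightarrow> (let p = carr P; q = carr Q in
    \<forall>z \<in> Obj C. Hw p q f z ** Lw A P z = Lw A Q z ** (carr A |> Hw p q f z))"
proof -
  have P: "carr P \<in> Obj C" "act P \<in> hom C (carr A *. carr P) (carr P)"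
    and Q: "carr Q \<in> Obj C" "act Q \<in> hom C (carr A *. carr Q) (carr Q)" and A: "carr A \<in> Obj C"
    using assms by (auto simp: is_cocomm_module_comonoid_def left_module_def
      is_cocomm_hopf_monoid_def is_cocomm_comonoid_def Let_def)
  show ?thesis
    unfolding left_linear_def Let_def
    by (rule tr_iff, (rule tr_rules op_tr A P Q f | assumption)+,
      simp add: op_tr_ok P Q A f pcomp_assoc del: pcomp_whisker)
qed

end

context braided_monoidal_category
begin

text \<open>The rewriting rules on words push the operations on the head of a word to the right
  (they are applied first) and merge operations on the tail. Each law is also used
  followed by a further composite and with that composite inside the whiskering.\<close>

lemma braidw_nat:
  "x \<in> Obj C \<Longrightarrow> y \<in> Obj C \<Longrightarrow> ok F \<Longrightarrow> ocod F = z \<Longrightarrow>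
    braidw x y z ** (x |> y |> F) = (y |> x |> F) ** braidw x y (odom F)"
  using braid_natural_z[of "Leaf x" "Leaf y" F] by auto

lemmas braidw_nat_rules = braidw_nat braidw_nat[THEN pcomp_eq_tail, unfolded pcomp_assoc]
  braidw_nat[THEN pcomp_whisker_inner, unfolded pcomp_assoc]
  braidw_nat[THEN pcomp_whisker_inner_tail, unfolded pcomp_assoc]

lemma Hw_ok [simp]:
  assumes "x \<in> Obj C" "y \<in> Obj C" "f \<in> hom C x y" "z \<in> Obj C"
  shows "ok (Hw x y f z)" "odom (Hw x y f z) = x *. z" "ocod (Hw x y f z) = y *. z"
  using tr_ok[OF tr_Hw] assms by simp_all

lemma Hw_nat:
  assumes "x \<in> Obj C" "y \<in> Obj C" "f \<in> hom C x y" "ok F" "ocod F = z"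
  shows "Hw x y f z ** (x |> F) = (y |> F) ** Hw x y f (odom F)"
  using tr_natural[OF tr_Hw] assms by force

lemma braidw_Hw_left:
  assumes "x \<in> Obj C" "y \<in> Obj C" "f \<in> hom C x y" "z \<in> Obj C" "w \<in> Obj C"
  shows "braidw y w z ** Hw x y f (w *. z) = (w |> Hw x y f z) ** braidw x w z"
  using braid_natural_left[OF tr_Hw, of x y f "Leaf w" z] assms by simp

lemma braidw_Hw_right:
  assumes "x \<in> Obj C" "y \<in> Obj C" "f \<in> hom C x y" "z \<in> Obj C" "w \<in> Obj C"
  shows "braidw w y z ** (w |> Hw x y f z) = Hw x y f (w *. z) ** braidw w x z"
  using braid_natural_right[OF tr_Hw, of x y f "Leaf w" z] assms by simp

lemma Hw_nat':
  "x \<in> Obj C \<Longrightarrow> y \<in> Obj C \<Longrightarrow> f \<in> hom C x y \<Longrightarrow> ok F \<Longrightarrow> odom F = z \<Longrightarrow>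
    (y |> F) ** Hw x y f z = Hw x y f (ocod F) ** (x |> F)"
  by (simp add: Hw_nat)

text \<open>One law in two orientations that would loop together, so each proof picks one:
  \<open>Hw_right\<close> moves \<open>f\<close> to the right, where it is applied first, and
  \<open>Hw_left\<close> lets the tail act first.\<close>

lemmas Hw_right = Hw_nat Hw_nat[THEN pcomp_eq_tail, unfolded pcomp_assoc]

lemmas Hw_left = Hw_nat' Hw_nat'[THEN pcomp_eq_tail, unfolded pcomp_assoc]

lemmas Hw_laws = braidw_Hw_left braidw_Hw_right

lemmas Hw_laws_whisker = braidw_Hw_right

lemmas Hw_rules = Hw_laws Hw_laws[THEN pcomp_eq_tail, unfolded pcomp_assoc]
  Hw_laws_whisker[THEN pcomp_whisker_inner, unfolded pcomp_assoc]
  Hw_laws_whisker[THEN pcomp_whisker_inner_tail, unfolded pcomp_assoc]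

text \<open>Typing without axioms: naturality of the word operations is then available for
  \<open>Q\<close> and \<open>K\<close> before their laws are established.\<close>

definition comonoid_typed :: "('o, 'a, 'y) comonoid_scheme \<Rightarrow> bool" where
  "comonoid_typed X \<longleftrightarrow> carr X \<in> Obj C \<and> comul X \<in> hom C (carr X) (carr X *. carr X) \<and>
     counit X \<in> hom C (carr X) \<one>"

definition hopf_typed :: "('o, 'a) hopf_monoid \<Rightarrow> bool" where
  "hopf_typed A \<longleftrightarrow> comonoid_typed A \<and> mul A \<in> hom C (carr A *. carr A) (carr A) \<and>
     unit_arr A \<in> hom C \<one> (carr A) \<and> antipode A \<in> hom C (carr A) (carr A)"

definition module_typed :: "('o, 'a) hopf_monoid \<Rightarrow> ('o, 'a) module_comonoid \<Rightarrow> bool" where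
  "module_typed A Q \<longleftrightarrow> carr A \<in> Obj C \<and> comonoid_typed Q \<and> act Q \<in> hom C (carr A *. carr Q) (carr Q)"

lemma cocomm_comonoid_typed: "is_cocomm_comonoid C X \<Longrightarrow> comonoid_typed X"
  by (auto simp: is_cocomm_comonoid_def comonoid_typed_def Let_def)

lemma hopf_comonoid: "is_cocomm_hopf_monoid C A \<Longrightarrow> is_cocomm_comonoid C A"
  by (simp add: is_cocomm_hopf_monoid_def)

lemma cocomm_hopf_typed: "is_cocomm_hopf_monoid C A \<Longrightarrow> hopf_typed A"
  by (auto simp: is_cocomm_hopf_monoid_def hopf_typed_def Let_def intro: cocomm_comonoid_typed)

lemma hopf_typed_comonoid: "hopf_typed A \<Longrightarrow> comonoid_typed A"
  by (simp add: hopf_typed_def)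

lemma module_comonoid_typed:
  "is_cocomm_hopf_monoid C A \<Longrightarrow> is_cocomm_module_comonoid C A Q \<Longrightarrow> module_typed A Q"
  using cocomm_comonoid_typed[OF hopf_comonoid, of A] cocomm_comonoid_typed[of Q]
  by (auto simp: is_cocomm_module_comonoid_def left_module_def module_typed_def comonoid_typed_def)

lemma module_typed_comonoid: "module_typed A Q \<Longrightarrow> comonoid_typed Q"
  by (simp add: module_typed_def)

lemma module_comonoid: "is_cocomm_module_comonoid C A Q \<Longrightarrow> is_cocomm_comonoid C Q"
  by (simp add: is_cocomm_module_comonoid_def)

section \<open>Naturality of the operations and their passage through the braiding\<close>

context
  fixes X :: "('o, 'a, 'y) comonoid_scheme"
  assumes X: "comonoid_typed X"
begin

lemma comonoid_hom:
  shows "carr X \<in> Obj C" "comul X \<in> hom C (carr X) (carr X *. carr X)" "counit X \<in> hom C (carr X) \<one>"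
  using X by (auto simp: comonoid_typed_def)

lemma Dw_ok:
  assumes "z \<in> Obj C"
  shows "ok (Dw X z)" "odom (Dw X z) = carr X *. z" "ocod (Dw X z) = carr X *. carr X *. z"
  using tr_ok[OF tr_Dw[OF comonoid_hom(1,2)]] assms by auto

lemma Ew_ok:
  assumes "z \<in> Obj C"
  shows "ok (Ew X z)" "odom (Ew X z) = carr X *. z" "ocod (Ew X z) = z"
  using tr_ok[OF tr_Ew[OF comonoid_hom(1,3)]] assms by auto

lemma Dw_nat:
  "ok F \<Longrightarrow> ocod F = z \<Longrightarrow> Dw X z ** (carr X |> F) = (carr X |> carr X |> F) ** Dw X (odom F)"
  using tr_natural[OF tr_Dw[OF comonoid_hom(1,2)]] by force

lemma Ew_nat: "ok F \<Longrightarrow> ocod F = z \<Longrightarrow> Ew X z ** (carr X |> F) = F ** Ew X (odom F)"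
  using tr_natural[OF tr_Ew[OF comonoid_hom(1,3)]] by force

lemma braidw_Ew_right:
  assumes "y \<in> Obj C" "z \<in> Obj C"
  shows "Ew X (y *. z) ** braidw y (carr X) z = y |> Ew X z"
  using braid_natural_right[OF tr_Ew[OF comonoid_hom(1,3)], of "Leaf y" z] assms
  by (simp add: Ew_ok)

lemma braidw_Ew_left:
  assumes "y \<in> Obj C" "z \<in> Obj C"
  shows "(y |> Ew X z) ** braidw (carr X) y z = Ew X (y *. z)"
  using braid_natural_left[OF tr_Ew[OF comonoid_hom(1,3)], of "Leaf y" z] assms
  by (simp add: Ew_ok)

end

context
  fixes A :: "('o, 'a) hopf_monoid"
  assumes A: "hopf_typed A"
begin

lemma hopf_hom:
  shows "mul A \<in> hom C (carr A *. carr A) (carr A)" "unit_arr A \<in> hom C \<one> (carr A)"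
    "antipode A \<in> hom C (carr A) (carr A)"
  using A by (auto simp: hopf_typed_def)

lemmas hopf_Obj = comonoid_hom(1)[OF hopf_typed_comonoid[OF A]]

lemma Mw_ok:
  assumes "z \<in> Obj C"
  shows "ok (Mw A z)" "odom (Mw A z) = carr A *. carr A *. z" "ocod (Mw A z) = carr A *. z"
  using tr_ok[OF tr_Mw[OF hopf_Obj hopf_hom(1)]] assms by auto

lemma Uw_ok:
  assumes "z \<in> Obj C"
  shows "ok (Uw A z)" "odom (Uw A z) = z" "ocod (Uw A z) = carr A *. z"
  using tr_ok[OF tr_Uw[OF hopf_Obj hopf_hom(2)]] assms by auto

lemma Sw_ok:
  assumes "z \<in> Obj C"
  shows "ok (Sw A z)" "odom (Sw A z) = carr A *. z" "ocod (Sw A z) = carr A *. z"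
  using tr_ok[OF tr_Sw[OF hopf_Obj hopf_hom(3)]] assms by auto

lemma Mw_nat: "ok F \<Longrightarrow> ocod F = z \<Longrightarrow>
    Mw A z ** (carr A |> carr A |> F) = (carr A |> F) ** Mw A (odom F)"
  using tr_natural[OF tr_Mw[OF hopf_Obj hopf_hom(1)]] by force

lemma Uw_nat: "ok F \<Longrightarrow> odom F = z \<Longrightarrow> (carr A |> F) ** Uw A z = Uw A (ocod F) ** F"
  using tr_natural[OF tr_Uw[OF hopf_Obj hopf_hom(2)]] by force

lemma Sw_nat: "ok F \<Longrightarrow> ocod F = z \<Longrightarrow> Sw A z ** (carr A |> F) = (carr A |> F) ** Sw A (odom F)"
  using tr_natural[OF tr_Sw[OF hopf_Obj hopf_hom(3)]] by force

lemma braidw_Mw_left: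
  assumes "y \<in> Obj C" "z \<in> Obj C"
  shows "braidw (carr A) y z ** Mw A (y *. z) =
    (y |> Mw A z) ** braidw (carr A) y (carr A *. z) ** (carr A |> braidw (carr A) y z)"
  using braid_natural_left[OF tr_Mw[OF hopf_Obj hopf_hom(1)], of "Leaf y" z] assms
  by (simp add: braid_Node_left hopf_Obj)

lemma braidw_Mw_right:
  assumes "y \<in> Obj C" "z \<in> Obj C"
  shows "braidw y (carr A) z ** (y |> Mw A z) =
    Mw A (y *. z) ** (carr A |> braidw y (carr A) z) ** braidw y (carr A) (carr A *. z)"
  using braid_natural_right[OF tr_Mw[OF hopf_Obj hopf_hom(1)], of "Leaf y" z] assms
  by (simp add: braid_Node_right hopf_Obj)

lemma braidw_Uw_left:
  assumes "y \<in> Obj C" "z \<in> Obj C"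
  shows "braidw (carr A) y z ** Uw A (y *. z) = y |> Uw A z"
  using braid_natural_left[OF tr_Uw[OF hopf_Obj hopf_hom(2)], of "Leaf y" z] assms
  by (simp add: Uw_ok)

lemma braidw_Uw_right:
  assumes "y \<in> Obj C" "z \<in> Obj C"
  shows "braidw y (carr A) z ** (y |> Uw A z) = Uw A (y *. z)"
  using braid_natural_right[OF tr_Uw[OF hopf_Obj hopf_hom(2)], of "Leaf y" z] assms
  by (simp add: Uw_ok)

end

context
  fixes A :: "('o, 'a) hopf_monoid" and Q :: "('o, 'a) module_comonoid"
  assumes Q: "module_typed A Q"
begin

lemma act_hom: "act Q \<in> hom C (carr A *. carr Q) (carr Q)"
  using Q by (simp add: module_typed_def)

lemma module_Obj: "carr A \<in> Obj C" "carr Q \<in> Obj C"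
  using Q by (simp_all add: module_typed_def comonoid_typed_def)

lemma Lw_ok:
  assumes "z \<in> Obj C"
  shows "ok (Lw A Q z)" "odom (Lw A Q z) = carr A *. carr Q *. z" "ocod (Lw A Q z) = carr Q *. z"
  using tr_ok[OF tr_Lw[OF module_Obj act_hom]] assms by auto

lemma Lw_nat: "ok F \<Longrightarrow> ocod F = z \<Longrightarrow>
    Lw A Q z ** (carr A |> carr Q |> F) = (carr Q |> F) ** Lw A Q (odom F)"
  using tr_natural[OF tr_Lw[OF module_Obj act_hom]] by force

lemma braidw_Lw_right:
  assumes "y \<in> Obj C" "z \<in> Obj C"
  shows "braidw y (carr Q) z ** (y |> Lw A Q z) =
    Lw A Q (y *. z) ** (carr A |> braidw y (carr Q) z) ** braidw y (carr A) (carr Q *. z)"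
  using braid_natural_right[OF tr_Lw[OF module_Obj act_hom], of "Leaf y" z] assms
  by (simp add: braid_Node_right module_Obj)

end

lemmas [simp] = comonoid_hom hopf_hom act_hom Dw_ok Ew_ok Mw_ok Uw_ok Sw_ok Lw_ok
  cocomm_comonoid_typed hopf_comonoid cocomm_hopf_typed hopf_typed_comonoid

section \<open>The structure laws oriented for rewriting\<close>

context
  fixes X :: "('o, 'a, 'y) comonoid_scheme"
  assumes X: "is_cocomm_comonoid C X"
begin

lemma coassocw: "z \<in> Obj C \<Longrightarrow> Dw X (carr X *. z) ** Dw X z = (carr X |> Dw X z) ** Dw X z"
  using X[unfolded cocomm_comonoid_iff Let_def] by blast

lemma counitw_left: "z \<in> Obj C \<Longrightarrow> Ew X (carr X *. z) ** Dw X z = oid (carr X *. z)"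
  using X[unfolded cocomm_comonoid_iff Let_def] by blast

lemma counitw_right: "z \<in> Obj C \<Longrightarrow> (carr X |> Ew X z) ** Dw X z = oid (carr X *. z)"
  using X[unfolded cocomm_comonoid_iff Let_def] by blast

lemma cocommw: "z \<in> Obj C \<Longrightarrow> braidw (carr X) (carr X) z ** Dw X z = Dw X z"
  using X[unfolded cocomm_comonoid_iff Let_def] by blast

end

context
  fixes A :: "('o, 'a) hopf_monoid"
  assumes A: "is_cocomm_hopf_monoid C A"
begin

lemma mul_assocw: "z \<in> Obj C \<Longrightarrow> Mw A z ** (carr A |> Mw A z) = Mw A z ** Mw A (carr A *. z)"
  by (rule sym) (use A[unfolded cocomm_hopf_monoid_iff Let_def] in blast)

lemma unitw_left: "z \<in> Obj C \<Longrightarrow> Mw A z ** Uw A (carr A *. z) = oid (carr A *. z)"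
  and unitw_right: "z \<in> Obj C \<Longrightarrow> Mw A z ** (carr A |> Uw A z) = oid (carr A *. z)"
  and comul_unitw: "z \<in> Obj C \<Longrightarrow> Dw A z ** Uw A z = Uw A (carr A *. z) ** Uw A z"
  and counit_unitw: "z \<in> Obj C \<Longrightarrow> Ew A z ** Uw A z = oid z"
  and antipodew_left: "z \<in> Obj C \<Longrightarrow> Mw A z ** Sw A (carr A *. z) ** Dw A z = Uw A z ** Ew A z"
  and antipodew_right: "z \<in> Obj C \<Longrightarrow> Mw A z ** (carr A |> Sw A z) ** Dw A z = Uw A z ** Ew A z"
  using A[unfolded cocomm_hopf_monoid_iff Let_def] by blast+

lemma counit_mulw: "z \<in> Obj C \<Longrightarrow> Ew A z ** Mw A z = Ew A z ** Ew A (carr A *. z)"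
  using A[unfolded cocomm_hopf_monoid_iff Let_def] Ew_nat[of A "Ew A z" z] A by simp

lemma comul_mulw:
  assumes "z \<in> Obj C"
  shows "Dw A z ** Mw A z = Mw A (carr A *. z) **
    (carr A |> ((carr A |> Mw A z) ** braidw (carr A) (carr A) (carr A *. z) ** (carr A |> Dw A z))) **
    Dw A (carr A *. z)"
  using A[unfolded cocomm_hopf_monoid_iff Let_def] assms Dw_nat[of A "Dw A z"] A by (simp add: pcomp_assoc)

end

context
  fixes A :: "('o, 'a) hopf_monoid" and Q :: "('o, 'a) module_comonoid"
  assumes A: "is_cocomm_hopf_monoid C A" and Q: "is_cocomm_module_comonoid C A Q"
begin

lemma act_assocw: "z \<in> Obj C \<Longrightarrow> Lw A Q z ** (carr A |> Lw A Q z) = Lw A Q z ** Mw A (carr Q *. z)"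
  by (rule sym) (use Q[unfolded module_comonoid_iff[OF A] Let_def] in blast)

lemma act_unitw: "z \<in> Obj C \<Longrightarrow> Lw A Q z ** Uw A (carr Q *. z) = oid (carr Q *. z)"
  using Q[unfolded module_comonoid_iff[OF A] Let_def] by blast+

end

lemmas comonoid_laws = Dw_nat Ew_nat coassocw counitw_left counitw_right cocommw braidw_Ew_right
  braidw_Ew_left

lemmas comonoid_rules = comonoid_laws comonoid_laws[THEN pcomp_eq_tail, unfolded pcomp_assoc]

lemmas hopf_laws = Mw_nat Uw_nat Sw_nat mul_assocw unitw_left unitw_right comul_unitw
  counit_unitw antipodew_left antipodew_right counit_mulw comul_mulw braidw_Mw_left
  braidw_Mw_right braidw_Uw_left braidw_Uw_right

lemmas hopf_laws_whisker = Mw_nat mul_assocw unitw_right braidw_Mw_right braidw_Uw_right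

lemmas hopf_rules = hopf_laws hopf_laws[THEN pcomp_eq_tail, unfolded pcomp_assoc]
  hopf_laws_whisker[THEN pcomp_whisker_inner, unfolded pcomp_assoc]
  hopf_laws_whisker[THEN pcomp_whisker_inner_tail, unfolded pcomp_assoc]

lemmas module_laws = Lw_nat act_assocw act_unitw braidw_Lw_right

lemmas module_laws_whisker = Lw_nat act_assocw braidw_Lw_right

lemmas module_rules = module_laws module_laws[THEN pcomp_eq_tail, unfolded pcomp_assoc]
  module_laws_whisker[THEN pcomp_whisker_inner, unfolded pcomp_assoc]
  module_laws_whisker[THEN pcomp_whisker_inner_tail, unfolded pcomp_assoc]

lemmas word_rules = pcomp_assoc braidw_nat_rules Hw_rules comonoid_rules hopf_rules module_rules

end

section \<open>Equalizers and coequalizers\<close>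

context category
begin

lemma is_coequalizerD:
  assumes "is_coequalizer C f g p"
  shows "f \<in> Arr C" "g \<in> Arr C" "p \<in> Arr C" "Dom C g = Dom C f" "Cod C g = Cod C f" "Dom C p = Cod C f"
    "p \<cdot> f = p \<cdot> g"
    "\<And>h. h \<in> Arr C \<Longrightarrow> Dom C h = Cod C f \<Longrightarrow> h \<cdot> f = h \<cdot> g \<Longrightarrow>
      \<exists>!k. k \<in> hom C (Cod C p) (Cod C h) \<and> k \<cdot> p = h"
  using assms[unfolded is_coequalizer_def parallel_def] by (elim conjE; simp (no_asm_simp))+

definition ocoeq :: "'a option \<Rightarrow> 'a option \<Rightarrow> 'a option \<Rightarrow> bool" where
  "ocoeq F G P \<longleftrightarrow> (\<exists>f g p. F = Some f \<and> G = Some g \<and> P = Some p \<and> is_coequalizer C f g p)"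

definition oeq :: "'a option \<Rightarrow> 'a option \<Rightarrow> 'a option \<Rightarrow> bool" where
  "oeq F G E \<longleftrightarrow> (\<exists>f g e. F = Some f \<and> G = Some g \<and> E = Some e \<and> is_equalizer C f g e)"

lemma ocoeq_Some [simp]: "ocoeq (Some f) (Some g) (Some p) \<longleftrightarrow> is_coequalizer C f g p"
  by (simp add: ocoeq_def)

lemma oeq_Some [simp]: "oeq (Some f) (Some g) (Some e) \<longleftrightarrow> is_equalizer C f g e"
  by (simp add: oeq_def)

lemma ocoeq_ok:
  assumes "ocoeq F G P"
  shows "ok F" "ok G" "ok P" "odom G = odom F" "ocod G = ocod F" "odom P = ocod F" "P ** F = P ** G"
proof -
  obtain f g p where fgp: "F = Some f" "G = Some g" "P = Some p" "is_coequalizer C f g p"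
    using assms by (auto simp: ocoeq_def)
  note d = is_coequalizerD(1-7)[OF fgp(4)]
  show "ok F" "ok G" "ok P" "odom G = odom F" "ocod G = ocod F" "odom P = ocod F" "P ** F = P ** G"
    using d fgp(1-3) by (auto simp: pcomp_def)
qed

lemma ocoeq_factor:
  assumes "ocoeq F G P" "ok H" "odom H = ocod F" "H ** F = H ** G"
  shows "\<exists>K. ok K \<and> odom K = ocod P \<and> ocod K = ocod H \<and> K ** P = H"
proof -
  obtain f g p where fgp: "F = Some f" "G = Some g" "P = Some p" "is_coequalizer C f g p"
    using assms(1) by (auto simp: ocoeq_def)
  obtain h where h: "H = Some h" "h \<in> Arr C"
    using assms(2) by (auto simp: ok_def)
  note d = is_coequalizerD[OF fgp(4)]
  have "Dom C h = Cod C f" "h \<cdot> f = h \<cdot> g"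
    using fgp(1-3) d(1-7) h assms(3,4) by (auto simp: pcomp_def)
  then obtain k where "k \<in> hom C (Cod C p) (Cod C h)" "k \<cdot> p = h"
    using d(8)[OF h(2)] by auto
  then show ?thesis
    using fgp(1-3) h d(3) by (intro exI[of _ "Some k"]) (auto simp: hom_def pcomp_def)
qed

lemma ocoeq_epi:
  assumes "ocoeq F G P" "ok H" "ok H'" "odom H = ocod P" "odom H' = ocod P" "H ** P = H' ** P"
  shows "H = H'"
proof -
  obtain f g p where fgp: "F = Some f" "G = Some g" "P = Some p" "is_coequalizer C f g p"
    using assms(1) by (auto simp: ocoeq_def)
  obtain h h' where h: "H = Some h" "h \<in> Arr C" "H' = Some h'" "h' \<in> Arr C"
    using assms(2,3) by (auto simp: ok_def)
  note d = is_coequalizerD[OF fgp(4)]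
  have p: "p \<in> hom C (Cod C f) (Cod C p)" "f \<in> hom C (Dom C f) (Cod C f)"
    "g \<in> hom C (Dom C f) (Cod C f)" "p \<cdot> f = p \<cdot> g"
    using d(1-7) by (auto simp: hom_def)
  have hh: "h \<in> hom C (Cod C p) (Cod C h)" "h' \<in> hom C (Cod C p) (Cod C h')" "h \<cdot> p = h' \<cdot> p"
    using assms(2-6) fgp(1-3) h p by (auto simp: hom_def pcomp_def)
  have hp: "h \<cdot> p \<in> hom C (Cod C f) (Cod C h)" "h' \<cdot> p \<in> hom C (Cod C f) (Cod C h')"
    using Comp_hom[OF p(1) hh(1)] Comp_hom[OF p(1) hh(2)] by auto
  have "(h \<cdot> p) \<cdot> f = (h \<cdot> p) \<cdot> g"
    using Comp_assoc[OF p(2) p(1) hh(1)] Comp_assoc[OF p(3) p(1) hh(1)] p(4) by simp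
  then have "\<exists>!k. k \<in> hom C (Cod C p) (Cod C (h \<cdot> p)) \<and> k \<cdot> p = h \<cdot> p"
    using hp by (intro d(8)) (auto simp: hom_def)
  moreover have "Cod C (h \<cdot> p) = Cod C h" "Cod C h' = Cod C h"
    using hp hh(3) by (auto simp: hom_def)
  ultimately have "h = h'"
    using hh by metis
  then show ?thesis using h by simp
qed

lemma ocoeqI:
  assumes "ok F" "ok G" "ok P" "odom G = odom F" "ocod G = ocod F" "odom P = ocod F" "P ** F = P ** G"
    and ex: "\<And>H. ok H \<Longrightarrow> odom H = ocod F \<Longrightarrow> H ** F = H ** G \<Longrightarrow>
      \<exists>K. ok K \<and> odom K = ocod P \<and> K ** P = H"
    and epi: "\<And>H H'. ok H \<Longrightarrow> ok H' \<Longrightarrow> odom H = ocod P \<Longrightarrow> odom H' = ocod P \<Longrightarrow> H ** P = H' ** P \<Longrightarrow> H = H'"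
  shows "ocoeq F G P"
proof -
  obtain f g p where fgp: "F = Some f" "G = Some g" "P = Some p"
    using assms(1-3) by (auto simp: ok_def)
  have "\<exists>!k. k \<in> hom C (Cod C p) (Cod C h) \<and> k \<cdot> p = h"
    if h: "h \<in> Arr C" "Dom C h = Cod C f" "h \<cdot> f = h \<cdot> g" for h
  proof -
    obtain K where K: "ok K" "odom K = ocod P" "K ** P = Some h"
      using ex[of "Some h"] h assms(1-5) fgp by (auto simp: pcomp_def)
    then obtain k where k: "K = Some k" "k \<in> Arr C"
      by (auto simp: ok_def)
    show ?thesis
    proof (rule ex1I[of _ k])
      show "k \<in> hom C (Cod C p) (Cod C h) \<and> k \<cdot> p = h"
        using K k fgp assms Comp_closed[of p k] by (auto simp: hom_def pcomp_def split: if_splits)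
    next
      fix k' assume "k' \<in> hom C (Cod C p) (Cod C h) \<and> k' \<cdot> p = h"
      then have "Some k' = K"
        using K k fgp assms(3) by (intro epi[of "Some k'" K]) (auto simp: hom_def pcomp_def)
      then show "k' = k" using k by simp
    qed
  qed
  then show ?thesis
    using assms(1-7) fgp by (auto simp: is_coequalizer_def parallel_def pcomp_def)
qed

lemma oiso_shift:
  assumes X: "oiso X" and Y: "oiso Y" and "ok F" "odom F = odom X" "ocod F = odom Y"
    "ok G" "odom G = ocod X" and eq: "Y ** F = G ** X"
  shows "F ** oinv X = oinv Y ** G"
proof -
  note o = oinv[OF X] oinv[OF Y] oiso_ok[OF X] oiso_ok[OF Y]
  have "F ** oinv X = oinv Y ** (Y ** F) ** oinv X"
    using assms(3-7) o by (simp add: pcomp_assoc[symmetric])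
  also have "\<dots> = oinv Y ** G ** (X ** oinv X)"
    by (simp only: eq pcomp_assoc)
  also have "\<dots> = oinv Y ** G"
    using assms(3-7) o by simp
  finally show ?thesis .
qed

text \<open>Isomorphisms \<open>Y\<close> and \<open>Z\<close> change the two ends of the
  projection. On the source of the pair a split epimorphism \<open>X\<close> is enough, because
  precomposing a pair with an epimorphism does not change what coequalizes it.\<close>

lemma ocoeq_transport:
  assumes co: "ocoeq F G P" and Y: "oiso Y" "ocod Y = ocod F" and Z: "oiso Z" "odom Z = ocod P"
    and X: "ok X" "ok X'" "X ** X' = oid (odom F)"
    and FG: "ok F'" "ok G'" "ocod F' = odom Y" "ocod G' = odom Y"
    and eq: "Y ** F' = F ** X" "Y ** G' = G ** X"
  shows "ocoeq F' G' (Z ** P ** Y)"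
proof -
  note c = ocoeq_ok[OF co]
  note y = oinv[OF Y(1)] oiso_ok[OF Y(1)] oiso_ok[OF Z(1)]
  have X1: "odom F = ocod X" "odom X = ocod X'" "odom X' = odom F"
    using X c by (metis ok_Obj(1) ok_oid ok_pcomp ocod_pcomp odom_pcomp ocod_oid odom_oid)+
  have d: "odom F' = odom X" "odom G' = odom X"
    using eq FG X X1 Y y c by (metis odom_pcomp)+
  show ?thesis
  proof (rule ocoeqI)
    have "P ** F ** X = P ** G ** X"
      using c(7) by (simp add: pcomp_assoc[symmetric])
    then show "(Z ** P ** Y) ** F' = (Z ** P ** Y) ** G'"
      by (simp add: pcomp_assoc eq)
  next
    fix H assume H: "ok H" "odom H = ocod F'" "H ** F' = H ** G'"
    have s: "(H ** oinv Y) ** T ** X = H ** T'" if "Y ** T' = T ** X" "ok T'" "ocod T' = odom Y" for T T'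
    proof -
      have "(H ** oinv Y) ** T ** X = H ** (oinv Y ** Y) ** T'"
        using that(1) by (simp add: pcomp_assoc)
      then show ?thesis using that y by simp
    qed
    \<comment> \<open>The section \<open>X'\<close> cancels \<open>X\<close>, so
      \<open>H ** oinv Y\<close> coequalizes the original pair.\<close>
    have "((H ** oinv Y) ** F) ** X ** X' = ((H ** oinv Y) ** G) ** X ** X'"
      using s[OF eq(1)] s[OF eq(2)] FG H(3) by (metis pcomp_assoc)
    then have "(H ** oinv Y) ** F = (H ** oinv Y) ** G"
      using X c H FG y Y by simp
    then obtain K where K: "ok K" "odom K = ocod P" "ocod K = ocod (H ** oinv Y)" "K ** P = H ** oinv Y"
      using ocoeq_factor[OF co, of "H ** oinv Y"] H FG y Y by auto
    show "\<exists>K. ok K \<and> odom K = ocod (Z ** P ** Y) \<and> K ** Z ** P ** Y = H"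
    proof (intro exI conjI)
      have "(K ** oinv Z) ** Z ** P ** Y = K ** (oinv Z ** Z) ** P ** Y"
        by (simp add: pcomp_assoc)
      also have "\<dots> = K ** P ** Y"
        using oinv[OF Z(1)] Z K(1-3) c Y y by simp
      also have "\<dots> = H ** (oinv Y ** Y)"
        using pcomp_tail[OF K(4), of Y] by (simp add: pcomp_assoc)
      also have "\<dots> = H"
        using H FG y by simp
      finally show "(K ** oinv Z) ** Z ** P ** Y = H" .
    qed (use K Z Y y c oinv[OF Z(1)] in auto)
  next
    fix H H' assume H: "ok H" "ok H'" "odom H = ocod (Z ** P ** Y)" "odom H' = ocod (Z ** P ** Y)"
      "H ** Z ** P ** Y = H' ** Z ** P ** Y"
    have "((H ** Z) ** P) ** Y = ((H' ** Z) ** P) ** Y"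
      using H(5) by (simp add: pcomp_assoc)
    then have "(H ** Z) ** P = (H' ** Z) ** P"
      by (rule oiso_cancel_right[OF Y(1), rotated 4]) (use H(1-4) Z Y y c(1-6) in auto)
    then have "H ** Z = H' ** Z"
      by (rule ocoeq_epi[OF co, rotated 4]) (use H(1-4) Z Y y c(1-6) in auto)
    then show "H = H'"
      by (rule oiso_cancel_right[OF Z(1), rotated 4]) (use H(1-4) Z Y y c(1-6) in auto)
  qed (use c Y Z y FG d in auto)
qed

lemma ocoeq_unique:
  assumes P: "ocoeq F G P" and P': "ocoeq F G P'"
  shows "\<exists>T. oiso T \<and> odom T = ocod P \<and> ocod T = ocod P' \<and> T ** P = P'"
proof -
  note p = ocoeq_ok[OF P] and p' = ocoeq_ok[OF P']
  obtain T where T: "ok T" "odom T = ocod P" "ocod T = ocod P'" "T ** P = P'"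
    using ocoeq_factor[OF P p'(3,6,7)] by auto
  obtain T' where T': "ok T'" "odom T' = ocod P'" "ocod T' = ocod P" "T' ** P' = P"
    using ocoeq_factor[OF P' p(3,6,7)] by auto
  have "T' ** T = oid (odom T)"
    by (rule ocoeq_epi[OF P]) (use T T' p in \<open>simp_all add: pcomp_assoc\<close>)
  moreover have "T ** T' = oid (ocod T)"
    by (rule ocoeq_epi[OF P']) (use T T' p' in \<open>simp_all add: pcomp_assoc\<close>)
  ultimately have "oiso T"
    using T T' by (intro oisoI)
  with T show ?thesis by blast
qed

lemma ocoeq_precomp_iso:
  assumes co: "ocoeq F G P" and T: "oiso T" "ocod T = odom F"
  shows "ocoeq (F ** T) (G ** T) P"
proof -
  note c = ocoeq_ok[OF co]
  have "ocoeq (F ** T) (G ** T) (oid (ocod P) ** P ** oid (ocod F))"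
    by (rule ocoeq_transport[OF co, of _ _ T "oinv T"]) (use c T oinv[OF T(1)] oiso_ok[OF T(1)] in simp_all)
  then show ?thesis using c by simp
qed

lemma ocoeq_postcomp_iso:
  assumes co: "ocoeq F G P" and T: "oiso T" "odom T = ocod P"
  shows "ocoeq F G (T ** P)"
proof -
  note c = ocoeq_ok[OF co]
  have "ocoeq F G (T ** P ** oid (ocod F))"
    by (rule ocoeq_transport[OF co, of _ _ "oid (odom F)" "oid (odom F)"]) (use c T in simp_all)
  then show ?thesis using c by simp
qed

lemma coequalizer_epi:
  assumes "is_coequalizer C f g p" "h \<in> hom C (Cod C p) w" "h' \<in> hom C (Cod C p) w'" "h \<cdot> p = h' \<cdot> p"
  shows "h = h'"
proof -
  have "Some h = Some h'"
    by (rule ocoeq_epi[of "Some f" "Some g" "Some p"])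
      (use assms is_coequalizerD(3)[OF assms(1)] in \<open>auto simp: hom_def pcomp_def\<close>)
  then show ?thesis by simp
qed

lemma ocoeq_sym: "ocoeq F G P \<Longrightarrow> ocoeq G F P"
  by (rule ocoeqI) (auto simp: ocoeq_ok intro: ocoeq_factor[THEN exE] ocoeq_epi)

text \<open>The facts about equalizers are those about coequalizers in the opposite category.\<close>

definition dual :: "('o, 'a) category" where
  "dual = \<lparr>Obj = Obj C, Arr = Arr C, Dom = Cod C, Cod = Dom C, Ident = Ident C, Comp = (\<lambda>g f. f \<cdot> g)\<rparr>"

lemma dual_simps:
  "Obj dual = Obj C" "Arr dual = Arr C" "Dom dual = Cod C" "Cod dual = Dom C" "Ident dual = Ident C"
  "Comp dual g f = f \<cdot> g" "hom dual x y = hom C y x"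
  by (auto simp: dual_def hom_def)

lemma category_dual: "category dual"
  by unfold_locales
    (auto simp: dual_simps Dom_Obj Cod_Obj Ident_hom Comp_Ident Ident_Comp Comp_assoc intro: Comp_hom)

lemma dual_option_simps:
  "category.ok dual F = ok F" "category.odom dual F = ocod F" "category.ocod dual F = odom F"
  "category.pcomp dual F G = G ** F" "category.oid dual x = oid x"
  by (auto simp: category.ok_def[OF category_dual] category.odom_def[OF category_dual]
    category.ocod_def[OF category_dual] category.pcomp_def[OF category_dual]
    category.oid_def[OF category_dual] dual_simps ok_def odom_def ocod_def pcomp_def oid_def)

lemma dual_oiso: "category.oiso dual F = oiso F"
  by (auto simp: category.oiso_def[OF category_dual] dual_option_simps oiso_def)

lemma dual_coequalizer: "is_coequalizer dual f g e = is_equalizer C f g e"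
  by (auto simp: is_coequalizer_def is_equalizer_def parallel_def dual_simps)

lemma dual_ocoeq: "category.ocoeq dual F G E = oeq F G E"
  by (simp add: category.ocoeq_def[OF category_dual] oeq_def dual_coequalizer)

lemmas dual_rules = dual_simps dual_option_simps dual_oiso dual_coequalizer dual_ocoeq pcomp_assoc

lemmas is_equalizerD = category.is_coequalizerD[OF category_dual, unfolded dual_rules]

lemmas oeq_ok = category.ocoeq_ok[OF category_dual, unfolded dual_rules]

lemmas oeq_mono = category.ocoeq_epi[OF category_dual, unfolded dual_rules]

lemmas oeq_sym = category.ocoeq_sym[OF category_dual, unfolded dual_rules]

lemmas oeq_transport = category.ocoeq_transport[OF category_dual, unfolded dual_rules]

lemmas oeq_unique = category.ocoeq_unique[OF category_dual, unfolded dual_rules]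

lemmas oeq_postcomp_iso = category.ocoeq_precomp_iso[OF category_dual, unfolded dual_rules]

lemmas oeq_precomp_iso = category.ocoeq_postcomp_iso[OF category_dual, unfolded dual_rules]

lemmas equalizer_mono = category.coequalizer_epi[OF category_dual, unfolded dual_rules]

end

section \<open>Equalizers and coequalizers under the translation\<close>

locale exact_braided_category = braided_monoidal_category C
  for C :: "('o, 'a, 'z) braided_category_scheme" (structure) +
  assumes equalizers: "has_equalizers C" and eq_tensor: "equalizers_preserved_by_tensor C"
    and coequalizers: "has_coequalizers C" and coeq_tensor: "coequalizers_preserved_by_tensor C"
begin

lemma ocoeq_otensor:
  assumes "ocoeq F G P" "x \<in> Obj C"
  shows "ocoeq (x |> F) (x |> G) (x |> P)" "ocoeq (F \<boxtimes> oid x) (G \<boxtimes> oid x) (P \<boxtimes> oid x)"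
  using assms ocoeq_ok[OF assms(1)] coeq_tensor
  by (auto simp: coequalizers_preserved_by_tensor_def ocoeq_def otensor_def whisker_def oid_def Ident_closed)

lemma oeq_otensor:
  assumes "oeq F G P" "x \<in> Obj C"
  shows "oeq (x |> F) (x |> G) (x |> P)" "oeq (F \<boxtimes> oid x) (G \<boxtimes> oid x) (P \<boxtimes> oid x)"
  using assms oeq_ok[OF assms(1)] eq_tensor
  by (auto simp: equalizers_preserved_by_tensor_def oeq_def otensor_def whisker_def oid_def Ident_closed)

lemma tr_con: "tr f s t F \<Longrightarrow> z \<in> Obj C \<Longrightarrow> F z ** con s z = con t z ** (Some f \<boxtimes> oid z)"
  using hat_con[of s t z "Some f"] by (auto simp: tr_def hom_def)

lemma tr_con_inv:
  assumes "tr f s t F" "z \<in> Obj C"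
  shows "oinv (con t z) ** F z = (Some f \<boxtimes> oid z) ** oinv (con s z)"
    "F z = con t z ** (Some f \<boxtimes> oid z) ** oinv (con s z)"
proof -
  have w: "wft s" "wft t" "f \<in> Arr C" "Dom C f = ob s" "Cod C f = ob t"
    using assms(1) by (auto simp: tr_def hom_def)
  show F: "F z = con t z ** (Some f \<boxtimes> oid z) ** oinv (con s z)"
    using assms by (simp add: tr_def hat_def)
  have "oinv (con t z) ** F z = (oinv (con t z) ** con t z) ** (Some f \<boxtimes> oid z) ** oinv (con s z)"
    by (simp add: F pcomp_assoc)
  then show "oinv (con t z) ** F z = (Some f \<boxtimes> oid z) ** oinv (con s z)"
    using w assms(2) by (simp add: oinv)
qed

lemma oiso_oinv: "oiso F \<Longrightarrow> oiso (oinv F)"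
  by (rule oisoI[of _ F]) (auto simp: oinv oiso_ok)

text \<open>Tensoring with the tail \<open>z\<close> preserves the coequalizer by hypothesis;
  conjugation with the invertible constraints \<open>con\<close> then gives the statement about
  words.\<close>

lemma ocoeq_tr:
  assumes f: "tr f s t F" and g: "tr g s t G" and p: "tr p t r P" and "z \<in> Obj C"
    and co: "is_coequalizer C f g p"
  shows "ocoeq (F z) (G z) (P z)"
proof -
  have w: "wft s" "wft t" "wft r" and h: "f \<in> Arr C" "Dom C f = ob s" "Cod C f = ob t"
    "g \<in> Arr C" "Dom C g = ob s" "Cod C g = ob t" "p \<in> Arr C" "Dom C p = ob t" "Cod C p = ob r"
    using f g p by (auto simp: tr_def hom_def)
  have "ocoeq (F z) (G z) (con r z ** (Some p \<boxtimes> oid z) ** oinv (con t z))"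
    by (rule ocoeq_transport[OF ocoeq_otensor(2), of "Some f" "Some g" "Some p" z _ _ "oinv (con s z)" "con s z"])
      (use \<open>z \<in> Obj C\<close> co w h in \<open>simp_all add: oinv oiso_oinv tr_ok[OF f] tr_ok[OF g]
        tr_con_inv(1)[OF f] tr_con_inv(1)[OF g]\<close>)
  then show ?thesis
    using tr_con_inv(2)[OF p] assms(4) by simp
qed

lemma oeq_tr:
  assumes f: "tr f s t F" and g: "tr g s t G" and p: "tr p r s P" and "z \<in> Obj C"
    and co: "is_equalizer C f g p"
  shows "oeq (F z) (G z) (P z)"
proof -
  have w: "wft s" "wft t" "wft r" and h: "f \<in> Arr C" "Dom C f = ob s" "Cod C f = ob t"
    "g \<in> Arr C" "Dom C g = ob s" "Cod C g = ob t" "p \<in> Arr C" "Dom C p = ob r" "Cod C p = ob s"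
    using f g p by (auto simp: tr_def hom_def)
  have "oeq (F z) (G z) (con s z ** (Some p \<boxtimes> oid z) ** oinv (con r z))"
    by (rule oeq_transport[OF oeq_otensor(2), of "Some f" "Some g" "Some p" z _ _ "con t z" "oinv (con t z)"])
      (use \<open>z \<in> Obj C\<close> co w h in \<open>simp_all add: oinv oiso_oinv tr_ok[OF f] tr_ok[OF g]
        tr_con[OF f] tr_con[OF g]\<close>)
  then show ?thesis
    using tr_con_inv(2)[OF p] assms(4) by simp
qed

lemma runit_con:
  assumes "tr f s t F"
  shows "(con t \<one> ** oinv (orunit (ob t))) ** Some f = F \<one> ** con s \<one> ** oinv (orunit (ob s))"
proof -
  have w: "wft s" "wft t" "f \<in> Arr C" "Dom C f = ob s" "Cod C f = ob t"
    using assms by (auto simp: tr_def hom_def)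
  have "oinv (orunit (ob t)) ** Some f ** orunit (ob s) = (oinv (orunit (ob t)) ** orunit (ob t)) ** (Some f \<boxtimes> oid \<one>)"
    using orunit_natural[of "Some f"] w by (simp add: pcomp_assoc)
  also have "\<dots> = Some f \<boxtimes> oid \<one>"
    using w by (simp add: oinv)
  finally have 1: "oinv (orunit (ob t)) ** Some f ** orunit (ob s) = Some f \<boxtimes> oid \<one>" .
  have "F \<one> ** con s \<one> ** oinv (orunit (ob s)) = con t \<one> ** (Some f \<boxtimes> oid \<one>) ** oinv (orunit (ob s))"
    using pcomp_eq_tail[OF tr_con[OF assms unit_Obj]] by (simp add: pcomp_assoc)
  also have "\<dots> = con t \<one> ** oinv (orunit (ob t)) ** Some f ** (orunit (ob s) ** oinv (orunit (ob s)))"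
    by (simp add: 1[symmetric] pcomp_assoc)
  also have "\<dots> = con t \<one> ** oinv (orunit (ob t)) ** Some f"
    using w by (simp add: oinv)
  finally show ?thesis by (simp add: pcomp_assoc)
qed

text \<open>These isomorphisms compare \<open>ob t\<close> with the word \<open>t\<close> followed
  by the tail \<open>\<one>\<close>, naturally by \<open>runit_con\<close>; through them a statement
  at the tail \<open>\<one>\<close> descends to the category.\<close>

lemma orunit_con_iso:
  assumes "wft t"
  shows "oiso (con t \<one> ** oinv (orunit (ob t)))" "odom (con t \<one> ** oinv (orunit (ob t))) = ob t"
    "ocod (con t \<one> ** oinv (orunit (ob t))) = act_ob t \<one>" "ok (con t \<one> ** oinv (orunit (ob t)))"
  using assms by (auto intro!: oiso_pcomp oiso_oinv simp: oinv)

lemma tr_coequalizer: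
  assumes f: "tr f s t F" and g: "tr g s t G" and p: "tr p t r P"
    and co: "ocoeq (F \<one>) (G \<one>) (P \<one>)"
  shows "is_coequalizer C f g p"
proof -
  have w: "wft s" "wft t" "wft r" and h: "f \<in> Arr C" "Dom C f = ob s" "Cod C f = ob t"
    "g \<in> Arr C" "Dom C g = ob s" "Cod C g = ob t" "p \<in> Arr C" "Dom C p = ob t" "Cod C p = ob r"
    using f g p by (auto simp: tr_def hom_def)
  let ?c = "\<lambda>t. con t \<one> ** oinv (orunit (ob t))"
  note c = orunit_con_iso
  have "ocoeq (Some f) (Some g) (oinv (?c r) ** P \<one> ** ?c t)"
    by (rule ocoeq_transport[OF co, of _ _ "?c s" "oinv (?c s)"])
      (use w h c tr_ok[OF f] tr_ok[OF p] runit_con[OF f] runit_con[OF g]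
        in \<open>auto simp: oinv oiso_oinv\<close>)
  also have "oinv (?c r) ** P \<one> ** ?c t = oinv (?c r) ** ?c r ** Some p"
    using runit_con[OF p] by simp
  also have "\<dots> = Some p"
    using w h c[of r] oinv(4)[OF c(1), of r] by (simp add: pcomp_assoc[symmetric] del: ok_pcomp)
  finally show ?thesis by simp
qed

lemma tr_equalizer:
  assumes f: "tr f s t F" and g: "tr g s t G" and p: "tr p r s P"
    and co: "oeq (F \<one>) (G \<one>) (P \<one>)"
  shows "is_equalizer C f g p"
proof -
  have w: "wft s" "wft t" "wft r" and h: "f \<in> Arr C" "Dom C f = ob s" "Cod C f = ob t"
    "g \<in> Arr C" "Dom C g = ob s" "Cod C g = ob t" "p \<in> Arr C" "Dom C p = ob r" "Cod C p = ob s"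
    using f g p by (auto simp: tr_def hom_def)
  let ?c = "\<lambda>t. con t \<one> ** oinv (orunit (ob t))"
  note c = orunit_con_iso
  have inv: "Some h ** oinv (?c u) = oinv (?c v) ** H \<one>" if "tr h u v H" for h u v H
  proof -
    have w: "wft u" "wft v" and h: "h \<in> Arr C" "Dom C h = ob u" "Cod C h = ob v"
      using that by (auto simp: tr_def hom_def)
    show ?thesis
      by (rule oiso_shift[OF c(1) c(1)]) (use w h tr_ok[OF that] runit_con[OF that] in \<open>auto simp: oinv\<close>)
  qed
  have "oeq (Some f) (Some g) (oinv (?c s) ** P \<one> ** ?c r)"
    by (rule oeq_transport[OF co, of _ _ "oinv (?c t)" "?c t"])
      (use w h c tr_ok[OF f] tr_ok[OF p] inv[OF f] inv[OF g]
        in \<open>auto simp: oinv oiso_oinv\<close>)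
  also have "oinv (?c s) ** P \<one> ** ?c r = oinv (?c s) ** ?c s ** Some p"
    using runit_con[OF p] by simp
  also have "\<dots> = Some p"
    using w h c[of s] oinv(4)[OF c(1), of s] by (simp add: pcomp_assoc[symmetric] del: ok_pcomp)
  finally show ?thesis by simp
qed

end

section \<open>The quotient by a Hopf submonoid\<close>

locale hopf_arrow = braided_monoidal_category C
  for C :: "('o, 'a, 'z) braided_category_scheme" (structure) +
  fixes A K :: "('o, 'a) hopf_monoid" and i :: 'a
  assumes A [simp]: "is_cocomm_hopf_monoid C A" and K [simp]: "is_cocomm_hopf_monoid C K"
    and i: "hopf_morphism C K A i"
begin

abbreviation "a \<equiv> carr A"
abbreviation "k \<equiv> carr K"
abbreviation "Iw z \<equiv> Hw k a i z"

lemma i_hom [simp]: "i \<in> hom C k a"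
  using i by (simp add: hopf_morphism_def comonoid_morphism_def)

lemma comul_Iw: "z \<in> Obj C \<Longrightarrow> Dw A z ** Iw z = Iw (a *. z) ** (k |> Iw z) ** Dw K z"
  and counit_Iw: "z \<in> Obj C \<Longrightarrow> Ew A z ** Iw z = Ew K z"
  and Iw_mul: "z \<in> Obj C \<Longrightarrow> Iw z ** Mw K z = Mw A z ** Iw (a *. z) ** (k |> Iw z)"
  and Iw_unit: "z \<in> Obj C \<Longrightarrow> Iw z ** Uw K z = Uw A z"
  using i by (simp_all add: hopf_morphism_iff comonoid_morphism_iff Let_def)

lemmas Iw_rules = comul_Iw comul_Iw[THEN pcomp_eq_tail, unfolded pcomp_assoc]
  counit_Iw counit_Iw[THEN pcomp_eq_tail, unfolded pcomp_assoc]
  Iw_mul Iw_mul[THEN pcomp_eq_tail, unfolded pcomp_assoc]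
  Iw_unit Iw_unit[THEN pcomp_eq_tail, unfolded pcomp_assoc]

text \<open>The translation of g \<otimes> x \<mapsto> g i(x), the right multiplication by
  \<open>K\<close>.\<close>

definition "fw z = Mw A z ** (a |> Iw z)"

lemma fw_ok [simp]:
  assumes "z \<in> Obj C"
  shows "ok (fw z)" "odom (fw z) = a *. k *. z" "ocod (fw z) = a *. z"
  using assms by (simp_all add: fw_def)

text \<open>\<Delta>(g i(x)) = g1 i(x1) \<otimes> g2 i(x2): the comultiplication of \<open>A\<close>
  is multiplicative and \<open>i\<close> preserves comultiplication. The crossing moves g2 past
  x1.\<close>

lemma comul_fw:
  assumes [simp]: "z \<in> Obj C"
  shows "Dw A z ** fw z =
    fw (a *. z) ** (a |> k |> fw z) ** (a |> braidw a k (k *. z)) ** (a |> a |> Dw K z) ** Dw A (k *. z)"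
  by (simp add: fw_def word_rules Hw_right Iw_rules)

lemma counit_fw:
  assumes [simp]: "z \<in> Obj C"
  shows "Ew A z ** fw z = Ew A z ** (a |> Ew K z)"
  by (simp add: fw_def word_rules Hw_right Iw_rules)

lemma mul_fw:
  assumes [simp]: "z \<in> Obj C"
  shows "Mw A z ** (a |> fw z) = fw z ** Mw A (k *. z)"
  by (simp add: fw_def word_rules Hw_right Iw_rules)

end

context monoidal_category
begin

lemma tr_cong: "tr f s t F \<Longrightarrow> (\<And>z. z \<in> Obj C \<Longrightarrow> F z = G z) \<Longrightarrow> tr f s t G"
  by (simp add: tr_def)

end

section \<open>Operations of \<open>A\<close> that descend to the coequalizer\<close>

locale phi_arrow = hopf_arrow C A K i + exact_braided_category C
  for C :: "('o, 'a, 'z) braided_category_scheme" (structure)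
    and A K :: "('o, 'a) hopf_monoid" and i :: 'a +
  fixes \<pi> :: 'a
  assumes coeq: "is_coequalizer C (mul A \<cdot> (\<I> (carr A) \<otimes> i)) (\<r> (carr A) \<cdot> (\<I> (carr A) \<otimes> counit K)) \<pi>"
begin

abbreviation "q \<equiv> Cod C \<pi>"
abbreviation "Pw z \<equiv> Hw a q \<pi> z"

lemma tr_f: "tr (mul A \<cdot> (\<I> a \<otimes> i)) (Node (Leaf a) (Leaf k)) (Leaf a) fw"
  by (rule tr_cong, (rule tr_rules op_tr | simp)+) (auto simp: fw_def)

lemma tr_g: "tr (\<r> a \<cdot> (\<I> a \<otimes> counit K)) (Node (Leaf a) (Leaf k)) (Leaf a) (\<lambda>z. a |> Ew K z)"
  by (rule tr_cong, (rule tr_rules op_tr | simp)+)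

lemma \<pi>_hom [simp]: "\<pi> \<in> hom C a q"
  using is_coequalizerD[OF coeq] tr_hom[OF tr_f] by (auto simp: hom_def)

lemma q_Obj [simp]: "q \<in> Obj C"
  using \<pi>_hom Cod_Obj by (auto simp: hom_def)

lemma tr_\<pi>: "tr \<pi> (Leaf a) (Leaf q) Pw"
  by (rule tr_Hw) auto

lemma coeqw: "z \<in> Obj C \<Longrightarrow> ocoeq (fw z) (a |> Ew K z) (Pw z)"
  by (rule ocoeq_tr[OF tr_f tr_g tr_\<pi> _ coeq])

lemma Pw_fw: "z \<in> Obj C \<Longrightarrow> Pw z ** fw z = Pw z ** (a |> Ew K z)"
  using ocoeq_ok[OF coeqw] by blast

lemma Pw_epi:
  assumes "z \<in> Obj C" "ok F" "ok G" "odom F = q *. z" "odom G = q *. z" "F ** Pw z = G ** Pw z"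
  shows "F = G"
  by (rule ocoeq_epi[OF coeqw[OF assms(1)] assms(2,3) _ _ assms(6)]) (use assms in auto)

lemma Pw_epi1:
  assumes "z \<in> Obj C" "x \<in> Obj C" "ok F" "ok G" "odom F = x *. q *. z" "odom G = x *. q *. z"
    "F ** (x |> Pw z) = G ** (x |> Pw z)"
  shows "F = G"
  by (rule ocoeq_epi[OF ocoeq_otensor(1)[OF coeqw[OF assms(1)] assms(2)] assms(3,4) _ _ assms(7)])
    (use assms in auto)

lemma Pw_epi2:
  assumes "z \<in> Obj C" "x \<in> Obj C" "y \<in> Obj C" "ok F" "ok G"
    "odom F = y *. x *. q *. z" "odom G = y *. x *. q *. z"
    "F ** (y |> x |> Pw z) = G ** (y |> x |> Pw z)"
  shows "F = G"
  by (rule ocoeq_epi[OF ocoeq_otensor(1)[OF ocoeq_otensor(1)[OF coeqw[OF assms(1)] assms(2)] assms(3)]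
        assms(4,5) _ _ assms(8)])
    (use assms in auto)

lemmas fw_rules = Pw_fw Pw_fw[THEN pcomp_eq_tail, unfolded pcomp_assoc]
  comul_fw comul_fw[THEN pcomp_eq_tail, unfolded pcomp_assoc]
  counit_fw counit_fw[THEN pcomp_eq_tail, unfolded pcomp_assoc]
  mul_fw mul_fw[THEN pcomp_eq_tail, unfolded pcomp_assoc]

text \<open>After \<open>comul_fw\<close> each leg carries its own factor x1 or x2 from
  \<open>K\<close>. The projection replaces each of them by its counit, and the counit law of
  \<open>K\<close> joins the two counits into one.\<close>

lemma comul_compat:
  assumes [simp]: "z \<in> Obj C"
  shows "(q |> Pw z) ** Pw (a *. z) ** Dw A z ** fw z =
    (q |> Pw z) ** Pw (a *. z) ** Dw A z ** (a |> Ew K z)"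
  by (simp add: word_rules Hw_right fw_rules)

lemma counit_compat:
  assumes [simp]: "z \<in> Obj C"
  shows "Ew A z ** fw z = Ew A z ** (a |> Ew K z)"
  by (rule counit_fw) simp

text \<open>Left multiplication commutes with the right multiplication by \<open>K\<close>: h (g
  i(x)) = (h g) i(x).\<close>

lemma act_compat:
  assumes [simp]: "z \<in> Obj C"
  shows "Pw z ** Mw A z ** (a |> fw z) = Pw z ** Mw A z ** (a |> a |> Ew K z)"
  by (simp add: word_rules Hw_right fw_rules)

lemma quotient_arrows:
  obtains \<delta> e l where
    "\<delta> \<in> hom C q (q *. q)" "\<delta> \<cdot> \<pi> = (\<pi> \<otimes> \<pi>) \<cdot> comul A"
    "e \<in> hom C q \<one>" "e \<cdot> \<pi> = counit A"
    "l \<in> hom C (a *. q) q" "l \<cdot> (\<I> a \<otimes> \<pi>) = \<pi> \<cdot> mul A"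
proof -
  note d = is_coequalizerD[OF coeq]
  have fd: "Cod C (mul A \<cdot> (\<I> a \<otimes> i)) = a"
    using tr_hom[OF tr_f] by (auto simp: hom_def)
  have 1: "(\<pi> \<otimes> \<pi>) \<cdot> comul A \<in> hom C a (q *. q)"
    by (rule Comp_hom[OF comonoid_hom(2) tensor_hom[OF \<pi>_hom \<pi>_hom]]) simp
  have "((\<pi> \<otimes> \<pi>) \<cdot> comul A) \<cdot> (mul A \<cdot> (\<I> a \<otimes> i)) =
      ((\<pi> \<otimes> \<pi>) \<cdot> comul A) \<cdot> (\<r> a \<cdot> (\<I> a \<otimes> counit K))"
    by (rule tr_eqI, (rule tr_Comp[OF _ tr_f] tr_Comp[OF _ tr_g] tr_rules tr_\<pi> op_tr |
      simp add: comul_compat pcomp_assoc Hw_nat)+)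
  then obtain \<delta> where \<delta>: "\<delta> \<in> hom C q (q *. q)" "\<delta> \<cdot> \<pi> = (\<pi> \<otimes> \<pi>) \<cdot> comul A"
    using d(8)[of "(\<pi> \<otimes> \<pi>) \<cdot> comul A"] 1 fd by (auto simp: hom_def)
  have "counit A \<cdot> (mul A \<cdot> (\<I> a \<otimes> i)) = counit A \<cdot> (\<r> a \<cdot> (\<I> a \<otimes> counit K))"
    by (rule tr_eqI, (rule tr_Comp[OF _ tr_f] tr_Comp[OF _ tr_g] tr_rules tr_\<pi> op_tr |
      simp add: counit_compat)+)
  then obtain e where e: "e \<in> hom C q \<one>" "e \<cdot> \<pi> = counit A"
    using d(8)[of "counit A"] fd comonoid_hom(3)[of A] by (auto simp: hom_def)
  \<comment> \<open>The action starts at \<open>a *. q\<close>, so it is induced by the universal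
    property of the coequalizer tensored with \<open>A\<close>.\<close>
  have coeq': "is_coequalizer C (\<I> a \<otimes> (mul A \<cdot> (\<I> a \<otimes> i))) (\<I> a \<otimes> (\<r> a \<cdot> (\<I> a \<otimes> counit K))) (\<I> a \<otimes> \<pi>)"
    using coeq coeq_tensor by (simp add: coequalizers_preserved_by_tensor_def)
  note d' = is_coequalizerD[OF coeq']
  have I: "\<I> a \<in> hom C a a"
    by (simp add: Ident_hom)
  have fd': "Cod C (\<I> a \<otimes> (mul A \<cdot> (\<I> a \<otimes> i))) = a *. a" "Cod C (\<I> a \<otimes> \<pi>) = a *. q"
    using tensor_hom[OF I tr_hom[OF tr_f]] tensor_hom[OF I \<pi>_hom] by (auto simp: hom_def)
  have 2: "\<pi> \<cdot> mul A \<in> hom C (a *. a) q"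
    by (intro Comp_hom[OF hopf_hom(1)]) auto
  have "(\<pi> \<cdot> mul A) \<cdot> (\<I> a \<otimes> (mul A \<cdot> (\<I> a \<otimes> i))) =
      (\<pi> \<cdot> mul A) \<cdot> (\<I> a \<otimes> (\<r> a \<cdot> (\<I> a \<otimes> counit K)))"
    by (rule tr_eqI, (rule tr_tensor[OF _ tr_f] tr_tensor[OF _ tr_g] tr_rules tr_\<pi> op_tr |
      simp add: act_compat pcomp_assoc)+)
  then obtain l where "l \<in> hom C (a *. q) q" "l \<cdot> (\<I> a \<otimes> \<pi>) = \<pi> \<cdot> mul A"
    using d'(8)[of "\<pi> \<cdot> mul A"] fd' 2 by (auto simp: hom_def)
  with \<delta> e that show ?thesis by blast
qed

end

section \<open>Laws of the induced structure on \<open>Q\<close>\<close>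

locale phi_structure = phi_arrow C A K i \<pi>
  for C :: "('o, 'a, 'z) braided_category_scheme" (structure)
    and A K :: "('o, 'a) hopf_monoid" and i \<pi> :: 'a +
  fixes Q :: "('o, 'a) module_comonoid"
  assumes carr_Q [simp]: "carr Q = Cod C \<pi>"
    and comul_Q: "comul Q \<in> hom C (Cod C \<pi>) (Cod C \<pi> *. Cod C \<pi>)" "comul Q \<cdot> \<pi> = (\<pi> \<otimes> \<pi>) \<cdot> comul A"
    and counit_Q: "counit Q \<in> hom C (Cod C \<pi>) \<one>" "counit Q \<cdot> \<pi> = counit A"
    and act_Q: "act Q \<in> hom C (carr A *. Cod C \<pi>) (Cod C \<pi>)" "act Q \<cdot> (\<I> (carr A) \<otimes> \<pi>) = \<pi> \<cdot> mul A"
begin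

lemma Q_typed [simp]: "module_typed A Q"
  unfolding module_typed_def comonoid_typed_def using comul_Q counit_Q act_Q by simp

lemma Q_typed' [simp]: "comonoid_typed Q"
  by (rule module_typed_comonoid) (rule Q_typed)

lemmas Q_ok [simp] = Dw_ok[of Q, simplified] Ew_ok[of Q, simplified] Lw_ok[of A Q, simplified]

lemmas tr_Q = tr_Dw[of Q, simplified] tr_Ew[of Q, simplified] tr_Lw[of A Q, simplified]

lemma comul_Pw [rule_format, unfolded pcomp_assoc]:
  "\<forall>z \<in> Obj C. Dw Q z ** Pw z = (Pw (q *. z) ** (a |> Pw z)) ** Dw A z"
  by (rule tr_eq_iff[THEN iffD1, OF _ _ comul_Q(2)])
    (rule tr_cong, (rule tr_rules tr_\<pi> tr_Q op_tr comul_Q | simp)+)+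

lemma counit_Pw [rule_format]: "\<forall>z \<in> Obj C. Ew Q z ** Pw z = Ew A z"
  by (rule tr_eq_iff[THEN iffD1, OF _ _ counit_Q(2)])
    (rule tr_cong, (rule tr_rules tr_\<pi> tr_Q op_tr counit_Q | simp)+)+

lemma act_Pw [rule_format]: "\<forall>z \<in> Obj C. Lw A Q z ** (a |> Pw z) = Pw z ** Mw A z"
  by (rule tr_eq_iff[THEN iffD1, OF _ _ act_Q(2)])
    (rule tr_cong, (rule tr_rules tr_\<pi> tr_Q op_tr act_Q | simp)+)+

lemmas Pw_rules = comul_Pw comul_Pw[THEN pcomp_eq_tail, unfolded pcomp_assoc]
  counit_Pw counit_Pw[THEN pcomp_eq_tail, unfolded pcomp_assoc]
  act_Pw act_Pw[THEN pcomp_eq_tail, unfolded pcomp_assoc]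
  act_Pw[THEN pcomp_whisker_inner, unfolded pcomp_assoc]
  act_Pw[THEN pcomp_whisker_inner_tail, unfolded pcomp_assoc]

lemmas Q_rules = Dw_nat[of Q, simplified] Dw_nat[of Q, simplified, THEN pcomp_eq_tail, unfolded pcomp_assoc]
  Ew_nat[of Q, simplified] Ew_nat[of Q, simplified, THEN pcomp_eq_tail, unfolded pcomp_assoc]
  Lw_nat[of A Q, simplified] Lw_nat[of A Q, simplified, THEN pcomp_eq_tail, unfolded pcomp_assoc]
  Lw_nat[of A Q, simplified, THEN pcomp_whisker_inner, unfolded pcomp_assoc]
  Lw_nat[of A Q, simplified, THEN pcomp_whisker_inner_tail, unfolded pcomp_assoc]

text \<open>Every law has source \<open>q\<close>, so it may be tested after the epimorphism
  \<open>Pw z\<close>, where it becomes the same law of \<open>A\<close>.\<close>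

lemma Q_comonoid: "is_cocomm_comonoid C Q"
proof -
  have 1: "Dw Q (q *. z) ** Dw Q z = (q |> Dw Q z) ** Dw Q z" if [simp]: "z \<in> Obj C" for z
    by (rule Pw_epi[of z]) (simp_all add: Pw_rules Q_rules word_rules Hw_right)
  have 2: "Ew Q (q *. z) ** Dw Q z = oid (q *. z)" if [simp]: "z \<in> Obj C" for z
    by (rule Pw_epi[of z]) (simp_all add: Pw_rules Q_rules word_rules Hw_left)
  have 3: "(q |> Ew Q z) ** Dw Q z = oid (q *. z)" if [simp]: "z \<in> Obj C" for z
    by (rule Pw_epi[of z]) (simp_all add: Pw_rules Q_rules word_rules Hw_left)
  have 4: "braidw q q z ** Dw Q z = Dw Q z" if [simp]: "z \<in> Obj C" for z
    by (rule Pw_epi[of z]) (simp_all add: Pw_rules Q_rules word_rules Hw_left)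
  show ?thesis
    using comul_Q counit_Q 1 2 3 4 by (simp add: cocomm_comonoid_iff Let_def)
qed

text \<open>The laws have one or two letters \<open>a\<close> in front of \<open>q\<close>, except
  for the unit law. They are tested after the projection tensored with that many copies of
  \<open>A\<close>, which is still epic.\<close>

lemma Q_module_comonoid: "is_cocomm_module_comonoid C A Q"
proof -
  have 1: "Lw A Q z ** Mw A (q *. z) = Lw A Q z ** (a |> Lw A Q z)" if [simp]: "z \<in> Obj C" for z
    by (rule Pw_epi2[of z a a]) (simp_all add: Pw_rules Q_rules word_rules Hw_left)
  have 2: "Lw A Q z ** Uw A (q *. z) = oid (q *. z)" if [simp]: "z \<in> Obj C" for z
  proof (rule Pw_epi[of z])
    \<comment> \<open>Naturality of the unit is needed against the orientation of the rewriting
      rules, so it is applied by hand.\<close>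
    have "Uw A (q *. z) ** Pw z = (a |> Pw z) ** Uw A (a *. z)"
      by (simp add: Uw_nat)
    then have "(Lw A Q z ** Uw A (q *. z)) ** Pw z = Lw A Q z ** (a |> Pw z) ** Uw A (a *. z)"
      by (simp only: pcomp_assoc)
    also have "\<dots> = oid (q *. z) ** Pw z"
      by (simp add: act_Pw[THEN pcomp_eq_tail] pcomp_assoc unitw_left)
    finally show "(Lw A Q z ** Uw A (q *. z)) ** Pw z = oid (q *. z) ** Pw z" .
  qed simp_all
  have 3: "Dw Q z ** Lw A Q z = Lw A Q (q *. z) ** (a |> q |> Lw A Q z) **
        (a |> braidw a q (q *. z)) ** Dw A (q *. q *. z) ** (a |> Dw Q z)" if [simp]: "z \<in> Obj C" for z
    by (rule Pw_epi1[of z a]) (simp_all add: Pw_rules Q_rules word_rules Hw_left)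
  have 4: "Ew Q z ** Lw A Q z = Ew A z ** (a |> Ew Q z)" if [simp]: "z \<in> Obj C" for z
    by (rule Pw_epi1[of z a]) (simp_all add: Pw_rules Q_rules word_rules Hw_left)
  show ?thesis
    using act_Q 1 2 3 4 Q_comonoid by (simp add: module_comonoid_iff Let_def)
qed

end

section \<open>The Hopf monoid of coinvariants\<close>

locale module_quotient = braided_monoidal_category C
  for C :: "('o, 'a, 'z) braided_category_scheme" (structure) +
  fixes A :: "('o, 'a) hopf_monoid" and Q :: "('o, 'a) module_comonoid" and \<pi> :: 'a
  assumes A [simp]: "is_cocomm_hopf_monoid C A" and Q [simp]: "is_cocomm_module_comonoid C A Q"
    and \<pi>: "comonoid_morphism C A Q \<pi>" "left_linear C A (mul A) (act Q) \<pi>"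
begin

abbreviation "a \<equiv> carr A"
abbreviation "q \<equiv> carr Q"
abbreviation "Pw z \<equiv> Hw a q \<pi> z"

lemma Q_comonoid [simp]: "is_cocomm_comonoid C Q"
  by (rule module_comonoid) (rule Q)

lemma Q_typed [simp]: "module_typed A Q"
  by (rule module_comonoid_typed) simp_all

lemma \<pi>_hom [simp]: "\<pi> \<in> hom C a q"
  using \<pi> by (simp add: comonoid_morphism_def)

lemma tr_\<pi>: "tr \<pi> (Leaf a) (Leaf q) Pw"
  by (rule tr_Hw) auto

lemma comul_Pw: "z \<in> Obj C \<Longrightarrow> Dw Q z ** Pw z = Pw (q *. z) ** (a |> Pw z) ** Dw A z"
  and counit_Pw: "z \<in> Obj C \<Longrightarrow> Ew Q z ** Pw z = Ew A z"
  using \<pi> by (simp_all add: comonoid_morphism_iff Let_def)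

lemma act_Pw [rule_format]: "\<forall>z \<in> Obj C. Lw A Q z ** (a |> Pw z) = Pw z ** Mw A z"
  by (rule tr_eq_iff[THEN iffD1, OF _ _ \<pi>(2)[unfolded left_linear_def, symmetric]])
    (rule tr_cong, (rule tr_rules tr_\<pi> tr_Lw[of A Q] op_tr | simp)+)+

lemmas Pw_rules = comul_Pw comul_Pw[THEN pcomp_eq_tail, unfolded pcomp_assoc]
  counit_Pw counit_Pw[THEN pcomp_eq_tail, unfolded pcomp_assoc]
  act_Pw act_Pw[THEN pcomp_eq_tail, unfolded pcomp_assoc]
  act_Pw[THEN pcomp_whisker_inner, unfolded pcomp_assoc]
  act_Pw[THEN pcomp_whisker_inner_tail, unfolded pcomp_assoc]

abbreviation "coact \<equiv> (\<pi> \<otimes> \<I> a) \<cdot> comul A"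
abbreviation "coact0 \<equiv> ((\<pi> \<cdot> unit_arr A) \<otimes> \<I> a) \<cdot> inv_arr C (\<l> a)"

text \<open>The translations of \<open>coact\<close> and \<open>coact0\<close>, that is, of h
  \<mapsto> \<pi>(h1) \<otimes> h2 and, below, h \<mapsto> \<pi>(1) \<otimes> h.\<close>

definition "Fw z = Pw (a *. z) ** Dw A z"
definition "Gw z = Pw (a *. z) ** Uw A (a *. z)"

text \<open>The diagonal action of \<open>A\<close> on \<open>Q \<otimes> A\<close>.\<close>

definition "Nw z = Lw A Q (a *. z) ** (a |> ((q |> Mw A z) ** braidw a q (a *. z))) ** Dw A (q *. a *. z)"

lemma FGN_ok [simp]:
  assumes "z \<in> Obj C"
  shows "ok (Fw z)" "odom (Fw z) = a *. z" "ocod (Fw z) = q *. a *. z"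
    "ok (Gw z)" "odom (Gw z) = a *. z" "ocod (Gw z) = q *. a *. z"
    "ok (Nw z)" "odom (Nw z) = a *. q *. a *. z" "ocod (Nw z) = q *. a *. z"
  using assms by (simp_all add: Fw_def Gw_def Nw_def)

text \<open>F(gh) = \<pi>(g1 h1) \<otimes> g2 h2 = g1 \<pi>(h1) \<otimes> g2 h2, by multiplicativity
  of \<Delta> and linearity of \<pi>; this is g acting diagonally on F(h).\<close>

lemma Fw_mul: "z \<in> Obj C \<Longrightarrow> Fw z ** Mw A z = Nw z ** (a |> Fw z)"
  by (simp add: Fw_def Nw_def Pw_rules word_rules Hw_left)

text \<open>Linearity gives g1 \<pi>(1) = \<pi>(g1), so acting on \<pi>(1) \<otimes> h produces
  \<pi>(g1) \<otimes> g2 h. Thus the action ties \<open>Gw\<close> on one argument to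
  \<open>Fw\<close> on the other.\<close>

lemma Nw_Gw: "z \<in> Obj C \<Longrightarrow> Nw z ** (a |> Gw z) = (q |> Mw A z) ** Fw (a *. z)"
  by (simp add: Fw_def Gw_def Nw_def Pw_rules word_rules Hw_left)

lemma Nw_unit: "z \<in> Obj C \<Longrightarrow> Nw z ** Uw A (q *. a *. z) = oid (q *. a *. z)"
  by (simp add: Nw_def word_rules)

text \<open>A diagonal action is associative because the comultiplication of \<open>A\<close> is
  multiplicative.\<close>

lemma Nw_assoc: "z \<in> Obj C \<Longrightarrow> Nw z ** (a |> Nw z) = Nw z ** Mw A (q *. a *. z)"
  by (simp add: Nw_def word_rules)

lemma Fw_unit: "z \<in> Obj C \<Longrightarrow> Fw z ** Uw A z = Gw z ** Uw A z"
  by (simp add: Fw_def Gw_def word_rules)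

lemma Gw_mul: "z \<in> Obj C \<Longrightarrow> (q |> Mw A z) ** Gw (a *. z) = Gw z ** Mw A z"
  by (simp add: Gw_def word_rules Hw_left)

lemma Fw_comul: "z \<in> Obj C \<Longrightarrow> Fw (a *. z) ** Dw A z = (q |> Dw A z) ** Fw z"
  by (simp add: Fw_def word_rules Hw_left)

lemma Gw_comul: "z \<in> Obj C \<Longrightarrow> Gw (a *. z) ** Dw A z = (q |> Dw A z) ** Gw z"
  by (simp add: Gw_def word_rules Hw_left)

text \<open>Cocommutativity exchanges the first two of h1, h2, h3, so h1 \<otimes> \<pi>(h2)
  \<otimes> h3 is the crossing of \<pi>(h1) \<otimes> h2 \<otimes> h3. A statement about the second
  leg is thereby reduced to one about the first.\<close>

lemma Fw_comul': "z \<in> Obj C \<Longrightarrow> (a |> Fw z) ** Dw A z = braidw q a (a *. z) ** Fw (a *. z) ** Dw A z"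
proof -
  assume z [simp]: "z \<in> Obj C"
  have "braidw a a (a *. z) ** (a |> Dw A z) ** Dw A z = braidw a a (a *. z) ** Dw A (a *. z) ** Dw A z"
    by (simp add: coassocw)
  also have "\<dots> = Dw A (a *. z) ** Dw A z"
    by (simp add: pcomp_eq_tail[OF cocommw])
  also have "\<dots> = (a |> Dw A z) ** Dw A z"
    by (simp add: coassocw)
  finally show ?thesis
    by (simp add: Fw_def word_rules Hw_left)
qed

text \<open>The element \<pi>(1) comes from the unit object, so it passes a letter by the braiding
  without effect.\<close>

lemma Gw_comul': "z \<in> Obj C \<Longrightarrow> (a |> Gw z) = braidw q a (a *. z) ** Gw (a *. z)"
  by (simp add: Gw_def word_rules Hw_left)

end

section \<open>Operations of \<open>A\<close> that restrict to the equalizer\<close>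

locale psi_arrow = module_quotient C A Q \<pi> + exact_braided_category C
  for C :: "('o, 'a, 'z) braided_category_scheme" (structure)
    and A :: "('o, 'a) hopf_monoid" and Q :: "('o, 'a) module_comonoid" and \<pi> :: 'a +
  fixes j :: 'a
  assumes eq: "is_equalizer C coact coact0 j"
begin

abbreviation "k \<equiv> Dom C j"
abbreviation "Jw z \<equiv> Hw k a j z"

lemma tr_F: "tr coact (Leaf a) (Node (Leaf q) (Leaf a)) Fw"
  by (rule tr_cong, (rule tr_rules tr_\<pi> op_tr | simp add: Fw_def)+)

lemma tr_G: "tr coact0 (Leaf a) (Node (Leaf q) (Leaf a)) Gw"
  by (rule tr_cong, (rule tr_rules tr_\<pi> op_tr | simp add: Gw_def)+)

lemma j_hom [simp]: "j \<in> hom C k a"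
  using is_equalizerD[OF eq] tr_hom[OF tr_F] by (auto simp: hom_def)

lemma k_Obj [simp]: "k \<in> Obj C"
  using j_hom Dom_Obj by (auto simp: hom_def)

lemma tr_j: "tr j (Leaf k) (Leaf a) Jw"
  by (rule tr_Hw) auto

lemma eqw: "z \<in> Obj C \<Longrightarrow> oeq (Fw z) (Gw z) (Jw z)"
  by (rule oeq_tr[OF tr_F tr_G tr_j _ eq])

lemma Fw_Jw: "z \<in> Obj C \<Longrightarrow> Fw z ** Jw z = Gw z ** Jw z"
  using oeq_ok[OF eqw] by blast

lemma Jw_mono:
  assumes "z \<in> Obj C" "ok F" "ok G" "ocod F = k *. z" "ocod G = k *. z" "Jw z ** F = Jw z ** G"
  shows "F = G"
  by (rule oeq_mono[OF eqw[OF assms(1)] assms(2,3) _ _ assms(6)]) (use assms in auto)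

lemma Jw_mono1:
  assumes "z \<in> Obj C" "x \<in> Obj C" "ok F" "ok G" "ocod F = x *. k *. z" "ocod G = x *. k *. z"
    "(x |> Jw z) ** F = (x |> Jw z) ** G"
  shows "F = G"
  by (rule oeq_mono[OF oeq_otensor(1)[OF eqw[OF assms(1)] assms(2)] assms(3,4) _ _ assms(7)])
    (use assms in auto)

text \<open>For x, y from \<open>K\<close>: F(xy) = x . F(y) = x . G(y). By \<open>Nw_Gw\<close>
  this is F(x) with y multiplied into its second factor, and since F(x) = G(x), it equals
  G(xy).\<close>

lemma mul_compat:
  assumes [simp]: "z \<in> Obj C"
  shows "Fw z ** Mw A z ** Jw (a *. z) ** (k |> Jw z) = Gw z ** Mw A z ** Jw (a *. z) ** (k |> Jw z)"
proof -
  have "Fw z ** Mw A z ** Jw (a *. z) ** (k |> Jw z) = Nw z ** (a |> (Fw z ** Jw z)) ** Jw (k *. z)"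
    by (simp add: Fw_mul[THEN pcomp_eq_tail] pcomp_assoc Hw_right)
  also have "\<dots> = (Nw z ** (a |> Gw z)) ** Jw (a *. z) ** (k |> Jw z)"
    by (simp add: Fw_Jw pcomp_assoc Hw_right)
  also have "\<dots> = (q |> Mw A z) ** (Fw (a *. z) ** Jw (a *. z)) ** (k |> Jw z)"
    by (simp add: Nw_Gw pcomp_assoc)
  also have "\<dots> = ((q |> Mw A z) ** Gw (a *. z)) ** Jw (a *. z) ** (k |> Jw z)"
    by (simp add: Fw_Jw pcomp_assoc)
  finally show ?thesis
    by (simp add: Gw_mul pcomp_assoc)
qed

lemma comul_compat1:
  assumes [simp]: "z \<in> Obj C"
  shows "Fw (a *. z) ** Dw A z ** Jw z = Gw (a *. z) ** Dw A z ** Jw z"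
  by (simp add: Fw_comul[THEN pcomp_eq_tail] Gw_comul[THEN pcomp_eq_tail] pcomp_assoc Fw_Jw)

lemma comul_compat2:
  assumes [simp]: "z \<in> Obj C"
  shows "(a |> Fw z) ** Dw A z ** Jw z = (a |> Gw z) ** Dw A z ** Jw z"
  by (simp add: Fw_comul'[THEN pcomp_eq_tail] Gw_comul' pcomp_assoc comul_compat1)

lemma sub_arrows:
  obtains \<delta> \<mu> \<eta> where
    "\<delta> \<in> hom C k (k *. k)" "(j \<otimes> j) \<cdot> \<delta> = comul A \<cdot> j"
    "\<mu> \<in> hom C (k *. k) k" "j \<cdot> \<mu> = mul A \<cdot> (j \<otimes> j)"
    "\<eta> \<in> hom C \<one> k" "j \<cdot> \<eta> = unit_arr A"
proof -
  note d = is_equalizerD[OF eq]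
  have I: "\<I> a \<in> hom C a a" "\<I> k \<in> hom C k k"
    by (simp_all add: Ident_hom)
  note Fh = tr_hom[OF tr_F, simplified]
  have dF: "Dom C coact = a"
    using Fh by (auto simp: hom_def)
  have "coact \<cdot> unit_arr A = coact0 \<cdot> unit_arr A"
    by (rule tr_eqI, (rule tr_Comp[OF tr_F] tr_Comp[OF tr_G] op_tr | simp add: Fw_unit)+)
  then obtain \<eta> where \<eta>: "\<eta> \<in> hom C \<one> k" "j \<cdot> \<eta> = unit_arr A"
    using d(8)[of "unit_arr A"] hopf_hom(2)[of A] dF by (auto simp: hom_def)
  have m: "mul A \<cdot> (j \<otimes> j) \<in> hom C (k *. k) a"
    by (rule Comp_hom[OF tensor_hom[OF j_hom j_hom]]) simp
  have "coact \<cdot> (mul A \<cdot> (j \<otimes> j)) = coact0 \<cdot> (mul A \<cdot> (j \<otimes> j))"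
    by (rule tr_eqI, (rule tr_Comp[OF tr_F] tr_Comp[OF tr_G] tr_rules tr_j op_tr |
      simp add: mul_compat pcomp_assoc)+)
  then obtain \<mu> where \<mu>: "\<mu> \<in> hom C (k *. k) k" "j \<cdot> \<mu> = mul A \<cdot> (j \<otimes> j)"
    using d(8)[of "mul A \<cdot> (j \<otimes> j)"] m dF by (auto simp: hom_def)
  \<comment> \<open>The comultiplication is lifted one leg at a time: through
    \<open>\<I> a \<otimes> j\<close> and then through \<open>j \<otimes> \<I> k\<close>, both
    equalizers by the preservation hypothesis.\<close>
  have eq1: "is_equalizer C (\<I> a \<otimes> coact) (\<I> a \<otimes> coact0) (\<I> a \<otimes> j)"
    and eq2: "is_equalizer C (coact \<otimes> \<I> k) (coact0 \<otimes> \<I> k) (j \<otimes> \<I> k)"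
    using eq eq_tensor by (simp_all add: equalizers_preserved_by_tensor_def)
  note d1 = is_equalizerD[OF eq1] and d2 = is_equalizerD[OF eq2]
  have dF1: "Dom C (\<I> a \<otimes> coact) = a *. a" "Dom C (\<I> a \<otimes> j) = a *. k"
    using tensor_hom[OF I(1) Fh] tensor_hom[OF I(1) j_hom] by (auto simp: hom_def)
  have dF2: "Dom C (coact \<otimes> \<I> k) = a *. k" "Dom C (j \<otimes> \<I> k) = k *. k"
    using tensor_hom[OF Fh I(2)] tensor_hom[OF j_hom I(2)] by (auto simp: hom_def)
  have c: "comul A \<cdot> j \<in> hom C k (a *. a)"
    by (rule Comp_hom[OF j_hom]) simp
  have "(\<I> a \<otimes> coact) \<cdot> (comul A \<cdot> j) = (\<I> a \<otimes> coact0) \<cdot> (comul A \<cdot> j)"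
    by (rule tr_eqI, (rule tr_tensor[OF _ tr_F] tr_tensor[OF _ tr_G] tr_rules tr_j op_tr |
      simp add: comul_compat2 pcomp_assoc)+)
  then obtain \<gamma> where \<gamma>: "\<gamma> \<in> hom C k (a *. k)" "(\<I> a \<otimes> j) \<cdot> \<gamma> = comul A \<cdot> j"
    using d1(8)[of "comul A \<cdot> j"] c dF1 by (auto simp: hom_def)
  define \<gamma>w where "\<gamma>w = hat (Leaf k) (Node (Leaf a) (Leaf k)) (Some \<gamma>)"
  have tr_\<gamma>: "tr \<gamma> (Leaf k) (Node (Leaf a) (Leaf k)) \<gamma>w"
    unfolding \<gamma>w_def by (rule tr_hat_Some) (use \<gamma> in auto)
  note \<gamma>_ok = tr_ok[OF tr_\<gamma>, simplified]
  have \<gamma>w: "(a |> Jw z) ** \<gamma>w z = Dw A z ** Jw z" if "z \<in> Obj C" for z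
  proof -
    have "\<forall>z \<in> Obj C. (a |> Jw z) ** \<gamma>w z = Dw A z ** Jw z"
      by (rule tr_eq_iff[THEN iffD1, OF _ _ \<gamma>(2)])
        (rule tr_cong, (rule tr_rules tr_j tr_\<gamma> op_tr | simp add: \<gamma>_ok)+)+
    then show ?thesis using that by blast
  qed
  \<comment> \<open>The first leg of \<open>\<gamma>\<close> is tested after the monic
    \<open>q |> a |> Jw z\<close>, where \<open>\<gamma>\<close> turns back into the
    comultiplication of \<open>A\<close> and \<open>comul_compat1\<close> applies.\<close>
  have compat: "Fw (k *. z) ** \<gamma>w z = Gw (k *. z) ** \<gamma>w z" if [simp]: "z \<in> Obj C" for z
  proof -
    have nat: "(q |> a |> Jw z) ** Fw (k *. z) = Fw (a *. z) ** (a |> Jw z)"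
      "(q |> a |> Jw z) ** Gw (k *. z) = Gw (a *. z) ** (a |> Jw z)"
      using tr_natural[OF tr_F, of "Jw z"] tr_natural[OF tr_G, of "Jw z"] by simp_all
    have "q |> a |> Jw z = (q |> (a |> Jw z))" by simp
    show ?thesis
      by (rule oeq_mono[OF oeq_otensor(1)[OF oeq_otensor(1)[OF eqw[OF that]]], of a q])
        (simp_all add: \<gamma>_ok nat[THEN pcomp_eq_tail] pcomp_assoc \<gamma>w comul_compat1)
  qed
  have "(coact \<otimes> \<I> k) \<cdot> \<gamma> = (coact0 \<otimes> \<I> k) \<cdot> \<gamma>"
    by (rule tr_eqI, (rule tr_tensor[OF tr_F] tr_tensor[OF tr_G] tr_rules tr_\<gamma> |
      simp add: compat pcomp_assoc)+)
  then obtain \<delta> where \<delta>: "\<delta> \<in> hom C k (k *. k)" "(j \<otimes> \<I> k) \<cdot> \<delta> = \<gamma>"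
    using d2(8)[of \<gamma>] \<gamma> dF2 by (auto simp: hom_def)
  have "(j \<otimes> j) \<cdot> \<delta> = ((\<I> a \<otimes> j) \<cdot> (j \<otimes> \<I> k)) \<cdot> \<delta>"
    using tensor_Comp[OF j_hom I(1) I(2) j_hom] Ident_Comp[OF j_hom] Comp_Ident[OF j_hom] by simp
  also have "\<dots> = comul A \<cdot> j"
    using Comp_assoc[OF \<delta>(1) tensor_hom[OF j_hom I(2)] tensor_hom[OF I(1) j_hom]] \<delta> \<gamma> by simp
  finally have "(j \<otimes> j) \<cdot> \<delta> = comul A \<cdot> j" .
  with \<delta> \<mu> \<eta> that show ?thesis by blast
qed

end

section \<open>Comonoid laws of \<open>K\<close> and the restriction of the antipode\<close>

locale psi_comonoid = psi_arrow C A Q \<pi> j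
  for C :: "('o, 'a, 'z) braided_category_scheme" (structure)
    and A :: "('o, 'a) hopf_monoid" and Q :: "('o, 'a) module_comonoid" and \<pi> j :: 'a +
  fixes K :: "('o, 'a, 'y) comonoid_scheme"
  assumes carr_K [simp]: "carr K = Dom C j"
    and comul_K: "comul K \<in> hom C (Dom C j) (Dom C j *. Dom C j)" "(j \<otimes> j) \<cdot> comul K = comul A \<cdot> j"
    and counit_K: "counit K = counit A \<cdot> j"
begin

lemma K_typed [simp]: "comonoid_typed K"
  unfolding comonoid_typed_def using comul_K counit_K Comp_hom[OF j_hom comonoid_hom(3)] by simp

lemmas K_ok [simp] = Dw_ok[of K, simplified] Ew_ok[of K, simplified]

lemma comul_Jw [rule_format, unfolded pcomp_assoc]:
  "\<forall>z \<in> Obj C. Dw A z ** Jw z = (Jw (a *. z) ** (k |> Jw z)) ** Dw K z"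
  by (rule tr_eq_iff[THEN iffD1, OF _ _ comul_K(2)[symmetric]])
    (rule tr_cong, (rule tr_rules tr_j tr_Dw[of K, simplified] op_tr comul_K | simp)+)+

lemma counit_Jw: "z \<in> Obj C \<Longrightarrow> Ew A z ** Jw z = Ew K z"
proof -
  have h: "counit A \<cdot> j \<in> hom C k \<one>"
    using counit_K comonoid_hom(3)[of K] by simp
  have "\<forall>z \<in> Obj C. Ew K z = Ew A z ** Jw z"
    by (rule tr_eq_iff[THEN iffD1, OF _ _ counit_K])
      (rule tr_cong, (rule tr_rules tr_j tr_Ew[of K, simplified] op_tr | simp add: counit_K h)+)+
  then show "z \<in> Obj C \<Longrightarrow> ?thesis" by auto
qed

lemmas Jw_rules = comul_Jw comul_Jw[THEN pcomp_eq_tail, unfolded pcomp_assoc]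
  counit_Jw counit_Jw[THEN pcomp_eq_tail, unfolded pcomp_assoc]

lemmas K_nat = Dw_nat[of K, simplified] Dw_nat[of K, simplified, THEN pcomp_eq_tail, unfolded pcomp_assoc]
  Ew_nat[of K, simplified] Ew_nat[of K, simplified, THEN pcomp_eq_tail, unfolded pcomp_assoc]

lemma Jw_mono2:
  assumes "z \<in> Obj C" "ok F" "ok G" "ocod F = k *. k *. z" "ocod G = k *. k *. z"
    "Jw (a *. z) ** (k |> Jw z) ** F = Jw (a *. z) ** (k |> Jw z) ** G"
  shows "F = G"
proof -
  have "(k |> Jw z) ** F = (k |> Jw z) ** G"
    by (rule Jw_mono[of "a *. z"]) (use assms in simp_all)
  then show ?thesis
    by (rule Jw_mono1[of z k, rotated 6]) (use assms in simp_all)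
qed

text \<open>The last \<open>j\<close> is brought to the front by naturality, where it is cancelled
  as an equalizer tensored with two copies of \<open>A\<close>; \<open>Jw_mono2\<close> cancels the
  other two.\<close>

lemma Jw_mono3:
  assumes "z \<in> Obj C" "ok F" "ok G" "ocod F = k *. k *. k *. z" "ocod G = k *. k *. k *. z"
    "Jw (a *. a *. z) ** (k |> (Jw (a *. z) ** (k |> Jw z))) ** F =
     Jw (a *. a *. z) ** (k |> (Jw (a *. z) ** (k |> Jw z))) ** G"
  shows "F = G"
proof -
  have "Jw (a *. k *. z) ** (k |> Jw (k *. z)) ** F = Jw (a *. k *. z) ** (k |> Jw (k *. z)) ** G"
  proof (rule oeq_mono[OF oeq_otensor(1)[OF oeq_otensor(1)[OF eqw[OF assms(1)]]], of a a])
    have "(a |> a |> Jw z) ** Jw (a *. k *. z) ** (k |> Jw (k *. z)) =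
      Jw (a *. a *. z) ** (k |> (Jw (a *. z) ** (k |> Jw z)))"
      using assms(1) by (simp add: Hw_left)
    from pcomp_tail[OF this, of F] pcomp_tail[OF this, of G] assms
    show "(a |> a |> Jw z) ** Jw (a *. k *. z) ** (k |> Jw (k *. z)) ** F =
      (a |> a |> Jw z) ** Jw (a *. k *. z) ** (k |> Jw (k *. z)) ** G"
      by (simp only: pcomp_assoc)
  qed (use assms in simp_all)
  then show ?thesis
    by (rule Jw_mono2[of "k *. z", rotated 5]) (use assms in simp_all)
qed

text \<open>Each law is compared after as many copies of \<open>j\<close> as its target has letters
  \<open>k\<close>, and reduces there to the law of \<open>A\<close>.\<close>

lemma K_comonoid: "is_cocomm_comonoid C K"
proof -
  have 1: "Dw K (k *. z) ** Dw K z = (k |> Dw K z) ** Dw K z" if [simp]: "z \<in> Obj C" for z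
  proof (rule Jw_mono3[of z])
    have "Jw (a *. a *. z) ** (k |> (Jw (a *. z) ** (k |> Jw z))) ** Dw K (k *. z) ** Dw K z =
      Dw A (a *. z) ** Dw A z ** Jw z"
      by (simp add: Jw_rules K_nat pcomp_assoc)
    also have "\<dots> = (a |> Dw A z) ** Dw A z ** Jw z"
      by (simp add: coassocw pcomp_eq_tail[OF coassocw] pcomp_assoc)
    also have "\<dots> = Jw (a *. a *. z) ** (k |> (Jw (a *. z) ** (k |> Jw z))) ** (k |> Dw K z) ** Dw K z"
      by (simp add: Jw_rules K_nat Hw_left pcomp_assoc)
    finally show "Jw (a *. a *. z) ** (k |> (Jw (a *. z) ** (k |> Jw z))) ** Dw K (k *. z) ** Dw K z =
      Jw (a *. a *. z) ** (k |> (Jw (a *. z) ** (k |> Jw z))) ** (k |> Dw K z) ** Dw K z" .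
  qed simp_all
  have 2: "Ew K (k *. z) ** Dw K z = oid (k *. z)" if [simp]: "z \<in> Obj C" for z
  proof (rule Jw_mono[of z])
    have "Jw z ** Ew K (k *. z) ** Dw K z = Ew A (a *. z) ** Jw (a *. z) ** (k |> Jw z) ** Dw K z"
      by (simp add: Jw_rules K_nat)
    also have "\<dots> = Ew A (a *. z) ** Dw A z ** Jw z"
      by (simp only: comul_Jw[OF that])
    also have "\<dots> = Jw z"
      by (simp add: pcomp_eq_tail[OF counitw_left])
    finally show "Jw z ** Ew K (k *. z) ** Dw K z = Jw z ** oid (k *. z)" by simp
  qed simp_all
  have 3: "(k |> Ew K z) ** Dw K z = oid (k *. z)" if [simp]: "z \<in> Obj C" for z
  proof (rule Jw_mono[of z])
    have "Jw z ** (k |> Ew K z) ** Dw K z = (a |> Ew A z) ** Jw (a *. z) ** (k |> Jw z) ** Dw K z"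
      by (simp add: Jw_rules Hw_left)
    also have "\<dots> = (a |> Ew A z) ** Dw A z ** Jw z"
      by (simp only: comul_Jw[OF that])
    also have "\<dots> = Jw z"
      by (simp add: pcomp_eq_tail[OF counitw_right])
    finally show "Jw z ** (k |> Ew K z) ** Dw K z = Jw z ** oid (k *. z)" by simp
  qed simp_all
  have 4: "braidw k k z ** Dw K z = Dw K z" if [simp]: "z \<in> Obj C" for z
  proof (rule Jw_mono2[of z])
    have "Jw (a *. z) ** (k |> Jw z) ** braidw k k z = braidw a a z ** Jw (a *. z) ** (k |> Jw z)"
      by (simp add: word_rules Hw_left)
    then have "Jw (a *. z) ** (k |> Jw z) ** braidw k k z ** Dw K z =
        braidw a a z ** Jw (a *. z) ** (k |> Jw z) ** Dw K z"
      by (metis pcomp_assoc)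
    also have "\<dots> = braidw a a z ** Dw A z ** Jw z"
      by (simp only: comul_Jw[OF that])
    also have "\<dots> = Dw A z ** Jw z"
      by (simp add: pcomp_eq_tail[OF cocommw])
    finally show "Jw (a *. z) ** (k |> Jw z) ** braidw k k z ** Dw K z = Jw (a *. z) ** (k |> Jw z) ** Dw K z"
      by (simp only: comul_Jw[OF that])
  qed simp_all
  show ?thesis
    using comonoid_hom[of K] 1 2 3 4 by (simp add: cocomm_comonoid_iff Let_def)
qed

text \<open>An arrow \<open>R\<close> on \<open>K\<close> is recovered from \<open>x \<mapsto> x\<^sub>1 R(x\<^sub>2)\<close> by means of the antipode of \<open>A\<close>.\<close>

lemma action_recover:
  assumes [simp]: "z \<in> Obj C" "ok R" "odom R = k *. z" "ocod R = q *. a *. z"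
  shows "Nw z ** (a |> (Nw z ** (a |> R) ** Jw (k *. z) ** Dw K z)) ** Sw A (k *. z) ** Jw (k *. z) ** Dw K z = R"
    (is "?L = R")
proof -
  note [simp] = K_comonoid
  let ?z = "q *. a *. z"
  have "?L = (Nw z ** (a |> Nw z)) ** (a |> a |> R) ** (a |> (Jw (k *. z) ** Dw K z)) **
     Sw A (k *. z) ** Jw (k *. z) ** Dw K z"
    by (simp add: pcomp_assoc)
  also have "\<dots> = Nw z ** Mw A ?z ** (a |> a |> R) ** (a |> (Jw (k *. z) ** Dw K z)) **
     Sw A (k *. z) ** Jw (k *. z) ** Dw K z"
    by (simp only: Nw_assoc[OF assms(1)] pcomp_assoc)
  also have "\<dots> = Nw z ** (a |> R) ** Mw A (k *. z) ** Sw A (a *. k *. z) ** (a |> (Jw (k *. z) ** Dw K z)) **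
      Jw (k *. z) ** Dw K z"
    by (simp add: Mw_nat[THEN pcomp_eq_tail] Mw_nat[THEN pcomp_whisker_inner_tail] Sw_nat Sw_nat[THEN pcomp_eq_tail] pcomp_assoc)
  also have "(a |> (Jw (k *. z) ** Dw K z)) ** Jw (k *. z) ** Dw K z =
      (a |> Jw (k *. z)) ** Jw (k *. k *. z) ** Dw K (k *. z) ** Dw K z"
    by (simp add: coassocw[of K, simplified] Hw_right pcomp_assoc)
  also have "\<dots> = Dw A (k *. z) ** Jw (k *. z) ** Dw K z"
    by (simp add: comul_Jw[THEN pcomp_eq_tail] pcomp_assoc Hw_right)
  also have "Nw z ** (a |> R) ** Mw A (k *. z) ** Sw A (a *. k *. z) ** Dw A (k *. z) ** Jw (k *. z) ** Dw K z =
      Nw z ** (a |> R) ** Uw A (k *. z) ** Ew A (k *. z) ** Jw (k *. z) ** Dw K z"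
    by (simp add: antipodew_left[THEN pcomp_eq_tail, unfolded pcomp_assoc])
  also have "\<dots> = (Nw z ** Uw A ?z) ** R ** Ew K (k *. z) ** Dw K z"
    by (simp add: Uw_nat[THEN pcomp_eq_tail] pcomp_assoc counit_Jw[THEN pcomp_eq_tail])
  also have "\<dots> = R"
    by (simp add: Nw_unit counitw_left[of K, simplified])
  finally show ?thesis .
qed

text \<open>For x from \<open>K\<close>, x1 . F(S(x2)) = F(x1 S(x2)) = \<epsilon>(x) F(1) =
  \<epsilon>(x) G(1) = G(x1 S(x2)). The last term is G(x1) with S(x2) multiplied in; as x1 lies in
  \<open>K\<close>, G may be replaced by F there, and \<open>Nw_Gw\<close> gives x1 . G(S(x2)).
  \<open>action_recover\<close> then removes x1.\<close>

lemma antipode_compat: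
  assumes [simp]: "z \<in> Obj C"
  shows "Fw z ** Sw A z ** Jw z = Gw z ** Sw A z ** Jw z"
proof -
  note [simp] = K_comonoid
  let ?X = "(a |> Sw A z) ** Dw A z ** Jw z"
  \<comment> \<open>\<open>?X\<close> is x \<mapsto> x1 \<otimes> S(x2). The form \<open>X\<close>
    is the one met by the action; \<open>X'\<close> keeps the first leg in \<open>K\<close> until
    the end, so that \<open>Fw_Jw\<close> can be used on it.\<close>
  have X: "(a |> (Sw A z ** Jw z)) ** Jw (k *. z) ** Dw K z = ?X"
    by (simp add: comul_Jw Hw_right)
  have X': "?X = Jw (a *. z) ** (k |> (Sw A z ** Jw z)) ** Dw K z"
    by (simp add: comul_Jw Hw_left)
  have MX: "Mw A z ** ?X = Uw A z ** Ew A z ** Jw z"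
    by (simp add: antipodew_right[THEN pcomp_eq_tail, unfolded pcomp_assoc])
  have "Nw z ** (a |> (Fw z ** Sw A z ** Jw z)) ** Jw (k *. z) ** Dw K z =
      (Nw z ** (a |> Fw z)) ** (a |> (Sw A z ** Jw z)) ** Jw (k *. z) ** Dw K z"
    by (simp add: pcomp_assoc)
  also have "\<dots> = Fw z ** Mw A z ** ?X"
    unfolding X by (simp only: Fw_mul[OF assms, symmetric] pcomp_assoc)
  also have "\<dots> = Gw z ** Mw A z ** ?X"
    unfolding MX by (simp add: Fw_unit[THEN pcomp_eq_tail] pcomp_assoc)
  also have "\<dots> = (q |> Mw A z) ** Gw (a *. z) ** ?X"
    by (simp only: pcomp_eq_tail[OF Gw_mul[OF assms]] pcomp_assoc)
  also have "\<dots> = (q |> Mw A z) ** (Fw (a *. z) ** Jw (a *. z)) ** (k |> (Sw A z ** Jw z)) ** Dw K z"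
    unfolding X' by (simp add: Fw_Jw pcomp_assoc)
  also have "\<dots> = ((q |> Mw A z) ** Fw (a *. z)) ** ?X"
    unfolding X' by (simp only: pcomp_assoc)
  also have "\<dots> = (Nw z ** (a |> Gw z)) ** (a |> (Sw A z ** Jw z)) ** Jw (k *. z) ** Dw K z"
    unfolding X by (simp only: Nw_Gw[OF assms])
  also have "\<dots> = Nw z ** (a |> (Gw z ** Sw A z ** Jw z)) ** Jw (k *. z) ** Dw K z"
    by (simp add: pcomp_assoc)
  finally have e: "Nw z ** (a |> (Fw z ** Sw A z ** Jw z)) ** Jw (k *. z) ** Dw K z =
    Nw z ** (a |> (Gw z ** Sw A z ** Jw z)) ** Jw (k *. z) ** Dw K z" .
  let ?r = "\<lambda>R. Nw z ** (a |> R) ** Sw A (k *. z) ** Jw (k *. z) ** Dw K z"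
  have "Fw z ** Sw A z ** Jw z = ?r (Nw z ** (a |> (Fw z ** Sw A z ** Jw z)) ** Jw (k *. z) ** Dw K z)"
    by (rule action_recover[symmetric]) simp_all
  also have "\<dots> = ?r (Nw z ** (a |> (Gw z ** Sw A z ** Jw z)) ** Jw (k *. z) ** Dw K z)"
    by (simp only: e)
  also have "\<dots> = Gw z ** Sw A z ** Jw z"
    by (rule action_recover) simp_all
  finally show ?thesis .
qed

lemma antipode_arrow:
  obtains s where "s \<in> hom C k k" "j \<cdot> s = antipode A \<cdot> j"
proof -
  have "antipode A \<cdot> j \<in> hom C k a"
    by (rule Comp_hom[OF j_hom]) simp
  moreover have "coact \<cdot> (antipode A \<cdot> j) = coact0 \<cdot> (antipode A \<cdot> j)"
    by (rule tr_eqI, (rule tr_Comp[OF tr_F] tr_Comp[OF tr_G] tr_rules tr_j tr_Sw | simp add: antipode_compat)+)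
  ultimately show ?thesis
    using that is_equalizerD(8)[OF eq, of "antipode A \<cdot> j"] tr_hom[OF tr_F] by (auto simp: hom_def)
qed

end

section \<open>Multiplication, unit and antipode of \<open>K\<close>\<close>

locale psi_structure = psi_comonoid C A Q \<pi> j K
  for C :: "('o, 'a, 'z) braided_category_scheme" (structure)
    and A :: "('o, 'a) hopf_monoid" and Q :: "('o, 'a) module_comonoid" and \<pi> j :: 'a
    and K :: "('o, 'a) hopf_monoid" +
  assumes mul_K: "mul K \<in> hom C (Dom C j *. Dom C j) (Dom C j)" "j \<cdot> mul K = mul A \<cdot> (j \<otimes> j)"
    and unit_K: "unit_arr K \<in> hom C \<one> (Dom C j)" "j \<cdot> unit_arr K = unit_arr A"
    and antipode_K: "antipode K \<in> hom C (Dom C j) (Dom C j)" "j \<cdot> antipode K = antipode A \<cdot> j"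
begin

lemma K_hopf_typed [simp]: "hopf_typed K"
  unfolding hopf_typed_def using mul_K unit_K antipode_K by simp

lemmas K_hopf_ok [simp] = Mw_ok[of K, simplified] Uw_ok[of K, simplified] Sw_ok[of K, simplified]

lemmas tr_K = tr_Mw[of K, simplified] tr_Uw[of K, simplified] tr_Sw[of K, simplified]

lemma mul_Jw [rule_format]: "\<forall>z \<in> Obj C. Jw z ** Mw K z = Mw A z ** Jw (a *. z) ** (k |> Jw z)"
  by (rule tr_eq_iff[THEN iffD1, OF _ _ mul_K(2)])
    (rule tr_cong, (rule tr_rules tr_j tr_K op_tr mul_K | simp)+)+

lemma unit_Jw [rule_format]: "\<forall>z \<in> Obj C. Jw z ** Uw K z = Uw A z"
  by (rule tr_eq_iff[THEN iffD1, OF _ _ unit_K(2)])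
    (rule tr_cong, (rule tr_rules tr_j tr_K op_tr unit_K | simp)+)+

lemma antipode_Jw [rule_format]: "\<forall>z \<in> Obj C. Jw z ** Sw K z = Sw A z ** Jw z"
  by (rule tr_eq_iff[THEN iffD1, OF _ _ antipode_K(2)])
    (rule tr_cong, (rule tr_rules tr_j tr_Sw[of A] tr_K op_tr antipode_K | simp)+)+

lemmas Jw_hopf_rules = mul_Jw mul_Jw[THEN pcomp_eq_tail, unfolded pcomp_assoc]
  unit_Jw unit_Jw[THEN pcomp_eq_tail, unfolded pcomp_assoc]
  antipode_Jw antipode_Jw[THEN pcomp_eq_tail, unfolded pcomp_assoc]

lemmas K_hopf_naturality = Mw_nat[of K, simplified] Uw_nat[of K, simplified] Sw_nat[of K,
  simplified]

lemmas K_hopf_naturality_whisker = Mw_nat[of K, simplified]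

lemmas K_hopf_nat = K_hopf_naturality K_hopf_naturality[THEN pcomp_eq_tail, unfolded pcomp_assoc]
  K_hopf_naturality_whisker[THEN pcomp_whisker_inner, unfolded pcomp_assoc]
  K_hopf_naturality_whisker[THEN pcomp_whisker_inner_tail, unfolded pcomp_assoc]

text \<open>The laws with target \<open>K\<close> or \<open>K \<otimes> K\<close> are compared after
  \<open>j\<close> or \<open>j \<otimes> j\<close>. Those with target the unit object follow
  directly, since the counit of \<open>K\<close> is that of \<open>A\<close> after
  \<open>j\<close>.\<close>

lemma K_hopf: "is_cocomm_hopf_monoid C K"
proof -
  note [simp] = K_comonoid
  note r = Jw_rules K_nat Jw_hopf_rules K_hopf_nat word_rules
  have 1: "Mw K z ** Mw K (k *. z) = Mw K z ** (k |> Mw K z)" if [simp]: "z \<in> Obj C" for z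
  proof (rule Jw_mono[of z])
    have nat: "(k |> Jw z) ** Mw K (k *. z) = Mw K (a *. z) ** (k |> k |> Jw z)"
      using Mw_nat[of K "Jw z" "a *. z"] by simp
    have "Jw z ** Mw K z ** Mw K (k *. z) = Mw A z ** Jw (a *. z) ** Mw K (a *. z) ** (k |> k |> Jw z)"
      by (simp only: nat Jw_hopf_rules that pcomp_assoc)
    also have "\<dots> = Mw A z ** Mw A (a *. z) ** Jw (a *. a *. z) ** (k |> (Jw (a *. z) ** (k |> Jw z)))"
      by (simp add: Jw_hopf_rules pcomp_assoc)
    also have "\<dots> = Jw z ** Mw K z ** (k |> Mw K z)"
      by (simp add: Jw_hopf_rules pcomp_assoc Hw_right mul_assocw[THEN pcomp_whisker_inner_tail]
        mul_assocw[THEN pcomp_eq_tail])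
    finally show "Jw z ** Mw K z ** Mw K (k *. z) = Jw z ** Mw K z ** (k |> Mw K z)" .
  qed simp_all
  have 2: "Mw K z ** Uw K (k *. z) = oid (k *. z)" if [simp]: "z \<in> Obj C" for z
    by (rule Jw_mono[of z]) (simp_all add: r Hw_left)
  have 3: "Mw K z ** (k |> Uw K z) = oid (k *. z)" if [simp]: "z \<in> Obj C" for z
    by (rule Jw_mono[of z]) (simp_all add: r Hw_right)
  have 4: "Dw K z ** Mw K z = Mw K (k *. z) ** (k |> k |> Mw K z) **
        (k |> braidw k k (k *. z)) ** Dw K (k *. k *. z) ** (k |> Dw K z)" if [simp]: "z \<in> Obj C" for z
  proof (rule Jw_mono2[of z])
    have nat: "(k |> Jw z) ** Mw K (k *. z) = Mw K (a *. z) ** (k |> k |> Jw z)"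
      using Mw_nat[of K "Jw z" "a *. z"] by simp
    have "Jw (a *. z) ** (k |> Jw z) ** Dw K z ** Mw K z = Dw A z ** Jw z ** Mw K z"
      by (simp only: comul_Jw[THEN pcomp_eq_tail, unfolded pcomp_assoc] that)
    also have "\<dots> = Mw A (a *. z) ** Jw (a *. a *. z) ** (k |> (Jw (a *. z) **
        (k |> (Mw A z ** Jw (a *. z) ** (k |> Jw z))) ** braidw k k (k *. z) ** (k |> Dw K z))) ** Dw K (k *. z)"
      by (simp add: r Hw_left)
    also have "\<dots> = Jw (a *. z) ** Mw K (a *. z) ** (k |> k |> Jw z) ** (k |> k |> Mw K z) **
        (k |> braidw k k (k *. z)) ** Dw K (k *. k *. z) ** (k |> Dw K z)"
      by (simp add: Jw_hopf_rules K_nat pcomp_assoc)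
    also have "\<dots> = Jw (a *. z) ** (k |> Jw z) ** Mw K (k *. z) ** (k |> k |> Mw K z) **
        (k |> braidw k k (k *. z)) ** Dw K (k *. k *. z) ** (k |> Dw K z)"
      by (simp only: nat[THEN pcomp_eq_tail] pcomp_assoc)
    finally show "Jw (a *. z) ** (k |> Jw z) ** Dw K z ** Mw K z =
        Jw (a *. z) ** (k |> Jw z) ** Mw K (k *. z) ** (k |> k |> Mw K z) **
        (k |> braidw k k (k *. z)) ** Dw K (k *. k *. z) ** (k |> Dw K z)" .
  qed simp_all
  have 5: "Dw K z ** Uw K z = Uw K (k *. z) ** Uw K z" if [simp]: "z \<in> Obj C" for z
  proof (rule Jw_mono2[of z])
    have "Jw (a *. z) ** (k |> Jw z) ** Dw K z ** Uw K z = Dw A z ** Jw z ** Uw K z"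
      by (simp only: comul_Jw[THEN pcomp_eq_tail, unfolded pcomp_assoc] that)
    also have "\<dots> = Jw (a *. z) ** (k |> Jw z) ** Uw K (k *. z) ** Uw K z"
      by (simp add: r)
    finally show "Jw (a *. z) ** (k |> Jw z) ** Dw K z ** Uw K z =
      Jw (a *. z) ** (k |> Jw z) ** Uw K (k *. z) ** Uw K z" .
  qed simp_all
  have 6: "Ew K z ** Mw K z = Ew K z ** (k |> Ew K z)" if [simp]: "z \<in> Obj C" for z
  proof -
    have "Ew K z ** Mw K z = Ew A z ** Jw z ** Mw K z"
      by (simp only: counit_Jw[THEN pcomp_eq_tail] that)
    then show ?thesis
      by (simp add: Jw_hopf_rules r)
  qed
  have 7: "Ew K z ** Uw K z = oid z" if [simp]: "z \<in> Obj C" for z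
  proof -
    have "Ew K z ** Uw K z = Ew A z ** Jw z ** Uw K z"
      by (simp only: counit_Jw[THEN pcomp_eq_tail] that)
    then show ?thesis
      by (simp add: unit_Jw counit_unitw)
  qed
  have 8: "Mw K z ** Sw K (k *. z) ** Dw K z = Uw K z ** Ew K z" if [simp]: "z \<in> Obj C" for z
  proof (rule Jw_mono[of z])
    have nat: "(k |> Jw z) ** Sw K (k *. z) = Sw K (a *. z) ** (k |> Jw z)"
      using Sw_nat[of K "Jw z" "a *. z"] by simp
    have "Jw z ** Mw K z ** Sw K (k *. z) ** Dw K z =
        Mw A z ** Jw (a *. z) ** ((k |> Jw z) ** Sw K (k *. z)) ** Dw K z"
      by (simp only: Jw_hopf_rules that pcomp_assoc)
    also have "\<dots> = Mw A z ** Sw A (a *. z) ** Jw (a *. z) ** (k |> Jw z) ** Dw K z"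
      unfolding nat by (simp add: Jw_hopf_rules pcomp_assoc)
    also have "\<dots> = Mw A z ** Sw A (a *. z) ** Dw A z ** Jw z"
      by (simp only: comul_Jw that)
    also have "\<dots> = Jw z ** Uw K z ** Ew K z"
      by (simp add: antipodew_left[THEN pcomp_eq_tail, unfolded pcomp_assoc] Jw_hopf_rules counit_Jw)
    finally show "Jw z ** Mw K z ** Sw K (k *. z) ** Dw K z = Jw z ** Uw K z ** Ew K z" .
  qed simp_all
  have 9: "Mw K z ** (k |> Sw K z) ** Dw K z = Uw K z ** Ew K z" if [simp]: "z \<in> Obj C" for z
  proof (rule Jw_mono[of z])
    have "Jw z ** Mw K z ** (k |> Sw K z) ** Dw K z = Mw A z ** Jw (a *. z) ** (k |> (Sw A z ** Jw z)) ** Dw K z"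
      by (simp add: Jw_hopf_rules pcomp_assoc)
    also have "\<dots> = Mw A z ** (a |> Sw A z) ** Jw (a *. z) ** (k |> Jw z) ** Dw K z"
      by (simp add: Hw_left)
    also have "\<dots> = Mw A z ** (a |> Sw A z) ** Dw A z ** Jw z"
      by (simp only: comul_Jw that)
    also have "\<dots> = Jw z ** Uw K z ** Ew K z"
      by (simp add: antipodew_right[THEN pcomp_eq_tail, unfolded pcomp_assoc] Jw_hopf_rules counit_Jw)
    finally show "Jw z ** Mw K z ** (k |> Sw K z) ** Dw K z = Jw z ** Uw K z ** Ew K z" .
  qed simp_all
  show ?thesis
    using mul_K unit_K antipode_K 1 2 3 4 5 6 7 8 9 by (simp add: cocomm_hopf_monoid_iff Let_def)
qed

lemma j_morphism: "hopf_morphism C K A j"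
  unfolding hopf_morphism_def comonoid_morphism_def
  using comul_K counit_K mul_K unit_K by simp

end

section \<open>The fusion arrow\<close>

context braided_monoidal_category
begin

text \<open>For a module \<open>x\<close> over a Hopf monoid \<open>A\<close>, the arrow \<open>g \<otimes> y \<mapsto> g\<^sub>1 \<otimes> g\<^sub>2 y\<close> of \<open>A \<otimes> x\<close> is
  invertible with inverse \<open>g \<otimes> y \<mapsto> g\<^sub>1 \<otimes> S(g\<^sub>2) y\<close>.\<close>

lemma fusion_inverse:
  assumes [simp]: "is_cocomm_hopf_monoid C A" "x \<in> Obj C" "ok N" "odom N = carr A *. x" "ocod N = x"
    and assoc: "N ** (carr A |> N) = N ** Mw A x" and unit: "N ** Uw A x = oid x"
  defines "\<Omega> \<equiv> (carr A |> N) ** Dw A x"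
    and "\<Omega>' \<equiv> (carr A |> (N ** Sw A x)) ** Dw A x"
  shows "\<Omega>' ** \<Omega> = oid (carr A *. x)" "\<Omega> ** \<Omega>' = oid (carr A *. x)"
proof -
  note r = assoc pcomp_eq_tail[OF assoc, unfolded pcomp_assoc] unit pcomp_eq_tail[OF unit, unfolded pcomp_assoc]
    pcomp_whisker_inner[OF assoc, unfolded pcomp_assoc] pcomp_whisker_inner_tail[OF assoc, unfolded pcomp_assoc]
  show "\<Omega>' ** \<Omega> = oid (carr A *. x)" "\<Omega> ** \<Omega>' = oid (carr A *. x)"
    unfolding \<Omega>_def \<Omega>'_def by (simp_all add: word_rules r)
qed

definition fusion :: "('o, 'a) hopf_monoid \<Rightarrow> 'o \<Rightarrow> 'a option" where
  "fusion A z = (carr A |> Mw A z) ** Dw A (carr A *. z)"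

lemma fusion_ok [simp]:
  assumes "is_cocomm_hopf_monoid C A" "z \<in> Obj C"
  shows "ok (fusion A z)" "odom (fusion A z) = carr A *. carr A *. z"
    "ocod (fusion A z) = carr A *. carr A *. z"
  using assms by (simp_all add: fusion_def)

lemma fusion_iso:
  assumes [simp]: "is_cocomm_hopf_monoid C A" "z \<in> Obj C"
  shows "oiso (fusion A z)"
  by (rule oisoI[of _ "(carr A |> (Mw A z ** Sw A (carr A *. z))) ** Dw A (carr A *. z)"])
    (use fusion_inverse[of A "carr A *. z" "Mw A z"] in \<open>simp_all add: fusion_def mul_assocw unitw_left\<close>)

lemma tr_fusion:
  assumes [simp]: "is_cocomm_hopf_monoid C A"
  shows "tr ((\<I> (carr A) \<otimes> mul A) \<cdot> \<a> (carr A) (carr A) (carr A) \<cdot> (comul A \<otimes> \<I> (carr A)))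
    (Node (Leaf (carr A)) (Leaf (carr A))) (Node (Leaf (carr A)) (Leaf (carr A))) (fusion A)"
  by (rule tr_cong, (rule tr_rules op_tr | simp add: fusion_def)+)

end

section \<open>The tensor product over \<open>K\<close>\<close>

context phi_arrow
begin

abbreviation "tensor_arrow \<equiv> (\<pi> \<otimes> \<I> a) \<cdot> ((\<I> a \<otimes> mul A) \<cdot> \<a> a a a \<cdot> (comul A \<otimes> \<I> a))"

lemma tr_tensor_arrow:
  "tr tensor_arrow (Node (Leaf a) (Leaf a)) (Node (Leaf q) (Leaf a)) (\<lambda>z. Pw (a *. z) ** fusion A z)"
  by (rule tr_cong, (rule tr_Comp[OF _ tr_fusion] tr_rules tr_\<pi> | simp)+)

text \<open>The arrow \<open>g \<otimes> x \<otimes> h \<mapsto> g\<^sub>1 \<otimes> x\<^sub>1 \<otimes> g\<^sub>2 x\<^sub>2 h\<close> of \<open>A \<otimes> K \<otimes> A\<close>, a composite of two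
  fusion arrows.\<close>

definition "Vw z = (a |> ((k |> Mw A z) ** braidw a k (a *. z))) ** Dw A (k *. a *. z)"
definition "Ww z = a |> ((k |> (Mw A z ** Iw (a *. z))) ** Dw K (a *. z))"

lemma VW_ok [simp]:
  assumes "z \<in> Obj C"
  shows "ok (Vw z)" "odom (Vw z) = a *. k *. a *. z" "ocod (Vw z) = a *. k *. a *. z"
    "ok (Ww z)" "odom (Ww z) = a *. k *. a *. z" "ocod (Ww z) = a *. k *. a *. z"
  using assms by (simp_all add: Vw_def Ww_def)

text \<open>\<open>Vw\<close> is the fusion arrow for \<open>A\<close> acting on
  \<open>K \<otimes> A\<close> across \<open>K\<close> by the braiding; \<open>Ww\<close> is the one
  for \<open>K\<close> acting on \<open>A\<close> through \<open>i\<close>, tensored with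
  \<open>A\<close>. Their inverses compose to the section that \<open>ocoeq_transport\<close> asks
  for.\<close>

lemma VW_section:
  assumes [simp]: "z \<in> Obj C"
  shows "\<exists>X. ok X \<and> (Vw z ** Ww z) ** X = oid (a *. k *. a *. z)"
proof -
  let ?N = "(k |> Mw A z) ** braidw a k (a *. z)" and ?x = "k *. a *. z"
  let ?V = "(a |> (?N ** Sw A ?x)) ** Dw A ?x"
  have V: "Vw z ** ?V = oid (a *. ?x)"
    using fusion_inverse(2)[of A ?x ?N] by (simp add: Vw_def word_rules)
  let ?N' = "Mw A z ** Iw (a *. z)"
  let ?W = "(k |> (?N' ** Sw K (a *. z))) ** Dw K (a *. z)"
  have "((k |> ?N') ** Dw K (a *. z)) ** ?W = oid (k *. a *. z)"
    by (rule fusion_inverse(2)) (simp_all add: word_rules Hw_right Iw_rules)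
  then have W: "Ww z ** (a |> ?W) = oid (a *. ?x)"
    unfolding Ww_def by (subst pcomp_whisker) (simp_all only: Dw_ok Mw_ok Hw_ok Sw_ok ok_pcomp odom_pcomp
      ocod_pcomp ok_whisker odom_whisker ocod_whisker whisker_oid hopf_comonoid cocomm_comonoid_typed
      cocomm_hopf_typed A K assms comonoid_hom tensor_Obj' i_hom simp_thms)
  have "(Vw z ** Ww z) ** (a |> ?W) ** ?V = Vw z ** (Ww z ** (a |> ?W)) ** ?V"
    by (simp only: pcomp_assoc)
  also have "\<dots> = oid (a *. ?x)"
    unfolding W using V by simp
  finally show ?thesis
    by (intro exI[of _ "(a |> ?W) ** ?V"]) simp
qed

text \<open>Both sides send g \<otimes> x \<otimes> h to g1 i(x1) \<otimes> g2 i(x2) h. With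
  \<open>fusion_right\<close> this carries the pair defining the tensor product over
  \<open>K\<close> to the pair defining \<open>Q\<close>, tensored with \<open>A\<close>.\<close>

lemma fusion_left:
  assumes [simp]: "z \<in> Obj C"
  shows "fusion A z ** fw (a *. z) = fw (a *. z) ** Vw z ** Ww z"
  by (simp add: fusion_def fw_def Vw_def Ww_def word_rules Hw_right Iw_rules)

lemma fusion_right:
  assumes [simp]: "z \<in> Obj C"
  shows "fusion A z ** (a |> (Mw A z ** Iw (a *. z))) = (a |> Ew K (a *. z)) ** Vw z ** Ww z"
  by (simp add: fusion_def Vw_def Ww_def word_rules Hw_right Iw_rules)

text \<open>Transport of the coequalizer \<pi>, tensored with \<open>A\<close>, along the invertible
  fusion arrow; on the source of the pair the change is \<open>Vw\<close> after \<open>Ww\<close>, a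
  split epimorphism.\<close>

lemma tensor_coequalizer:
  "is_coequalizer C ((mul A \<cdot> (\<I> a \<otimes> i)) \<otimes> \<I> a) ((\<I> a \<otimes> (mul A \<cdot> (i \<otimes> \<I> a))) \<cdot> \<a> a k a) tensor_arrow"
proof (rule tr_coequalizer)
  show "tr ((mul A \<cdot> (\<I> a \<otimes> i)) \<otimes> \<I> a) (Node (Node (Leaf a) (Leaf k)) (Leaf a)) (Node (Leaf a) (Leaf a))
    (\<lambda>z. fw (a *. z))"
    by (rule tr_cong, (rule tr_tensor[OF tr_f] tr_rules | simp)+)
  show "tr ((\<I> a \<otimes> (mul A \<cdot> (i \<otimes> \<I> a))) \<cdot> \<a> a k a) (Node (Node (Leaf a) (Leaf k)) (Leaf a)) (Node (Leaf a) (Leaf a))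
    (\<lambda>z. a |> (Mw A z ** Iw (a *. z)))"
    by (rule tr_cong, (rule tr_rules tr_Mw tr_Hw[of k a i] | simp)+)
  show "tr tensor_arrow (Node (Leaf a) (Leaf a)) (Node (Leaf q) (Leaf a)) (\<lambda>z. Pw (a *. z) ** fusion A z)"
    by (rule tr_tensor_arrow)
  obtain X where X: "ok X" "(Vw \<one> ** Ww \<one>) ** X = oid (a *. k *. a *. \<one>)"
    using VW_section[OF unit_Obj] by blast
  have "ocoeq (fw (a *. \<one>)) (a |> (Mw A \<one> ** Iw (a *. \<one>))) (oid (q *. a *. \<one>) ** Pw (a *. \<one>) ** fusion A \<one>)"
    by (rule ocoeq_transport[OF coeqw, of "a *. \<one>" _ _ "Vw \<one> ** Ww \<one>" X])
      (use X in \<open>simp_all add: fusion_iso fusion_left fusion_right del: ok_pcomp, simp_all\<close>)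
  then show "ocoeq (fw (a *. \<one>)) (a |> (Mw A \<one> ** Iw (a *. \<one>))) (Pw (a *. \<one>) ** fusion A \<one>)"
    by simp
qed

lemma sub_condition_iff:
  "sub_condition C A (SArr K i A) \<longleftrightarrow> is_psi C A \<pi> i"
proof -
  let ?f = "\<lambda>p. p \<cdot> (unit_arr A \<otimes> \<I> a) \<cdot> inv_arr C (\<l> a)"
  let ?g = "\<lambda>p. p \<cdot> (\<I> a \<otimes> unit_arr A) \<cdot> inv_arr C (\<r> a)"
  let ?c = "is_coequalizer C ((mul A \<cdot> (\<I> a \<otimes> i)) \<otimes> \<I> a) ((\<I> a \<otimes> (mul A \<cdot> (i \<otimes> \<I> a))) \<cdot> \<a> a k a)"
  have sub: "sub_condition C A (SArr K i A) \<longleftrightarrow> (\<exists>p. ?c p \<and> is_equalizer C (?f p) (?g p) i)"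
    by (simp add: sub_condition_def is_tensor_over_def Let_def)
  have f: "?f tensor_arrow = ((\<pi> \<cdot> unit_arr A) \<otimes> \<I> a) \<cdot> inv_arr C (\<l> a)"
    by (rule tr_eqI, (rule tr_Comp[OF tr_tensor_arrow] tr_rules tr_\<pi> op_tr | simp)+)
      (simp add: fusion_def word_rules Hw_left)
  have g: "?g tensor_arrow = (\<pi> \<otimes> \<I> a) \<cdot> comul A"
    by (rule tr_eqI, (rule tr_Comp[OF tr_tensor_arrow] tr_rules tr_\<pi> op_tr | simp)+)
      (simp add: fusion_def word_rules Hw_left)
  \<comment> \<open>\<open>is_psi\<close> lists the same two arrows in the opposite order.\<close>
  have psi: "is_psi C A \<pi> i \<longleftrightarrow> is_equalizer C (?f tensor_arrow) (?g tensor_arrow) i"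
    unfolding f g is_psi_def Let_def using oeq_sym oeq_Some by metis
  \<comment> \<open>The condition is existential in the coequalizer. Two coequalizers differ by an
    isomorphism after them, which does not change the equalizer, so it may be tested on
    \<open>tensor_arrow\<close>.\<close>
  have "is_equalizer C (?f p) (?g p) i \<longleftrightarrow> is_equalizer C (?f p') (?g p') i" if p: "?c p" and p': "?c p'" for p p'
  proof -
    have *: "is_equalizer C (?f p') (?g p') i"
      if p: "?c p" and p': "?c p'" and eq: "is_equalizer C (?f p) (?g p) i" for p p'
    proof -
      obtain T where T: "oiso T" "odom T = ocod (Some p)" "ocod T = ocod (Some p')" "T ** Some p = Some p'"
        using ocoeq_unique[of _ _ "Some p" "Some p'"] p p' by (metis ocoeq_Some)
      have v: "inv_arr C (\<l> a) \<in> hom C a (\<one> *. a)" "inv_arr C (\<r> a) \<in> hom C a (a *. \<one>)"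
        using tr_hom[OF tr_lunit_inv_Leaf, of a] tr_hom[OF tr_runit_inv_Leaf, of a] by simp_all
      have u: "(unit_arr A \<otimes> \<I> a) \<cdot> inv_arr C (\<l> a) \<in> hom C a (a *. a)"
        "(\<I> a \<otimes> unit_arr A) \<cdot> inv_arr C (\<r> a) \<in> hom C a (a *. a)"
        using Comp_hom[OF v(1) tensor_hom[OF hopf_hom(2) Ident_hom]]
          Comp_hom[OF v(2) tensor_hom[OF Ident_hom hopf_hom(2)]] by simp_all
      have h: "p \<in> hom C (a *. a) (Cod C p)" "p' \<in> hom C (a *. a) (Cod C p')"
        using is_coequalizerD(3,6)[OF p] is_coequalizerD(3,6)[OF p'] is_coequalizerD(6)[OF tensor_coequalizer]
          tr_hom[OF tr_tensor_arrow] by (auto simp: hom_def)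
      have "Some (?f p') = T ** Some (?f p)" "Some (?g p') = T ** Some (?g p)"
        using Some_Comp[OF u(1) h(1)] Some_Comp[OF u(2) h(1)] Some_Comp[OF u(1) h(2)] Some_Comp[OF u(2) h(2)] T(4)
        by (simp_all add: pcomp_assoc[symmetric])
      moreover have "oeq (T ** Some (?f p)) (T ** Some (?g p)) (Some i)"
        by (rule oeq_postcomp_iso) (use eq T Comp_hom[OF u(1) h(1)] in \<open>auto simp: hom_def\<close>)
      ultimately have "oeq (Some (?f p')) (Some (?g p')) (Some i)" by (simp only:)
      then show ?thesis by (simp only: oeq_Some)
    qed
    show ?thesis using *[OF p p'] *[OF p' p] by blast
  qed
  then show ?thesis
    unfolding sub psi using tensor_coequalizer by blast
qed

end

section \<open>The cotensor product over \<open>Q\<close>\<close>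

context psi_structure
begin

abbreviation "cotensor_arrow \<equiv> ((\<I> a \<otimes> mul A) \<cdot> \<a> a a a \<cdot> (comul A \<otimes> \<I> a)) \<cdot> (\<I> a \<otimes> j)"

lemma tr_cotensor_arrow:
  "tr cotensor_arrow (Node (Leaf a) (Leaf k)) (Node (Leaf a) (Leaf a)) (\<lambda>z. fusion A z ** (a |> Jw z))"
  by (rule tr_cong, (rule tr_Comp[OF tr_fusion] tr_rules tr_j | simp)+)

text \<open>F(g2 h) = g2 . F(h), so past F the fusion arrow of \<open>A\<close> becomes the fusion
  arrow of the module \<open>Q \<otimes> A\<close> under the diagonal action.\<close>

lemma fusion_F:
  assumes [simp]: "z \<in> Obj C"
  shows "(a |> Fw z) ** fusion A z = ((a |> Nw z) ** Dw A (q *. a *. z)) ** (a |> Fw z)"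
  by (simp add: fusion_def Fw_mul[THEN pcomp_eq_tail] Fw_mul word_rules)

text \<open>Both sides are g \<otimes> h \<mapsto> g1 \<otimes> \<pi>(g2) \<otimes> g3 h; on the
  right it arises as g2 acting diagonally on \<pi>(1) \<otimes> h.\<close>

lemma fusion_G:
  assumes [simp]: "z \<in> Obj C"
  shows "(a |> Pw (a *. z)) ** Dw A (a *. z) ** fusion A z = ((a |> Nw z) ** Dw A (q *. a *. z)) ** (a |> Gw z)"
proof -
  have "(a |> Pw (a *. z)) ** Dw A (a *. z) ** fusion A z = (a |> ((q |> Mw A z) ** Fw (a *. z))) ** Dw A (a *. z)"
    by (simp add: fusion_def Fw_def word_rules Hw_right)
  also have "\<dots> = (a |> (Nw z ** (a |> Gw z))) ** Dw A (a *. z)"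
    by (simp add: Nw_Gw)
  also have "\<dots> = ((a |> Nw z) ** Dw A (q *. a *. z)) ** (a |> Gw z)"
    by (simp add: word_rules)
  finally show ?thesis .
qed

lemma cotensor_equalizer:
  "is_equalizer C (((\<I> a \<otimes> \<pi>) \<cdot> comul A) \<otimes> \<I> a)
    (inv_arr C (\<a> a q a) \<cdot> (\<I> a \<otimes> ((\<pi> \<otimes> \<I> a) \<cdot> comul A))) cotensor_arrow"
proof (rule tr_equalizer)
  show "tr (((\<I> a \<otimes> \<pi>) \<cdot> comul A) \<otimes> \<I> a) (Node (Leaf a) (Leaf a)) (Node (Node (Leaf a) (Leaf q)) (Leaf a))
    (\<lambda>z. (a |> Pw (a *. z)) ** Dw A (a *. z))"
    by (rule tr_cong, (rule tr_rules tr_\<pi> op_tr | simp)+)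
  show "tr (inv_arr C (\<a> a q a) \<cdot> (\<I> a \<otimes> ((\<pi> \<otimes> \<I> a) \<cdot> comul A))) (Node (Leaf a) (Leaf a))
    (Node (Node (Leaf a) (Leaf q)) (Leaf a)) (\<lambda>z. a |> Fw z)"
    by (rule tr_cong, (rule tr_tensor[OF _ tr_F] tr_rules | simp)+)
  show "tr cotensor_arrow (Node (Leaf a) (Leaf k)) (Node (Leaf a) (Leaf a)) (\<lambda>z. fusion A z ** (a |> Jw z))"
    by (rule tr_cotensor_arrow)
  let ?x = "q *. a *. \<one>"
  \<comment> \<open>The dual transport needs a retraction on the target of the pair; the inverse
    fusion arrow of \<open>Q \<otimes> A\<close> is one.\<close>
  have inv: "((a |> (Nw \<one> ** Sw A ?x)) ** Dw A ?x) ** (a |> Nw \<one>) ** Dw A ?x = oid (a *. ?x)"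
    by (rule fusion_inverse(1)) (simp_all add: Nw_assoc Nw_unit)
  have "oeq ((a |> Pw (a *. \<one>)) ** Dw A (a *. \<one>)) (a |> Fw \<one>)
      (fusion A \<one> ** (a |> Jw \<one>) ** oid (a *. k *. \<one>))"
    by (rule oeq_transport[OF oeq_sym[OF oeq_otensor(1)[OF eqw[OF unit_Obj]]], of a _ _
        "(a |> Nw \<one>) ** Dw A ?x" "(a |> (Nw \<one> ** Sw A ?x)) ** Dw A ?x"])
      (use inv in \<open>simp_all add: fusion_iso fusion_F fusion_G[unfolded pcomp_assoc] pcomp_assoc\<close>)
  then show "oeq ((a |> Pw (a *. \<one>)) ** Dw A (a *. \<one>)) (a |> Fw \<one>) (fusion A \<one> ** (a |> Jw \<one>))"
    by simp
qed

text \<open>On \<open>cotensor_arrow\<close> the two counits leave g \<otimes> x \<mapsto> g j(x)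
  and g \<otimes> x \<mapsto> g \<epsilon>(x), which is the pair whose coequalizer is
  \<phi>(j).\<close>

lemma quot_condition_iff:
  "quot_condition C A \<pi> \<longleftrightarrow> is_phi C A (SArr K j A) \<pi>"
proof -
  let ?f = "\<lambda>e. \<l> a \<cdot> (counit A \<otimes> \<I> a) \<cdot> e"
  let ?g = "\<lambda>e. \<r> a \<cdot> (\<I> a \<otimes> counit A) \<cdot> e"
  let ?c = "is_equalizer C (((\<I> a \<otimes> \<pi>) \<cdot> comul A) \<otimes> \<I> a)
    (inv_arr C (\<a> a q a) \<cdot> (\<I> a \<otimes> ((\<pi> \<otimes> \<I> a) \<cdot> comul A)))"
  have q: "Cod C \<pi> = q"
    using \<pi>_hom by (simp add: hom_def)
  have quot: "quot_condition C A \<pi> \<longleftrightarrow> (\<exists>e. ?c e \<and> is_coequalizer C (?f e) (?g e) \<pi>)"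
    by (simp add: quot_condition_def is_cotensor_over_def Let_def q)
  have f: "?f cotensor_arrow = mul A \<cdot> (\<I> a \<otimes> j)"
    by (rule tr_eqI, (rule tr_Comp[OF _ tr_cotensor_arrow] tr_rules tr_j op_tr | simp)+)
      (simp add: fusion_def word_rules Hw_left)
  have g: "?g cotensor_arrow = \<r> a \<cdot> (\<I> a \<otimes> counit K)"
    by (rule tr_eqI, (rule tr_Comp[OF _ tr_cotensor_arrow] tr_rules tr_j tr_Ew[of A] tr_Ew[of K, simplified] op_tr |
      simp add: comonoid_hom(3)[of K, simplified])+)
      (simp add: fusion_def word_rules Hw_left Jw_rules,
       simp add: whisker_pcomp counitw_right pcomp_assoc del: pcomp_whisker)
  have phi: "is_phi C A (SArr K j A) \<pi> \<longleftrightarrow> is_coequalizer C (?f cotensor_arrow) (?g cotensor_arrow) \<pi>"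
    unfolding f g is_phi_def Let_def by simp
  \<comment> \<open>Independence of the chosen cotensor product: another choice precomposes the pair
    with an isomorphism.\<close>
  have "is_coequalizer C (?f e) (?g e) \<pi> \<longleftrightarrow> is_coequalizer C (?f e') (?g e') \<pi>" if e: "?c e" and e': "?c e'" for e e'
  proof -
    have *: "is_coequalizer C (?f e') (?g e') \<pi>"
      if e: "?c e" and e': "?c e'" and eq: "is_coequalizer C (?f e) (?g e) \<pi>" for e e'
    proof -
      obtain T where T: "oiso T" "odom T = odom (Some e')" "ocod T = odom (Some e)" "Some e ** T = Some e'"
        using oeq_unique[of _ _ "Some e" "Some e'"] e e' by (metis oeq_Some)
      have h: "e \<in> hom C (Dom C e) (a *. a)" "e' \<in> hom C (Dom C e') (a *. a)"
        using is_equalizerD(3,6)[OF e] is_equalizerD(3,6)[OF e'] is_equalizerD(6)[OF cotensor_equalizer]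
          tr_hom[OF tr_cotensor_arrow] by (auto simp: hom_def)
      have uu: "\<l> a \<in> hom C (\<one> *. a) a" "counit A \<otimes> \<I> a \<in> hom C (a *. a) (\<one> *. a)"
        "\<r> a \<in> hom C (a *. \<one>) a" "\<I> a \<otimes> counit A \<in> hom C (a *. a) (a *. \<one>)"
        by (auto intro!: lunit_hom runit_hom tensor_hom Ident_hom)
      have u: "\<l> a \<cdot> (counit A \<otimes> \<I> a) \<in> hom C (a *. a) a" "\<r> a \<cdot> (\<I> a \<otimes> counit A) \<in> hom C (a *. a) a"
        using Comp_hom[OF uu(2,1)] Comp_hom[OF uu(4,3)] by simp_all
      have s: "?f x = (\<l> a \<cdot> (counit A \<otimes> \<I> a)) \<cdot> x" "?g x = (\<r> a \<cdot> (\<I> a \<otimes> counit A)) \<cdot> x"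
        if "x \<in> hom C (Dom C x) (a *. a)" for x
        using Comp_assoc[OF that uu(2) uu(1)] Comp_assoc[OF that uu(4) uu(3)] by simp_all
      have "Some (?f e') = Some (?f e) ** T" "Some (?g e') = Some (?g e) ** T"
        unfolding s[OF h(1)] s[OF h(2)]
        using Some_Comp[OF h(1) u(1)] Some_Comp[OF h(1) u(2)] Some_Comp[OF h(2) u(1)] Some_Comp[OF h(2) u(2)] T(4)
        by (simp_all add: pcomp_assoc)
      moreover have "ocoeq (Some (?f e) ** T) (Some (?g e) ** T) (Some \<pi>)"
        by (rule ocoeq_precomp_iso)
          (use eq T Comp_hom[OF h(1) u(1)] s(1)[OF h(1)] in \<open>auto simp: hom_def\<close>)
      ultimately have "ocoeq (Some (?f e')) (Some (?g e')) (Some \<pi>)" by (simp only:)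
      then show ?thesis by (simp only: ocoeq_Some)
    qed
    show ?thesis using *[OF e e'] *[OF e' e] by blast
  qed
  then show ?thesis
    unfolding quot phi using cotensor_equalizer by blast
qed

end

section \<open>The correspondence\<close>

definition mono_rel :: "('o, 'a, 'z) category_scheme \<Rightarrow> 'o \<Rightarrow> 'a rel" where
  "mono_rel C a = {(i, j). i \<in> monos_into C a \<and> j \<in> monos_into C a \<and>
    (\<exists>t \<in> hom C (Dom C i) (Dom C j). is_iso C t \<and> j \<cdot>\<^bsub>C\<^esub> t = i)}"

definition epi_rel :: "('o, 'a, 'z) category_scheme \<Rightarrow> 'o \<Rightarrow> 'a rel" where
  "epi_rel C a = {(p, r). p \<in> epis_from C a \<and> r \<in> epis_from C a \<and>
    (\<exists>t \<in> hom C (Cod C p) (Cod C r). is_iso C t \<and> t \<cdot>\<^bsub>C\<^esub> p = r)}"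

text \<open>A relation \<open>L\<close> that is invariant on both sides, and whose partners are
  unique up to \<open>R\<close> and \<open>R'\<close>, matches classes with classes. It is applied
  once to a relation and once to its converse, which gives both composites.\<close>

lemma quotient_correspondence:
  assumes R: "refl_on S R" and L: "\<And>i p. L i p \<Longrightarrow> p \<in> T"
    and L1: "\<And>i i' p. L i p \<Longrightarrow> (i, i') \<in> R \<Longrightarrow> L i' p"
    and L2: "\<And>i p p'. L i p \<Longrightarrow> (p, p') \<in> R' \<Longrightarrow> L i p'"
    and L3: "\<And>i p p'. L i p \<Longrightarrow> L i p' \<Longrightarrow> (p, p') \<in> R'"
    and L4: "\<And>i i' p. L i p \<Longrightarrow> L i' p \<Longrightarrow> (i, i') \<in> R"
    and X: "X \<in> S // R" "\<And>i. i \<in> X \<Longrightarrow> \<exists>p. L i p"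
  defines "Y \<equiv> {p. \<exists>i \<in> X. L i p}"
  shows "Y \<in> T // R'" "{i. \<exists>p \<in> Y. L i p} = X"
proof -
  obtain i where i: "i \<in> S" "X = R `` {i}"
    using X(1) by (auto elim: quotientE)
  have iX: "i \<in> X"
    using i R by (auto simp: refl_on_def)
  obtain p where p: "L i p"
    using X(2)[OF iX] by blast
  \<comment> \<open>By invariance the single representative \<open>i\<close> has all the partners of
    its class.\<close>
  have base: "L i p'" if "i' \<in> X" "L i' p'" for i' p'
    using L1[OF p] L2[OF p] L3[of i' p p'] that i by blast
  have "Y = R' `` {p}"
    unfolding Y_def using base L3[OF p] L2[OF p] iX by blast
  then show "Y \<in> T // R'"
    using L[OF p] by (auto intro: quotientI)
  show "{i. \<exists>p \<in> Y. L i p} = X"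
    unfolding Y_def using base L4 X(2) i by blast
qed

context hopf_arrow
begin

text \<open>Both sides equal \<open>x \<mapsto> S(i(x\<^sub>1)) i(x\<^sub>2) i(S(x\<^sub>3))\<close>.\<close>

lemma antipode_Iw:
  assumes [simp]: "z \<in> Obj C"
  shows "Sw A z ** Iw z = Iw z ** Sw K z"
proof -
  let ?R = "Iw z ** Sw K z"
  have inner: "Mw A z ** Iw (a *. z) ** (k |> ?R) ** Dw K z = Uw A z ** Ew K z"
  proof -
    have "Mw A z ** Iw (a *. z) ** (k |> ?R) ** Dw K z = (Iw z ** Mw K z) ** (k |> Sw K z) ** Dw K z"
      by (simp add: Iw_mul pcomp_assoc)
    also have "\<dots> = (Iw z ** Uw K z) ** Ew K z"
      by (simp add: pcomp_assoc antipodew_right)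
    finally show ?thesis by (simp add: Iw_unit)
  qed
  have "Sw A z ** Iw z = Mw A z ** Sw A (a *. z) ** Iw (a *. z) ** (k |> (Uw A z ** Ew K z)) ** Dw K z"
    by (simp add: whisker_pcomp pcomp_assoc counitw_right del: pcomp_whisker) (simp add: word_rules Hw_right)
  also have "\<dots> = Mw A z ** Sw A (a *. z) ** Iw (a *. z) **
      (k |> (Mw A z ** Iw (a *. z) ** (k |> ?R) ** Dw K z)) ** Dw K z"
    by (simp only: inner)
  also have "\<dots> = Mw A z ** Mw A (a *. z) ** Sw A (a *. a *. z) ** Iw (a *. a *. z) **
      (k |> (Iw (a *. z) ** (k |> ?R) ** Dw K z)) ** Dw K z"
    by (simp add: word_rules Hw_right)
  also have "(k |> (Iw (a *. z) ** (k |> ?R) ** Dw K z)) ** Dw K z =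
      (k |> Iw (a *. z)) ** Dw K (a *. z) ** (k |> ?R) ** Dw K z"
    by (simp add: Dw_nat[THEN pcomp_eq_tail] pcomp_assoc coassocw)
  also have "Mw A z ** Mw A (a *. z) ** Sw A (a *. a *. z) ** Iw (a *. a *. z) **
      (k |> Iw (a *. z)) ** Dw K (a *. z) ** (k |> ?R) ** Dw K z =
      Mw A z ** (Mw A (a *. z) ** Sw A (a *. a *. z) ** Dw A (a *. z)) ** Iw (a *. z) ** (k |> ?R) ** Dw K z"
    by (simp add: comul_Iw[THEN pcomp_eq_tail] pcomp_assoc)
  also have "\<dots> = (Mw A z ** Uw A (a *. z)) ** Ew K (a *. z) ** (k |> ?R) ** Dw K z"
    by (simp add: antipodew_left counit_Iw[THEN pcomp_eq_tail] pcomp_assoc)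
  also have "\<dots> = ?R ** Ew K (k *. z) ** Dw K z"
    by (simp add: unitw_left Ew_nat Ew_nat[THEN pcomp_eq_tail] pcomp_assoc)
  also have "\<dots> = ?R"
    by (simp add: counitw_left)
  finally show ?thesis .
qed

text \<open>\<open>hopf_morphism\<close> asks only for compatibility with the bimonoid structure.
  This supplies the antipode equation of \<open>psi_structure\<close>, so every Hopf monoid
  structure on the equalizer falls under that locale.\<close>

lemma antipode_morphism: "i \<cdot> antipode K = antipode A \<cdot> i"
  by (rule tr_eqI, (rule tr_rules tr_Sw tr_Hw[of k a i] | simp add: antipode_Iw)+)

end

section \<open>The categories of structured objects\<close>

context braided_monoidal_category
begin

lemma Hopf_coc_simps [simp]:
  "Obj (Hopf_coc C) = {A. is_cocomm_hopf_monoid C A}"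
  "Dom (Hopf_coc C) = src" "Cod (Hopf_coc C) = tgt"
  "Ident (Hopf_coc C) X = SArr X (\<I> (carr X)) X"
  "Comp (Hopf_coc C) g f = SArr (src f) (und g \<cdot> und f) (tgt g)"
  by (simp_all add: Hopf_coc_def)

lemma Hopf_coc_Arr [simp]: "f \<in> Arr (Hopf_coc C) \<longleftrightarrow> is_cocomm_hopf_monoid C (src f) \<and>
    is_cocomm_hopf_monoid C (tgt f) \<and> hopf_morphism C (src f) (tgt f) (und f)"
  by (cases f) (auto simp: Hopf_coc_def)

lemma Comon_coc_simps [simp]:
  "Obj (Comon_coc C A) = {Q. is_cocomm_module_comonoid C A Q}"
  "Dom (Comon_coc C A) = src" "Cod (Comon_coc C A) = tgt"
  "Ident (Comon_coc C A) X = SArr X (\<I> (carr X)) X"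
  "Comp (Comon_coc C A) g f = SArr (src f) (und g \<cdot> und f) (tgt g)"
  by (simp_all add: Comon_coc_def)

lemma Comon_coc_Arr [simp]: "f \<in> Arr (Comon_coc C A) \<longleftrightarrow> is_cocomm_module_comonoid C A (src f) \<and>
    is_cocomm_module_comonoid C A (tgt f) \<and> comonoid_morphism C (src f) (tgt f) (und f) \<and>
    left_linear C A (act (src f)) (act (tgt f)) (und f)"
  by (cases f) (auto simp: Comon_coc_def)

lemma comonoid_morphism_Ident:
  assumes "is_cocomm_comonoid C X"
  shows "comonoid_morphism C X X (\<I> (carr X))"
proof -
  have h: "comul X \<in> hom C (carr X) (carr X *. carr X)" "counit X \<in> hom C (carr X) \<one>" "carr X \<in> Obj C"
    using assms by simp_all
  show ?thesis
    using h Comp_Ident[OF h(1)] Comp_Ident[OF h(2)] Ident_Comp[OF h(1)]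
    by (simp add: comonoid_morphism_def tensor_Ident Ident_hom)
qed

lemma regular_simps [simp]:
  "carr (regular A) = carr A" "comul (regular A) = comul A" "counit (regular A) = counit A"
  "act (regular A) = mul A"
  by (simp_all add: regular_def)

lemma regular_words: "Dw (regular A) = Dw A" "Ew (regular A) = Ew A" "Lw A (regular A) = Mw A"
  by (simp_all add: Dw_def Ew_def Lw_def Mw_def)

lemma regular_module_comonoid:
  assumes [simp]: "is_cocomm_hopf_monoid C A"
  shows "is_cocomm_module_comonoid C A (regular A)"
proof -
  have c: "is_cocomm_comonoid C (regular A)"
    using hopf_comonoid[OF assms] unfolding is_cocomm_comonoid_def regular_simps .
  have d: "Dw A z ** Mw A z = Mw A (carr A *. z) ** (carr A |> carr A |> Mw A z) **
        (carr A |> braidw (carr A) (carr A) (carr A *. z)) ** Dw A (carr A *. carr A *. z) ** (carr A |> Dw A z)"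
    "Ew A z ** Mw A z = Ew A z ** (carr A |> Ew A z)" if "z \<in> Obj C" for z
    using assms[unfolded cocomm_hopf_monoid_iff Let_def] that by blast+
  show ?thesis
    unfolding module_comonoid_iff[OF assms] Let_def regular_words regular_simps
    using c d by (simp add: mul_assocw unitw_left)
qed

end

text \<open>\<open>j \<otimes> j\<close> factors as \<open>\<I> a \<otimes> j\<close> after
  \<open>j \<otimes> \<I> k\<close>, and both are equalizers. It fixes the comultiplication of
  \<open>K\<close>.\<close>

lemma (in psi_arrow) j_tensor_mono:
  assumes "(j \<otimes> j) \<cdot> h = (j \<otimes> j) \<cdot> h'" "h \<in> hom C w (k *. k)" "h' \<in> hom C w (k *. k)"
  shows "h = h'"
proof -
  have I: "\<I> a \<in> hom C a a" "\<I> k \<in> hom C k k" by (simp_all add: Ident_hom)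
  note j1 = tensor_hom[OF j_hom I(2)] and j2 = tensor_hom[OF I(1) j_hom]
  have s: "(j \<otimes> j) \<cdot> x = (\<I> a \<otimes> j) \<cdot> ((j \<otimes> \<I> k) \<cdot> x)" if "x \<in> hom C w (k *. k)" for x
    using tensor_Comp[OF j_hom I j_hom] Ident_Comp[OF j_hom] Comp_Ident[OF j_hom] Comp_assoc[OF that j1 j2] by simp
  have eqs: "is_equalizer C (\<I> a \<otimes> coact) (\<I> a \<otimes> coact0) (\<I> a \<otimes> j)"
    "is_equalizer C (coact \<otimes> \<I> k) (coact0 \<otimes> \<I> k) (j \<otimes> \<I> k)"
    using eq eq_tensor by (simp_all add: equalizers_preserved_by_tensor_def)
  have "(j \<otimes> \<I> k) \<cdot> h = (j \<otimes> \<I> k) \<cdot> h'"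
    using equalizer_mono[OF eqs(1), of "(j \<otimes> \<I> k) \<cdot> h" w "(j \<otimes> \<I> k) \<cdot> h'" w]
      s assms Comp_hom[OF assms(2) j1] Comp_hom[OF assms(3) j1] j2 by (simp add: hom_def)
  then show ?thesis
    using equalizer_mono[OF eqs(2), of h w h' w] assms(2,3) j1 by (simp add: hom_def)
qed

text \<open>Restricting the antipode uses the comonoid laws of \<open>K\<close>. Hence a bare
  comonoid is interpreted before the full record exists, which is why \<open>psi_comonoid\<close>
  takes an extensible record.\<close>

lemma (in psi_arrow) psi_structure_exists: "\<exists>K. psi_structure C A Q \<pi> j K"
proof -
  obtain \<delta> \<mu> \<eta> where s:
    "\<delta> \<in> hom C k (k *. k)" "(j \<otimes> j) \<cdot> \<delta> = comul A \<cdot> j"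
    "\<mu> \<in> hom C (k *. k) k" "j \<cdot> \<mu> = mul A \<cdot> (j \<otimes> j)"
    "\<eta> \<in> hom C \<one> k" "j \<cdot> \<eta> = unit_arr A"
    by (rule sub_arrows)
  interpret X: psi_comonoid C A Q \<pi> j "\<lparr>carr = k, comul = \<delta>, counit = counit A \<cdot> j\<rparr>"
    by unfold_locales (simp_all add: s)
  obtain t where t: "t \<in> hom C k k" "j \<cdot> t = antipode A \<cdot> j"
    by (rule X.antipode_arrow)
  have "psi_structure C A Q \<pi> j
    \<lparr>carr = k, comul = \<delta>, counit = counit A \<cdot> j, mul = \<mu>, unit_arr = \<eta>, antipode = t\<rparr>"
    by unfold_locales (simp_all add: s t)
  then show ?thesis by blast
qed

section \<open>Isomorphism classes and the bijection\<close>

context exact_braided_category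
begin

context
  fixes A :: "('o, 'a) hopf_monoid"
  assumes A [simp]: "is_cocomm_hopf_monoid C A"
begin

abbreviation "\<H> \<equiv> Hopf_coc C"
abbreviation "\<Q> \<equiv> Comon_coc C A"

lemma hopf_arrowI: "I \<in> Arr \<H> \<Longrightarrow> tgt I = A \<Longrightarrow> hopf_arrow C A (src I) (und I)"
  by unfold_locales simp_all

lemma phi_arrowI:
  "I \<in> Arr \<H> \<Longrightarrow> tgt I = A \<Longrightarrow> is_phi C A I \<pi> \<Longrightarrow> phi_arrow C A (src I) (und I) \<pi>"
  by (intro phi_arrow.intro hopf_arrowI exact_braided_category_axioms phi_arrow_axioms.intro)
    (simp_all add: is_phi_def Let_def)

lemma module_quotientI:
  "p \<in> Arr \<Q> \<Longrightarrow> src p = regular A \<Longrightarrow> module_quotient C A (tgt p) (und p)"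
  by unfold_locales (simp_all add: comonoid_morphism_def)

lemma psi_arrowI:
  "p \<in> Arr \<Q> \<Longrightarrow> src p = regular A \<Longrightarrow> is_psi C A (und p) j \<Longrightarrow>
    psi_arrow C A (tgt p) (und p) j"
  by (intro psi_arrow.intro module_quotientI exact_braided_category_axioms psi_arrow_axioms.intro)
    (simp_all add: is_psi_def Let_def)

lemma phi_exists:
  assumes "I \<in> Arr \<H>" "tgt I = A"
  shows "\<exists>\<pi>. is_phi C A I \<pi>"
proof -
  interpret hopf_arrow C A "src I" "und I" by (rule hopf_arrowI[OF assms])
  have "mul A \<cdot> (\<I> a \<otimes> und I) \<in> hom C (a *. k) a" "\<r> a \<cdot> (\<I> a \<otimes> counit (src I)) \<in> hom C (a *. k) a"
    using Comp_hom[OF tensor_hom[OF Ident_hom[OF comonoid_hom(1)] i_hom] hopf_hom(1)]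
      Comp_hom[OF tensor_hom[OF Ident_hom[OF comonoid_hom(1)] comonoid_hom(3)] runit_hom, of A "src I"]
    by simp_all
  then have "parallel C (mul A \<cdot> (\<I> a \<otimes> und I)) (\<r> a \<cdot> (\<I> a \<otimes> counit (src I)))"
    by (simp add: parallel_def hom_def)
  then show ?thesis
    using coequalizers by (auto simp: has_coequalizers_def is_phi_def Let_def)
qed

lemma psi_exists:
  assumes "p \<in> Arr \<Q>" "src p = regular A"
  shows "\<exists>j. is_psi C A (und p) j"
proof -
  interpret module_quotient C A "tgt p" "und p" by (rule module_quotientI[OF assms])
  have "(und p \<otimes> \<I> a) \<cdot> comul A \<in> hom C a (q *. a)"
    by (rule Comp_hom[OF comonoid_hom(2) tensor_hom]) (auto simp: Ident_hom)
  moreover have "((und p \<cdot> unit_arr A) \<otimes> \<I> a) \<cdot> inv_arr C (\<l> a) \<in> hom C a (q *. a)"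
    using tr_hom[OF tr_lunit_inv_Leaf, of a]
    by (intro Comp_hom[OF _ tensor_hom[OF Comp_hom[OF hopf_hom(2)] Ident_hom]]) auto
  ultimately have "parallel C ((und p \<otimes> \<I> a) \<cdot> comul A) (((und p \<cdot> unit_arr A) \<otimes> \<I> a) \<cdot> inv_arr C (\<l> a))"
    by (simp add: parallel_def hom_def)
  then show ?thesis
    using equalizers by (auto simp: has_equalizers_def is_psi_def Let_def)
qed

text \<open>The induced structure is the only one, since \<pi> is epic and so is
  \<open>\<I> a \<otimes> \<pi>\<close>, on which the action is tested.\<close>

lemma phi_structure_unique:
  assumes I: "I \<in> Arr \<H>" "tgt I = A" and phi: "is_phi C A I \<pi>"
  shows "\<exists>!Q. carr Q = Cod C \<pi> \<and> SArr (regular A) \<pi> Q \<in> Arr \<Q>"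
proof -
  interpret phi_arrow C A "src I" "und I" \<pi> by (rule phi_arrowI[OF assms])
  obtain \<delta> e l where s: "\<delta> \<in> hom C q (q *. q)" "\<delta> \<cdot> \<pi> = (\<pi> \<otimes> \<pi>) \<cdot> comul A"
    "e \<in> hom C q \<one>" "e \<cdot> \<pi> = counit A" "l \<in> hom C (a *. q) q" "l \<cdot> (\<I> a \<otimes> \<pi>) = \<pi> \<cdot> mul A"
    by (rule quotient_arrows)
  define Q where "Q = \<lparr>carr = q, comul = \<delta>, counit = e, act = l\<rparr>"
  interpret phi_structure C A "src I" "und I" \<pi> Q
    by unfold_locales (simp_all add: Q_def s)
  have "SArr (regular A) \<pi> Q \<in> Arr \<Q>"
    using Q_module_comonoid regular_module_comonoid[OF A] s
    by (simp add: comonoid_morphism_def left_linear_def Q_def)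
  moreover have "Q' = Q" if Q': "carr Q' = q" "SArr (regular A) \<pi> Q' \<in> Arr \<Q>" for Q'
  proof -
    have h: "comul Q' \<in> hom C q (q *. q)" "counit Q' \<in> hom C q \<one>" "act Q' \<in> hom C (a *. q) q"
      using Q' comonoid_hom[of Q'] by (auto simp: is_cocomm_module_comonoid_def left_module_def)
    have e: "comul Q' \<cdot> \<pi> = (\<pi> \<otimes> \<pi>) \<cdot> comul A" "counit Q' \<cdot> \<pi> = counit A" "act Q' \<cdot> (\<I> a \<otimes> \<pi>) = \<pi> \<cdot> mul A"
      using Q' by (simp_all add: comonoid_morphism_def left_linear_def)
    have co: "is_coequalizer C (\<I> a \<otimes> (mul A \<cdot> (\<I> a \<otimes> und I))) (\<I> a \<otimes> (\<r> a \<cdot> (\<I> a \<otimes> counit (src I)))) (\<I> a \<otimes> \<pi>)"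
      using coeq coeq_tensor by (simp add: coequalizers_preserved_by_tensor_def)
    have c: "Cod C (\<I> a \<otimes> \<pi>) = a *. q"
      using tensor_hom[OF Ident_hom[OF comonoid_hom(1)] \<pi>_hom, of A] by (simp add: hom_def)
    have "comul Q' = \<delta>" "counit Q' = e" "act Q' = l"
      using coequalizer_epi[OF coeq h(1) s(1)] coequalizer_epi[OF coeq h(2) s(3)]
        coequalizer_epi[OF co, of "act Q'" q l q] h(3) c e s by simp_all
    then show ?thesis
      using Q'(1) by (simp add: Q_def)
  qed
  ultimately show ?thesis
    by (intro ex1I[of _ Q]) auto
qed

text \<open>Makes the results on the constructed \<open>K\<close> available for every arrow of Hopf
  monoids whose underlying arrow is such an equalizer.\<close>

lemma psi_structureI:
  assumes p: "p \<in> Arr \<Q>" "src p = regular A" and I: "I \<in> Arr \<H>" "tgt I = A"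
    and psi: "is_psi C A (und p) (und I)"
  shows "psi_structure C A (tgt p) (und p) (und I) (src I)"
proof -
  interpret hopf_arrow C A "src I" "und I" by (rule hopf_arrowI[OF I])
  interpret P: psi_arrow C A "tgt p" "und p" "und I" by (rule psi_arrowI[OF p psi])
  have d: "Dom C (und I) = carr (src I)" using i_hom by (simp add: hom_def)
  show ?thesis
    by unfold_locales
      (use I antipode_morphism hopf_hom[of "src I"] comonoid_hom[of "src I"] in
        \<open>simp_all add: d hopf_morphism_def comonoid_morphism_def\<close>)
qed

text \<open>All structure arrows are determined after the monic \<open>j\<close> or
  \<open>j \<otimes> j\<close>; for the antipode this rests on morphisms commuting with
  antipodes.\<close>

lemma psi_structure_unique:
  assumes p: "p \<in> Arr \<Q>" "src p = regular A" and psi: "is_psi C A (und p) j"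
  shows "\<exists>!K. carr K = Dom C j \<and> SArr K j A \<in> Arr \<H>"
proof -
  interpret psi_arrow C A "tgt p" "und p" j by (rule psi_arrowI[OF p psi])
  obtain K where K: "psi_structure C A (tgt p) (und p) j K"
    using psi_structure_exists by blast
  interpret K: psi_structure C A "tgt p" "und p" j K by (rule K)
  have "SArr K j A \<in> Arr \<H>"
    using K.K_hopf K.j_morphism by simp
  moreover have "K' = K" if K': "carr K' = k" "SArr K' j A \<in> Arr \<H>" for K'
  proof -
    interpret K': psi_structure C A "tgt p" "und p" j K'
      using psi_structureI[OF p K'(2)] psi by simp
    have "comul K' = comul K" "mul K' = mul K" "unit_arr K' = unit_arr K" "antipode K' = antipode K"
      using j_tensor_mono[of "comul K'" "comul K" k] K.comul_K K'.comul_K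
        equalizer_mono[OF eq K'.mul_K(1) K.mul_K(1)] K.mul_K K'.mul_K
        equalizer_mono[OF eq K'.unit_K(1) K.unit_K(1)] K.unit_K K'.unit_K
        equalizer_mono[OF eq K'.antipode_K(1) K.antipode_K(1)] K.antipode_K K'.antipode_K by simp_all
    then show ?thesis
      using K.counit_K K'.counit_K K'(1) K.carr_K by (intro hopf_monoid.equality) simp_all
  qed
  ultimately show ?thesis
    by (intro ex1I[of _ K]) auto
qed

lemma sub_condition_psi:
  assumes "I \<in> Arr \<H>" "tgt I = A" "is_phi C A I \<pi>"
  shows "sub_condition C A I \<longleftrightarrow> is_psi C A \<pi> (und I)"
proof -
  interpret phi_arrow C A "src I" "und I" \<pi> by (rule phi_arrowI[OF assms])
  show ?thesis
    using sub_condition_iff assms(2) by (cases I) simp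
qed

lemma quot_condition_phi:
  assumes p: "p \<in> Arr \<Q>" "src p = regular A" and I: "I \<in> Arr \<H>" "tgt I = A"
    and psi: "is_psi C A (und p) (und I)"
  shows "quot_condition C A (und p) \<longleftrightarrow> is_phi C A I (und p)"
proof -
  interpret psi_structure C A "tgt p" "und p" "und I" "src I" by (rule psi_structureI[OF assms])
  show ?thesis
    using quot_condition_iff I(2) by (cases I) simp
qed

text \<open>The comparison arrow of two equalizers of the same pair respects the Hopf structures
  because it does so after the monic \<open>und J\<close>.\<close>

lemma psi_factor:
  assumes p: "p \<in> Arr \<Q>" "src p = regular A"
    and I: "I \<in> Arr \<H>" "tgt I = A" "is_psi C A (und p) (und I)"
    and J: "J \<in> Arr \<H>" "tgt J = A" "is_psi C A (und p) (und J)"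
  shows "\<exists>t. SArr (src I) t (src J) \<in> Arr \<H> \<and> und J \<cdot> t = und I"
proof -
  interpret I: psi_structure C A "tgt p" "und p" "und I" "src I" by (rule psi_structureI[OF p I])
  interpret J: psi_structure C A "tgt p" "und p" "und J" "src J" by (rule psi_structureI[OF p J])
  note [simp] = I.K_hopf J.K_hopf
  obtain t where t: "t \<in> hom C I.k J.k" "und J \<cdot> t = und I"
    using is_equalizerD(8)[OF J.eq, of "und I"] is_equalizerD(3,6,7)[OF I.eq] by auto
  note [simp] = t(1)
  let ?T = "Hw I.k J.k t"
  have "\<forall>z \<in> Obj C. J.Jw z ** ?T z = I.Jw z"
    by (rule tr_eq_iff[THEN iffD1, OF _ _ t(2)]) (rule tr_Comp J.tr_j I.tr_j tr_Hw | simp)+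
  then have T: "J.Jw z ** ?T z = I.Jw z" if "z \<in> Obj C" for z
    using that by blast
  note r = T T[THEN pcomp_eq_tail] Hw_left I.Jw_hopf_rules J.Jw_hopf_rules pcomp_assoc
  have 1: "Dw (src J) z ** ?T z = ?T (J.k *. z) ** (I.k |> ?T z) ** Dw (src I) z" if [simp]: "z \<in> Obj C" for z
    by (rule J.Jw_mono2[of z])
      (simp_all add: r J.comul_Jw[symmetric, THEN pcomp_eq_tail, unfolded pcomp_assoc] I.comul_Jw)
  have 2: "Ew (src J) z ** ?T z = Ew (src I) z" if [simp]: "z \<in> Obj C" for z
    by (simp add: r J.counit_Jw[symmetric] I.counit_Jw[symmetric])
  have 3: "?T z ** Mw (src I) z = Mw (src J) z ** ?T (J.k *. z) ** (I.k |> ?T z)" if [simp]: "z \<in> Obj C" for z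
    by (rule J.Jw_mono[of z]) (simp_all add: r)
  have 4: "?T z ** Uw (src I) z = Uw (src J) z" if [simp]: "z \<in> Obj C" for z
    by (rule J.Jw_mono[of z]) (simp_all add: r)
  show ?thesis
    using 1 2 3 4 t(2) by (intro exI[of _ t]) (simp add: hopf_morphism_iff comonoid_morphism_iff)
qed

text \<open>Dually, the comparison of two coequalizers is a linear comonoid morphism because it is
  one after the epimorphism \<open>und p\<close>, tensored with \<open>A\<close> for
  linearity.\<close>

lemma phi_factor:
  assumes I: "I \<in> Arr \<H>" "tgt I = A"
    and p: "p \<in> Arr \<Q>" "src p = regular A" "is_phi C A I (und p)"
    and r: "r \<in> Arr \<Q>" "src r = regular A" "is_phi C A I (und r)"
  shows "\<exists>t. SArr (tgt p) t (tgt r) \<in> Arr \<Q> \<and> t \<cdot> und p = und r"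
proof -
  interpret P: phi_arrow C A "src I" "und I" "und p" by (rule phi_arrowI[OF I p(3)])
  interpret R: phi_arrow C A "src I" "und I" "und r" by (rule phi_arrowI[OF I r(3)])
  interpret P': module_quotient C A "tgt p" "und p" by (rule module_quotientI[OF p(1,2)])
  interpret R': module_quotient C A "tgt r" "und r" by (rule module_quotientI[OF r(1,2)])
  have q: "P.q = P'.q" "R.q = R'.q"
    using P'.\<pi>_hom R'.\<pi>_hom by (auto simp: hom_def)
  obtain t where t: "t \<in> hom C P'.q R'.q" "t \<cdot> und p = und r"
    using is_coequalizerD(8)[OF P.coeq, of "und r"] is_coequalizerD(3,6,7)[OF R.coeq] q by auto
  note [simp] = t(1)
  let ?T = "Hw P'.q R'.q t"
  have "\<forall>z \<in> Obj C. ?T z ** P'.Pw z = R'.Pw z"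
    by (rule tr_eq_iff[THEN iffD1, OF _ _ t(2)]) (rule tr_Comp P'.tr_\<pi> R'.tr_\<pi> tr_Hw | simp)+
  then have T: "?T z ** P'.Pw z = R'.Pw z" if "z \<in> Obj C" for z
    using that by blast
  note r = T T[THEN pcomp_eq_tail] Hw_right P'.Pw_rules R'.Pw_rules pcomp_assoc
  have 1: "Dw (tgt r) z ** ?T z = ?T (R'.q *. z) ** (P'.q |> ?T z) ** Dw (tgt p) z" if [simp]: "z \<in> Obj C" for z
    by (rule P.Pw_epi[unfolded q, of z]) (simp_all add: r)
  have 2: "Ew (tgt r) z ** ?T z = Ew (tgt p) z" if [simp]: "z \<in> Obj C" for z
    by (rule P.Pw_epi[unfolded q, of z]) (simp_all add: r)
  have 3: "?T z ** Lw A (tgt p) z = Lw A (tgt r) z ** (P'.a |> ?T z)" if [simp]: "z \<in> Obj C" for z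
    by (rule P.Pw_epi1[unfolded q, of z P'.a]) (simp_all add: r)
  show ?thesis
    using 1 2 3 t(2) by (intro exI[of _ t]) (simp add: left_linear_iff comonoid_morphism_iff)
qed

text \<open>The correspondence is established as a relation, since \<open>\<phi>\<close> and \<open>\<psi>\<close> are only determined up to
  isomorphism.\<close>

definition "corr I p \<longleftrightarrow> I \<in> Arr \<H> \<and> tgt I = A \<and> p \<in> Arr \<Q> \<and> src p = regular A \<and>
  is_phi C A I (und p) \<and> is_psi C A (und p) (und I)"

text \<open>An equalizer is monic in the base category, and an arrow of Hopf monoids is determined
  by its underlying arrow together with its source and target.\<close>

lemma psi_mono:
  assumes p: "p \<in> Arr \<Q>" "src p = regular A"
    and I: "I \<in> Arr \<H>" "tgt I = A" "is_psi C A (und p) (und I)"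
  shows "I \<in> monos_into \<H> A"
proof -
  interpret psi_structure C A "tgt p" "und p" "und I" "src I" by (rule psi_structureI[OF p I])
  have "g = h" if "g \<in> hom \<H> x (src I)" "h \<in> hom \<H> x (src I)" "und I \<cdot> und g = und I \<cdot> und h" for g h x
  proof -
    have "und g = und h"
      by (rule equalizer_mono[OF eq, of _ "carr x" _ "carr x"])
        (use that in \<open>auto simp: hom_def[of "Hopf_coc C"] hopf_morphism_def comonoid_morphism_def\<close>)
    then show ?thesis
      using that by (cases g; cases h) (auto simp: hom_def)
  qed
  then show ?thesis
    using I by (auto simp: monos_into_def is_mono_def)
qed

lemma phi_epi:
  assumes I: "I \<in> Arr \<H>" "tgt I = A"
    and p: "p \<in> Arr \<Q>" "src p = regular A" "is_phi C A I (und p)"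
  shows "p \<in> epis_from \<Q> (regular A)"
proof -
  interpret phi_arrow C A "src I" "und I" "und p" by (rule phi_arrowI[OF I p(3)])
  have q: "q = carr (tgt p)"
    using p(1) by (auto simp: comonoid_morphism_def hom_def)
  have "g = h" if "g \<in> hom \<Q> (tgt p) x" "h \<in> hom \<Q> (tgt p) x" "und g \<cdot> und p = und h \<cdot> und p" for g h x
  proof -
    have "und g = und h"
      by (rule coequalizer_epi[OF coeq, of _ "carr x" _ "carr x"])
        (use that q in \<open>auto simp: hom_def[of "Comon_coc C A"] comonoid_morphism_def\<close>)
    then show ?thesis
      using that by (cases g; cases h) (auto simp: hom_def)
  qed
  then show ?thesis
    using p by (auto simp: epis_from_def is_epi_def)
qed

text \<open>The factorizations in the two directions are mutually inverse, as can be seen after the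
  monic equalizers.\<close>

lemma mono_rel_psi:
  assumes p: "p \<in> Arr \<Q>" "src p = regular A"
    and I: "I \<in> Arr \<H>" "tgt I = A" "is_psi C A (und p) (und I)"
    and J: "J \<in> Arr \<H>" "tgt J = A" "is_psi C A (und p) (und J)"
  shows "(I, J) \<in> mono_rel \<H> A"
proof -
  interpret I: psi_structure C A "tgt p" "und p" "und I" "src I" by (rule psi_structureI[OF p I])
  interpret J: psi_structure C A "tgt p" "und p" "und J" "src J" by (rule psi_structureI[OF p J])
  obtain t where t: "SArr (src I) t (src J) \<in> Arr \<H>" "und J \<cdot> t = und I"
    using psi_factor[OF p I J] by blast
  obtain s where s: "SArr (src J) s (src I) \<in> Arr \<H>" "und I \<cdot> s = und J"
    using psi_factor[OF p J I] by blast
  have h: "t \<in> hom C I.k J.k" "s \<in> hom C J.k I.k"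
    using t s by (auto simp: hopf_morphism_def comonoid_morphism_def)
  have "s \<cdot> t = \<I> I.k"
    using equalizer_mono[OF I.eq Comp_hom[OF h] Ident_hom[OF I.k_Obj]]
      Comp_assoc[OF h I.j_hom] Comp_Ident[OF I.j_hom] s t by simp
  moreover have "t \<cdot> s = \<I> J.k"
    using equalizer_mono[OF J.eq Comp_hom[OF h(2,1)] Ident_hom[OF J.k_Obj]]
      Comp_assoc[OF h(2,1) J.j_hom] Comp_Ident[OF J.j_hom] s t by simp
  ultimately have "inverse_arrows \<H> (SArr (src I) t (src J)) (SArr (src J) s (src I))"
    using t s by (simp add: inverse_arrows_def hom_def[of "Hopf_coc C"])
  then have "is_iso \<H> (SArr (src I) t (src J))"
    by (auto simp: is_iso_def)
  moreover have "SArr (src I) t (src J) \<in> hom \<H> (src I) (src J)"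
    using t by (simp add: hom_def[of "Hopf_coc C"])
  moreover have "SArr (src I) (und J \<cdot> t) (tgt J) = I"
    using t(2) I(2) J(2) by (cases I) simp
  ultimately show ?thesis
    using psi_mono[OF p I] psi_mono[OF p J] unfolding mono_rel_def
    by (simp only: mem_Collect_eq case_prod_conv Hopf_coc_simps) (metis sarr.sel)
qed

lemma epi_rel_phi:
  assumes I: "I \<in> Arr \<H>" "tgt I = A"
    and p: "p \<in> Arr \<Q>" "src p = regular A" "is_phi C A I (und p)"
    and r: "r \<in> Arr \<Q>" "src r = regular A" "is_phi C A I (und r)"
  shows "(p, r) \<in> epi_rel \<Q> (regular A)"
proof -
  interpret P: phi_arrow C A "src I" "und I" "und p" by (rule phi_arrowI[OF I p(3)])
  interpret R: phi_arrow C A "src I" "und I" "und r" by (rule phi_arrowI[OF I r(3)])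
  have q: "P.q = carr (tgt p)" "R.q = carr (tgt r)"
    using p(1) r(1) by (auto simp: comonoid_morphism_def hom_def)
  obtain t where t: "SArr (tgt p) t (tgt r) \<in> Arr \<Q>" "t \<cdot> und p = und r"
    using phi_factor[OF I p r] by blast
  obtain s where s: "SArr (tgt r) s (tgt p) \<in> Arr \<Q>" "s \<cdot> und r = und p"
    using phi_factor[OF I r p] by blast
  have h: "t \<in> hom C P.q R.q" "s \<in> hom C R.q P.q"
    using t s q by (auto simp: comonoid_morphism_def)
  have "s \<cdot> t = \<I> P.q"
    using coequalizer_epi[OF P.coeq Comp_hom[OF h] Ident_hom[OF P.q_Obj]]
      Comp_assoc[OF P.\<pi>_hom h] Ident_Comp[OF P.\<pi>_hom] s t by simp
  moreover have "t \<cdot> s = \<I> R.q"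
    using coequalizer_epi[OF R.coeq Comp_hom[OF h(2,1)] Ident_hom[OF R.q_Obj]]
      Comp_assoc[OF R.\<pi>_hom h(2,1)] Ident_Comp[OF R.\<pi>_hom] s t by simp
  ultimately have "inverse_arrows \<Q> (SArr (tgt p) t (tgt r)) (SArr (tgt r) s (tgt p))"
    using t s q by (simp add: inverse_arrows_def hom_def[of "Comon_coc C A"])
  then have "is_iso \<Q> (SArr (tgt p) t (tgt r))"
    by (auto simp: is_iso_def)
  moreover have "SArr (tgt p) t (tgt r) \<in> hom \<Q> (tgt p) (tgt r)"
    using t by (simp add: hom_def[of "Comon_coc C A"])
  moreover have "SArr (src p) (t \<cdot> und p) (tgt r) = r"
    using t(2) p(2) r(2) by (cases r) simp
  ultimately show ?thesis
    using phi_epi[OF I p] phi_epi[OF I r] unfolding epi_rel_def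
    by (simp only: mem_Collect_eq case_prod_conv Comon_coc_simps) (metis sarr.sel)
qed

lemma corr_mono_rel:
  assumes c: "corr I p" and r: "(I, J) \<in> mono_rel \<H> A"
  shows "corr J p"
proof -
  obtain T where T: "T \<in> hom \<H> (src I) (src J)" "is_iso \<H> T"
    "Comp \<H> J T = I" and J: "J \<in> Arr \<H>" "tgt J = A"
    using r by (auto simp: mono_rel_def monos_into_def is_mono_def)
  obtain S where S: "inverse_arrows \<H> T S"
    using T(2) by (auto simp: is_iso_def)
  define t s where "t = und T" and "s = und S"
  have h: "t \<in> hom C (carr (src I)) (carr (src J))" "s \<in> hom C (carr (src J)) (carr (src I))"
      "und J \<in> hom C (carr (src J)) (carr A)"
    and e0: "t \<cdot> s = \<I> (carr (src J))" "s \<cdot> t = \<I> (carr (src I))"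
    using T S J by (auto simp: inverse_arrows_def hom_def[of "Hopf_coc C"] hopf_morphism_def
        comonoid_morphism_def t_def s_def)
  have "und J \<cdot> t = und I"
    using arg_cong[OF T(3), of und] by (simp add: t_def)
  note e = e0 this
  have "und J = und I \<cdot> s"
    using Comp_assoc[OF h(2,1,3)] e Comp_Ident[OF h(3)] by simp
  then have J': "Some (und J) = Some (und I) ** Some s"
    using Some_Comp[OF h(2), of "und I"] Comp_hom[OF h(1,3)] e by simp
  have "oiso (Some s)"
    by (rule oisoI[of _ "Some t"]) (use h e Some_Comp[OF h(1,2)] Some_Comp[OF h(2,1)] in \<open>auto simp: hom_def oid_def Dom_Obj dest: Dom_Obj\<close>)
  moreover have "ocod (Some s) = odom (Some (und I))"
    using h e Comp_hom[OF h(1,3)] by (auto simp: hom_def)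
  ultimately have "is_psi C A (und p) (und J)"
    using c oeq_precomp_iso[of _ _ "Some (und I)" "Some s"] unfolding corr_def is_psi_def Let_def J'[symmetric] oeq_Some[symmetric]
    by blast
  \<comment> \<open>Only the equalizer property is transported along the isomorphism. Given it,
    being \<phi> of the subobject is equivalent to \<open>quot_condition\<close>, which mentions the
    quotient alone.\<close>
  then show ?thesis
    using c J quot_condition_phi[of p I] quot_condition_phi[of p J] unfolding corr_def by blast
qed

lemma corr_epi_rel:
  assumes c: "corr I p" and r: "(p, r) \<in> epi_rel \<Q> (regular A)"
  shows "corr I r"
proof -
  obtain T where T: "T \<in> hom \<Q> (tgt p) (tgt r)" "is_iso \<Q> T"
    "Comp \<Q> T p = r" and R: "r \<in> Arr \<Q>" "src r = regular A"
    using r by (auto simp: epi_rel_def epis_from_def is_epi_def)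
  obtain S where S: "inverse_arrows \<Q> T S"
    using T(2) by (auto simp: is_iso_def)
  have p: "p \<in> Arr \<Q>" "src p = regular A"
    using c by (simp_all only: corr_def)
  define t s where "t = und T" and "s = und S"
  have h: "t \<in> hom C (carr (tgt p)) (carr (tgt r))" "s \<in> hom C (carr (tgt r)) (carr (tgt p))"
      "und p \<in> hom C (carr A) (carr (tgt p))"
    and e0: "t \<cdot> s = \<I> (carr (tgt r))" "s \<cdot> t = \<I> (carr (tgt p))"
    using T S p by (auto simp: inverse_arrows_def hom_def[of "Comon_coc C A"]
        comonoid_morphism_def t_def s_def)
  have "t \<cdot> und p = und r"
    using arg_cong[OF T(3), of und] by (simp add: t_def)
  note e = e0 this
  have R': "Some (und r) = Some t ** Some (und p)"
    using Some_Comp[OF h(3,1)] e by simp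
  have "oiso (Some t)"
    by (rule oisoI[of _ "Some s"]) (use h e Some_Comp[OF h(1,2)] Some_Comp[OF h(2,1)] in \<open>auto simp: hom_def oid_def dest: Dom_Obj\<close>)
  moreover have "odom (Some t) = ocod (Some (und p))"
    using h by (auto simp: hom_def)
  ultimately have "is_phi C A I (und r)"
    using c ocoeq_postcomp_iso[of _ _ "Some (und p)" "Some t"] unfolding corr_def is_phi_def Let_def R'[symmetric] ocoeq_Some[symmetric]
    by blast
  \<comment> \<open>Dually, \<open>sub_condition\<close> mentions the subobject alone, so the
    equalizer property passes from \<open>p\<close> to \<open>r\<close>.\<close>
  then show ?thesis
    using c R sub_condition_psi[of I "und p"] sub_condition_psi[of I "und r"] unfolding corr_def by blast
qed

text \<open>The partner is the coequalizer \<phi>(I) with its induced structure; condition 1)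
  supplies the missing equalizer property.\<close>

lemma sub_condition_corr:
  assumes "I \<in> Arr \<H>" "tgt I = A"
  shows "sub_condition C A I \<longleftrightarrow> (\<exists>p. corr I p)"
proof
  assume sub: "sub_condition C A I"
  obtain \<pi> where \<pi>: "is_phi C A I \<pi>"
    using phi_exists[OF assms] by blast
  obtain Q where "SArr (regular A) \<pi> Q \<in> Arr \<Q>"
    using phi_structure_unique[OF assms \<pi>] by blast
  then have "corr I (SArr (regular A) \<pi> Q)"
    using sub \<pi> assms sub_condition_psi[OF assms \<pi>] by (simp add: corr_def)
  then show "\<exists>p. corr I p" by blast
next
  assume "\<exists>p. corr I p"
  then show "sub_condition C A I"
    using sub_condition_psi[OF assms] by (auto simp only: corr_def)
qed

lemma quot_condition_corr:
  assumes "p \<in> Arr \<Q>" "src p = regular A"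
  shows "quot_condition C A (und p) \<longleftrightarrow> (\<exists>I. corr I p)"
proof
  assume quot: "quot_condition C A (und p)"
  obtain j where j: "is_psi C A (und p) j"
    using psi_exists[OF assms] by blast
  obtain K where K: "SArr K j A \<in> Arr \<H>"
    using psi_structure_unique[OF assms j] by blast
  have "corr (SArr K j A) p"
    using quot j K assms quot_condition_phi[OF assms K] by (simp add: corr_def)
  then show "\<exists>I. corr I p" by blast
next
  assume "\<exists>I. corr I p"
  then show "quot_condition C A (und p)"
    using quot_condition_phi[OF assms] by (auto simp only: corr_def)
qed

lemma mono_rel_refl: "refl_on (monos_into \<H> A) (mono_rel \<H> A)"
proof (rule refl_onI)
  fix I assume I: "I \<in> monos_into \<H> A"
  then have K: "is_cocomm_hopf_monoid C (src I)" and h: "und I \<in> hom C (carr (src I)) (carr (tgt I))"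
    by (auto simp: monos_into_def is_mono_def hopf_morphism_def comonoid_morphism_def)
  have m: "mul (src I) \<in> hom C (carr (src I) *. carr (src I)) (carr (src I))"
      "unit_arr (src I) \<in> hom C \<one> (carr (src I))" "carr (src I) \<in> Obj C"
    using K by simp_all
  let ?t = "SArr (src I) (\<I> (carr (src I))) (src I)"
  have t: "?t \<in> hom \<H> (src I) (src I)"
    using K m comonoid_morphism_Ident[of "src I"] Ident_Comp[OF m(1)] Comp_Ident[OF m(1)] Ident_Comp[OF m(2)]
    by (simp add: hom_def[of \<H>] hopf_morphism_def tensor_Ident)
  moreover have "is_iso \<H> ?t"
    unfolding is_iso_def inverse_arrows_def
    by (rule exI[of _ ?t]) (use t Comp_Ident[OF Ident_hom[OF m(3)]] in \<open>simp add: hom_def[of \<H>]\<close>)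
  moreover have "SArr (src I) (und I \<cdot> \<I> (carr (src I))) (tgt I) = I"
    using Comp_Ident[OF h] by simp
  ultimately show "(I, I) \<in> mono_rel \<H> A"
    using I unfolding mono_rel_def
    by (simp only: mem_Collect_eq case_prod_conv Hopf_coc_simps) (metis sarr.sel)
qed

lemma epi_rel_refl: "refl_on (epis_from \<Q> (regular A)) (epi_rel \<Q> (regular A))"
proof (rule refl_onI)
  fix p assume p: "p \<in> epis_from \<Q> (regular A)"
  then have Q: "is_cocomm_module_comonoid C A (tgt p)" and h: "und p \<in> hom C (carr (src p)) (carr (tgt p))"
    by (auto simp: epis_from_def is_epi_def comonoid_morphism_def)
  have c: "is_cocomm_comonoid C (tgt p)" and t: "module_typed A (tgt p)"
    using module_comonoid[OF Q] module_comonoid_typed[OF A Q] by auto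
  have m: "act (tgt p) \<in> hom C (carr A *. carr (tgt p)) (carr (tgt p))" "carr (tgt p) \<in> Obj C" "carr A \<in> Obj C"
    using t c by simp_all
  let ?t = "SArr (tgt p) (\<I> (carr (tgt p))) (tgt p)"
  have t: "?t \<in> hom \<Q> (tgt p) (tgt p)"
    using Q m comonoid_morphism_Ident[OF c] Ident_Comp[OF m(1)] Comp_Ident[OF m(1)]
    by (simp add: hom_def[of \<Q>] left_linear_def tensor_Ident)
  moreover have "is_iso \<Q> ?t"
    unfolding is_iso_def inverse_arrows_def
    by (rule exI[of _ ?t]) (use t Comp_Ident[OF Ident_hom[OF m(2)]] in \<open>simp add: hom_def[of \<Q>]\<close>)
  moreover have "SArr (src p) (\<I> (carr (tgt p)) \<cdot> und p) (tgt p) = p"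
    using Ident_Comp[OF h] by simp
  ultimately show "(p, p) \<in> epi_rel \<Q> (regular A)"
    using p unfolding epi_rel_def
    by (simp only: mem_Collect_eq case_prod_conv Comon_coc_simps) (metis sarr.sel)
qed

lemma equalizer_subobjects_corr:
  "equalizer_subobjects C A =
    {X \<in> monos_into \<H> A // mono_rel \<H> A. \<forall>I \<in> X. \<exists>p. corr I p}"
proof -
  have "I \<in> Arr \<H> \<and> tgt I = A"
    if "X \<in> monos_into \<H> A // mono_rel \<H> A" "I \<in> X" for X I
    using that by (auto elim!: quotientE simp: mono_rel_def monos_into_def is_mono_def)
  then show ?thesis
    using sub_condition_corr by (auto simp only: equalizer_subobjects_def subobjects_def mono_rel_def[symmetric])
qed

lemma coequalizer_quotients_corr:
  "coequalizer_quotients C A =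
    {Y \<in> epis_from \<Q> (regular A) // epi_rel \<Q> (regular A). \<forall>p \<in> Y. \<exists>I. corr I p}"
proof -
  have "p \<in> Arr \<Q> \<and> src p = regular A"
    if "Y \<in> epis_from \<Q> (regular A) // epi_rel \<Q> (regular A)" "p \<in> Y" for Y p
    using that by (auto elim!: quotientE simp: epi_rel_def epis_from_def is_epi_def)
  then show ?thesis
    using quot_condition_corr by (auto simp only: coequalizer_quotients_def quotients_def epi_rel_def[symmetric])
qed

text \<open>\<open>phi\<close> records only that the projection is a \<phi>(I). Where condition 1)
  holds, the other half of \<open>corr\<close> follows.\<close>

lemma phi_corr:
  assumes "\<And>I. I \<in> X \<Longrightarrow> \<exists>p. corr I p"
  shows "phi C A X = {p. \<exists>I \<in> X. corr I p}"
proof -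
  have "is_psi C A (und p) (und I)" if "I \<in> X" "is_phi C A I (und p)" for I p
    using assms[OF that(1)] that(2) sub_condition_corr[of I] sub_condition_psi[of I "und p"]
    by (auto simp only: corr_def)
  then show ?thesis
    using assms by (auto simp only: phi_def corr_def)
qed

lemma psi_corr:
  assumes "\<And>p. p \<in> Y \<Longrightarrow> \<exists>I. corr I p"
  shows "psi C A Y = {I. \<exists>p \<in> Y. corr I p}"
proof -
  have "is_phi C A I (und p)" if "p \<in> Y" "I \<in> Arr \<H>" "tgt I = A" "is_psi C A (und p) (und I)" for I p
    using assms[OF that(1)] that quot_condition_corr[of p] quot_condition_phi[of p I]
    by (auto simp only: corr_def)
  then show ?thesis
    using assms by (auto simp only: psi_def corr_def)
qed

lemma corr_memb: "corr I p \<Longrightarrow> I \<in> monos_into \<H> A \<and> p \<in> epis_from \<Q> (regular A)"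
  using psi_mono[of p I] phi_epi[of I p] by (auto simp only: corr_def)

lemma phi_correspondence:
  assumes X: "X \<in> equalizer_subobjects C A"
  shows "phi C A X \<in> coequalizer_quotients C A" "psi C A (phi C A X) = X"
proof -
  have X': "X \<in> monos_into \<H> A // mono_rel \<H> A" "\<And>I. I \<in> X \<Longrightarrow> \<exists>p. corr I p"
    using X by (auto simp only: equalizer_subobjects_corr)
  have L: "p \<in> epis_from \<Q> (regular A)" if "corr I p" for I p
    using corr_memb[OF that] by blast
  have L3: "(p, p') \<in> epi_rel \<Q> (regular A)" if "corr I p" "corr I p'" for I p p'
    using that epi_rel_phi[of I p p'] by (auto simp only: corr_def)
  have L4: "(I, I') \<in> mono_rel \<H> A" if "corr I p" "corr I' p" for I I' p
    using that mono_rel_psi[of p I I'] by (auto simp only: corr_def)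
  have c: "{p. \<exists>I \<in> X. corr I p} \<in> epis_from \<Q> (regular A) // epi_rel \<Q> (regular A)"
    "{I. \<exists>p \<in> {p. \<exists>I \<in> X. corr I p}. corr I p} = X"
    by (rule quotient_correspondence(1)[where L = corr, OF mono_rel_refl]
          quotient_correspondence(2)[where L = corr, OF mono_rel_refl];
        fact L corr_mono_rel corr_epi_rel L3 L4 X')+
  have eq: "phi C A X = {p. \<exists>I \<in> X. corr I p}"
    by (rule phi_corr) (rule X'(2))
  show "phi C A X \<in> coequalizer_quotients C A"
    using c(1) by (simp only: eq coequalizer_quotients_corr) blast
  have "psi C A (phi C A X) = {I. \<exists>p \<in> phi C A X. corr I p}"
    by (rule psi_corr) (auto simp only: eq)
  then show "psi C A (phi C A X) = X"
    using c(2) by (simp only: eq)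
qed

lemma psi_correspondence:
  assumes Y: "Y \<in> coequalizer_quotients C A"
  shows "psi C A Y \<in> equalizer_subobjects C A" "phi C A (psi C A Y) = Y"
proof -
  have Y': "Y \<in> epis_from \<Q> (regular A) // epi_rel \<Q> (regular A)"
      "\<And>p. p \<in> Y \<Longrightarrow> \<exists>I. corr I p"
    using Y by (auto simp only: coequalizer_quotients_corr)
  have L3: "(p, p') \<in> epi_rel \<Q> (regular A)" if "corr I p" "corr I p'" for I p p'
    using that epi_rel_phi[of I p p'] by (auto simp only: corr_def)
  have L4: "(I, I') \<in> mono_rel \<H> A" if "corr I p" "corr I' p" for I I' p
    using that mono_rel_psi[of p I I'] by (auto simp only: corr_def)
  have L: "I \<in> monos_into \<H> A" if "corr I p" for I p
    using corr_memb[OF that] by blast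
  \<comment> \<open>The same matching of classes, applied to the converse of
    \<open>corr\<close>.\<close>
  have c: "{I. \<exists>p \<in> Y. corr I p} \<in> monos_into \<H> A // mono_rel \<H> A"
    "{p. \<exists>I \<in> {I. \<exists>p \<in> Y. corr I p}. corr I p} = Y"
    by (rule quotient_correspondence(1)[where L = "\<lambda>p I. corr I p", OF epi_rel_refl]
          quotient_correspondence(2)[where L = "\<lambda>p I. corr I p", OF epi_rel_refl];
        fact L corr_mono_rel corr_epi_rel L3 L4 Y')+
  have eq: "psi C A Y = {I. \<exists>p \<in> Y. corr I p}"
    by (rule psi_corr) (rule Y'(2))
  show "psi C A Y \<in> equalizer_subobjects C A"
    using c(1) by (simp only: eq equalizer_subobjects_corr) blast
  have "phi C A (psi C A Y) = {p. \<exists>I \<in> psi C A Y. corr I p}"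
    by (rule phi_corr) (auto simp only: eq)
  then show "phi C A (psi C A Y) = Y"
    using c(2) by (simp only: eq)
qed

end
end

theorem theorem5p4:
  fixes M :: "('o, 'a) braided_category"
    and A :: "('o, 'a) hopf_monoid"
  assumes "braided_monoidal_category M"
    and "has_equalizers M" and "equalizers_preserved_by_tensor M"
    and "has_coequalizers M" and "coequalizers_preserved_by_tensor M"
    and "A \<in> Obj (Hopf_coc M)"
  shows "(\<forall>X \<in> equalizer_subobjects M A. \<forall>i \<in> X. \<forall>\<pi>. is_phi M A i \<pi> \<longrightarrow>
           (\<exists>!Q. carr Q = Cod M \<pi> \<and> SArr (regular A) \<pi> Q \<in> Arr (Comon_coc M A)))
       \<and> (\<forall>Y \<in> coequalizer_quotients M A. \<forall>p \<in> Y. \<forall>j. is_psi M A (und p) j \<longrightarrow>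
           (\<exists>!K. carr K = Dom M j \<and> SArr K j A \<in> Arr (Hopf_coc M)))
       \<and> bij_betw (phi M A) (equalizer_subobjects M A) (coequalizer_quotients M A)
       \<and> bij_betw (psi M A) (coequalizer_quotients M A) (equalizer_subobjects M A)
       \<and> (\<forall>X \<in> equalizer_subobjects M A. psi M A (phi M A X) = X)
       \<and> (\<forall>Y \<in> coequalizer_quotients M A. phi M A (psi M A Y) = Y)"
proof -
  interpret exact_braided_category M
    using assms by (intro exact_braided_category.intro exact_braided_category_axioms.intro)
  have A: "is_cocomm_hopf_monoid M A"
    using assms(6) by (simp add: Hopf_coc_def)
  note phi = phi_correspondence[OF A] and psi = psi_correspondence[OF A]
  have 1: "\<exists>!Q. carr Q = Cod M \<pi> \<and> SArr (regular A) \<pi> Q \<in> Arr (Comon_coc M A)"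
    if "X \<in> equalizer_subobjects M A" "i \<in> X" "is_phi M A i \<pi>" for X i \<pi>
    using that phi_structure_unique[OF A, of i \<pi>]
    by (auto simp only: equalizer_subobjects_corr[OF A] corr_def[OF A])
  have 2: "\<exists>!K. carr K = Dom M j \<and> SArr K j A \<in> Arr (Hopf_coc M)"
    if "Y \<in> coequalizer_quotients M A" "p \<in> Y" "is_psi M A (und p) j" for Y p j
    using that psi_structure_unique[OF A, of p j]
    by (auto simp only: coequalizer_quotients_corr[OF A] corr_def[OF A])
  have 3: "bij_betw (phi M A) (equalizer_subobjects M A) (coequalizer_quotients M A)"
    by (rule bij_betw_byWitness[where f' = "psi M A"]) (use phi psi in auto)
  have 4: "bij_betw (psi M A) (coequalizer_quotients M A) (equalizer_subobjects M A)"
    by (rule bij_betw_byWitness[where f' = "phi M A"]) (use phi psi in auto)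
  show ?thesis
    by (intro conjI ballI allI impI; (rule 1, assumption+ | rule 2, assumption+ | rule 3 | rule 4 |
      rule phi(2), assumption | rule psi(2), assumption))
qed

end
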